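(* Let $(R,\mathfrak{m})$ be a Noetherian local ring and $I$ an ideal of $R$. There exists $N>0$ such that for every ideal $J\subseteq R$ satisfying (i) $I+\mathfrak{m}^N=J+\mathfrak{m}^N$, (ii) $\dim(R/J)=\dim(R/I)=d$, (iii) $R/J$ is Cohen–Macaulay, (iv) $\operatorname{depth}\mathrm{gr}_{\mathfrak{m}}(R/J)\ge d-1$, the rings $R/I$ and $R/J$ have the same Hilbert function.
   Context: For an ideal $I$, $\mathrm{gr}_{\mathfrak{m}}(R/I)=\bigoplus_{n\ge0}\mathfrak{m}^n(R/I)/\mathfrak{m}^{n+1}(R/I)$, and the Hilbert function of $R/I$ is $n\mapsto\dim_k\mathfrak{m}^n(R/I)/\mathfrak{m}^{n+1}(R/I)$, $k=R/\mathfrak{m}$. The depth of $\mathrm{gr}_{\mathfrak{m}}(R/J)$ is taken with respect to its homogeneous maximal ideal. *)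

theory Defs
  imports "HOL-Algebra.QuotRing" "HOL-Algebra.Ring_Divisibility" "HOL-Library.Extended_Nat"
begin

definition local_ring :: "('a, 'b) ring_scheme \<Rightarrow> bool" where
  "local_ring A \<longleftrightarrow> cring A \<and> (\<exists>!M. maximalideal M A)"

definition noetherian_local_ring :: "('a, 'b) ring_scheme \<Rightarrow> bool" where
  "noetherian_local_ring A \<longleftrightarrow> noetherian_ring A \<and> local_ring A"

definition max_ideal :: "('a, 'b) ring_scheme \<Rightarrow> 'a set" where
  "max_ideal A = (THE M. maximalideal M A)"

definition ideal_mult :: "('a, 'b) ring_scheme \<Rightarrow> 'a set \<Rightarrow> 'a set \<Rightarrow> 'a set" where
  "ideal_mult A I J = genideal A {i \<otimes>\<^bsub>A\<^esub> j | i j. i \<in> I \<and> j \<in> J}"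

fun ideal_pow :: "('a, 'b) ring_scheme \<Rightarrow> 'a set \<Rightarrow> nat \<Rightarrow> 'a set" where
  "ideal_pow A I 0 = carrier A"
| "ideal_pow A I (Suc n) = ideal_mult A I (ideal_pow A I n)"

definition krull_dim :: "('a, 'b) ring_scheme \<Rightarrow> enat" where
  "krull_dim A = Sup {enat k | k. \<exists>P :: nat \<Rightarrow> 'a set.
      (\<forall>i\<le>k. primeideal (P i) A) \<and> (\<forall>i<k. P i \<subset> P (Suc i))}"

definition regular_seq :: "('a, 'b) ring_scheme \<Rightarrow> 'a set \<Rightarrow> 'a list \<Rightarrow> bool" where
  "regular_seq S Q xs \<longleftrightarrow> set xs \<subseteq> Q \<and>
     (\<forall>i<length xs. \<forall>y\<in>carrier S.
        (xs ! i) \<otimes>\<^bsub>S\<^esub> y \<in> genideal S (set (take i xs)) \<longrightarrow> y \<in> genideal S (set (take i xs))) \<and>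
     genideal S (set xs) \<noteq> carrier S"

definition depth :: "('a, 'b) ring_scheme \<Rightarrow> 'a set \<Rightarrow> enat" where
  "depth S Q = Sup {enat (length xs) | xs. regular_seq S Q xs}"

definition cohen_macaulay :: "('a, 'b) ring_scheme \<Rightarrow> bool" where
  "cohen_macaulay A \<longleftrightarrow> noetherian_local_ring A \<and> depth A (max_ideal A) = krull_dim A"

text \<open>gr_M(A) = direct sum of M^n/M^(n+1). The degree n component of an element is a coset
  M^(n+1) +> a with a in M^n (an element of A Quot M^(n+1)); elements have finite support.\<close>
definition gr_comp :: "('a, 'b) ring_scheme \<Rightarrow> 'a set \<Rightarrow> nat \<Rightarrow> 'a set set" where
  "gr_comp A M n = {ideal_pow A M (Suc n) +>\<^bsub>A\<^esub> a | a. a \<in> ideal_pow A M n}"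

definition gr_rep :: "'a set \<Rightarrow> 'a" where
  "gr_rep C = (SOME a. a \<in> C)"

definition gr_mult :: "('a, 'b) ring_scheme \<Rightarrow> 'a set \<Rightarrow> (nat \<Rightarrow> 'a set) \<Rightarrow> (nat \<Rightarrow> 'a set) \<Rightarrow> nat \<Rightarrow> 'a set" where
  "gr_mult A M f g n = finsum (A Quot (ideal_pow A M (Suc n)))
      (\<lambda>i. ideal_pow A M (Suc n) +>\<^bsub>A\<^esub> (gr_rep (f i) \<otimes>\<^bsub>A\<^esub> gr_rep (g (n - i)))) {..n}"

definition gr_carrier :: "('a, 'b) ring_scheme \<Rightarrow> 'a set \<Rightarrow> (nat \<Rightarrow> 'a set) set" where
  "gr_carrier A M = {f. (\<forall>n. f n \<in> gr_comp A M n) \<and> finite {n. f n \<noteq> ideal_pow A M (Suc n)}}"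

definition assoc_graded :: "('a, 'b) ring_scheme \<Rightarrow> 'a set \<Rightarrow> (nat \<Rightarrow> 'a set) ring" where
  "assoc_graded A M =
    \<lparr>carrier = gr_carrier A M,
      mult = gr_mult A M,
      one = (\<lambda>n. if n = 0 then ideal_pow A M (Suc 0) +>\<^bsub>A\<^esub> \<one>\<^bsub>A\<^esub> else ideal_pow A M (Suc n)),
      zero = (\<lambda>n. ideal_pow A M (Suc n)),
      add = (\<lambda>f g n. f n <+>\<^bsub>A\<^esub> g n)\<rparr>"

definition gr_hom_max_ideal :: "('a, 'b) ring_scheme \<Rightarrow> 'a set \<Rightarrow> (nat \<Rightarrow> 'a set) set" where
  "gr_hom_max_ideal A M = {f \<in> carrier (assoc_graded A M). f 0 = ideal_pow A M (Suc 0)}"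

definition depth_gr :: "('a, 'b) ring_scheme \<Rightarrow> enat" where
  "depth_gr A = depth (assoc_graded A (max_ideal A)) (gr_hom_max_ideal A (max_ideal A))"

text \<open>H_A(n) = dim_k m^n/m^(n+1), k = A/m. Since m annihilates m^n/m^(n+1), its k-dimension equals
  its length as an A-module, i.e. the supremum of lengths of strict chains of ideals of A from
  m^(n+1) to m^n.\<close>
definition hilbert_function :: "('a, 'b) ring_scheme \<Rightarrow> nat \<Rightarrow> enat" where
  "hilbert_function A n = Sup {enat k | k. \<exists>C :: nat \<Rightarrow> 'a set.
      C 0 = ideal_pow A (max_ideal A) (Suc n) \<and> C k = ideal_pow A (max_ideal A) n \<and>
      (\<forall>i\<le>k. ideal (C i) A) \<and> (\<forall>i<k. C i \<subset> C (Suc i))}"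

end

theory Submission
  imports Defs "HOL-Algebra.Ideal_Product" "HOL-Algebra.Ring_Divisibility" "HOL-Algebra.UnivPoly"
    "HOL-Algebra.Subrings"
begin

text \<open>
  If \<open>R/I\<close> has dimension \<open>d\<close>, repeated choice of superficial elements gives \<open>x\<^sub>i \<in> M^s\<^sub>i\<close>, \<open>1 \<le> i \<le> d\<close>,
  and \<open>r\<close> such that \<open>M^n \<subseteq> \<Sum>\<^sub>i x\<^sub>i M^(n - s\<^sub>i) + I\<close> and \<open>\<Prod>\<^sub>i (1 - T\<^sup>s\<^sup>i)\<close>, with \<open>T\<close> the shift, kills
  the Hilbert function of \<open>R/I\<close> in all degrees \<open>n \<ge> r\<close>.  Take \<open>N = r + 1\<close>.  By Nakayama's lemma the inclusion
  holds with \<open>J\<close> in place of \<open>I\<close>, so the \<open>x\<^sub>i\<close> generate an ideal of \<open>R/J\<close> that contains a power of the maximal ideal,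
  and their initial forms do the same in the associated graded ring.
  Depth sensitivity makes the Koszul complex of the \<open>x\<^sub>i\<close> over \<open>R/J\<close> exact in positive homological degrees, and
  that of the initial forms over the associated graded ring exact in homological degrees at least \<open>2\<close>; together
  with the inclusion this makes the latter exact in internal degree \<open>n \<ge> r\<close>.  Counting lengths, the same
  difference operator kills the Hilbert function of \<open>R/J\<close> in degrees \<open>n \<ge> r\<close>.  The two Hilbert functions agree
  below degree \<open>N\<close>, hence everywhere.
\<close>

section \<open>Lengths of subquotients\<close>

text \<open>The residue field may be finite, so superficial elements of order one need not exist.
  Homogeneous prime avoidance only yields elements of some order \<open>s\<close>; this is the
  origin of the weights \<open>ss\<close> and of the factors 1 - T^s. The data \<open>xs\<close>,
  \<open>ss\<close> and \<open>r\<close> are chosen from I alone, so N does not depend on J. Depth d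
  - 1 of the graded ring leaves homological degrees 0 and 1 of the graded Koszul complex open.
  Degree 0 is the inclusion itself. In degree 1 a graded cycle is a relation among the
  \<open>xs\<close> up to higher order. The inclusion changes it into an exact relation without
  disturbing its leading part, and the Cohen-Macaulay property makes that relation the boundary of a
  chain of uncontrolled order, which exactness in degree 2 replaces by one of the right order. The
  product of the graded ring is given through chosen representatives, so its ring structure and
  Koszul complex are taken from the Rees algebra. Filtrations are kept in R as ideals M^n + I, so
  that different ideals can be compared in one ring.\<close>

definition chain_len :: "'c set set \<Rightarrow> 'c set \<Rightarrow> 'c set \<Rightarrow> enat" where
  "chain_len L X Y = Sup {enat k | k. \<exists>C :: nat \<Rightarrow> 'c set.
      C 0 = X \<and> C k = Y \<and> (\<forall>i\<le>k. C i \<in> L) \<and> (\<forall>i<k. C i \<subset> C (Suc i))}"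

lemma chain_len_ge:
  assumes "C 0 = X" "C k = Y" "\<And>i. i \<le> k \<Longrightarrow> C i \<in> L" "\<And>i. i < k \<Longrightarrow> C i \<subset> C (Suc i)"
  shows "enat k \<le> chain_len L X Y"
  unfolding chain_len_def using assms by (intro Sup_upper) blast

lemma chain_len_le:
  assumes "\<And>k C. C 0 = X \<Longrightarrow> C k = Y \<Longrightarrow> \<forall>i\<le>k. C i \<in> L \<Longrightarrow> \<forall>i<k. C i \<subset> C (Suc i) \<Longrightarrow> enat k \<le> z"
  shows "chain_len L X Y \<le> z"
  unfolding chain_len_def using assms by (intro Sup_least) blast

lemma strict_chain_mono:
  fixes C :: "nat \<Rightarrow> 'c set"
  assumes "\<forall>i<k. C i \<subset> C (Suc i)" "i \<le> j" "j \<le> k"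
  shows "C i \<subseteq> C j"
  using assms(2,3)
proof (induction j rule: dec_induct)
  case (step n)
  then show ?case using assms(1) by (metis Suc_le_lessD less_imp_le order.trans psubset_imp_subset)
qed auto

lemma chain_len_map_le:
  assumes f: "\<And>Z. Z \<in> L \<Longrightarrow> X \<subseteq> Z \<Longrightarrow> Z \<subseteq> Y \<Longrightarrow> f Z \<in> L'"
    and mono: "\<And>A B. A \<in> L \<Longrightarrow> B \<in> L \<Longrightarrow> X \<subseteq> A \<Longrightarrow> A \<subset> B \<Longrightarrow> B \<subseteq> Y \<Longrightarrow> f A \<subset> f B"
    and ends: "f X = X'" "f Y = Y'"
  shows "chain_len L X Y \<le> chain_len L' X' Y'"
proof (rule chain_len_le)
  fix k and C :: "nat \<Rightarrow> 'a set"
  assume C: "C 0 = X" "C k = Y" "\<forall>i\<le>k. C i \<in> L" "\<forall>i<k. C i \<subset> C (Suc i)"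
  have b: "X \<subseteq> C i" "C i \<subseteq> Y" if "i \<le> k" for i
    using strict_chain_mono[OF C(4), of 0 i] strict_chain_mono[OF C(4), of i k] C(1,2) that by auto
  show "enat k \<le> chain_len L' X' Y'"
  proof (rule chain_len_ge[of "\<lambda>i. f (C i)"])
    show "f (C i) \<in> L'" if "i \<le> k" for i using f C(3) b that by auto
    show "f (C i) \<subset> f (C (Suc i))" if "i < k" for i
      using mono[of "C i" "C (Suc i)"] C(3,4) b[of i] b[of "Suc i"] that by auto
  qed (use C ends in auto)
qed

text \<open>Mutually inverse monotone maps between the intervals carry strict chains to strict
  chains in both directions. The element types may differ, as is required for comparing ideals of R
  with ideals of a quotient.\<close>

lemma chain_len_cong_iso:
  assumes "X \<in> L" "Y \<in> L" "X \<subseteq> Y" "X' \<in> L'" "Y' \<in> L'" "X' \<subseteq> Y'"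
    and f: "\<And>Z. Z \<in> L \<Longrightarrow> X \<subseteq> Z \<Longrightarrow> Z \<subseteq> Y \<Longrightarrow> f Z \<in> L' \<and> X' \<subseteq> f Z \<and> f Z \<subseteq> Y' \<and> g (f Z) = Z"
    and g: "\<And>Z. Z \<in> L' \<Longrightarrow> X' \<subseteq> Z \<Longrightarrow> Z \<subseteq> Y' \<Longrightarrow> g Z \<in> L \<and> X \<subseteq> g Z \<and> g Z \<subseteq> Y \<and> f (g Z) = Z"
    and fm: "\<And>A B. A \<subseteq> B \<Longrightarrow> f A \<subseteq> f B" and gm: "\<And>A B. A \<subseteq> B \<Longrightarrow> g A \<subseteq> g B"
  shows "chain_len L X Y = chain_len L' X' Y'"
proof (rule antisym)
  have fX: "f X = X'"
    using fm[of X "g X'"] g[of X'] f[of X] assms(1-6) by blast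
  have fY: "f Y = Y'"
    using fm[of "g Y'" Y] g[of Y'] f[of Y] assms(1-6) by blast
  have gX: "g X' = X" and gY: "g Y' = Y" using fX fY f assms(1-6) by auto
  show "chain_len L X Y \<le> chain_len L' X' Y'"
  proof (rule chain_len_map_le[of L X Y f])
    fix A B assume "A \<in> L" "B \<in> L" "X \<subseteq> A" "A \<subset> B" "B \<subseteq> Y"
    then have "g (f A) = A" "g (f B) = B" "f A \<subseteq> f B" "A \<noteq> B"
      using f[of A] f[of B] fm[of A B] by (meson order.trans psubset_imp_subset, meson order.trans psubset_imp_subset, blast+)
    then show "f A \<subset> f B" by (metis psubsetI)
  qed (use f fX fY in auto)
  show "chain_len L' X' Y' \<le> chain_len L X Y"
  proof (rule chain_len_map_le[of L' X' Y' g])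
    fix A B assume "A \<in> L'" "B \<in> L'" "X' \<subseteq> A" "A \<subset> B" "B \<subseteq> Y'"
    then have "f (g A) = A" "f (g B) = B" "g A \<subseteq> g B" "A \<noteq> B"
      using g[of A] g[of B] gm[of A B] by (meson order.trans psubset_imp_subset, meson order.trans psubset_imp_subset, blast+)
    then show "g A \<subset> g B" by (metis psubsetI)
  qed (use g gX gY in auto)
qed

text \<open>An infinite bound is trivial. A finite bound on all sums bounds each set separately,
  because both sets are nonempty; the sets are then finite and their suprema are maxima.\<close>

lemma Sup_enat_add_le:
  fixes S T :: "enat set"
  assumes "S \<noteq> {}" "T \<noteq> {}" "\<And>a b. a \<in> S \<Longrightarrow> b \<in> T \<Longrightarrow> a + b \<le> z"
  shows "Sup S + Sup T \<le> z"
proof (cases z)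
  case (enat m)
  have fin: "finite U" if "\<forall>a\<in>U. a \<le> enat m" for U :: "enat set"
    using that finite_enat_bounded by blast
  obtain a0 b0 where ab: "a0 \<in> S" "b0 \<in> T" using assms by blast
  have "\<forall>a\<in>S. a \<le> enat m"
  proof
    fix a assume "a \<in> S"
    then have "a + b0 \<le> enat m" using assms(3) ab enat by blast
    then show "a \<le> enat m" by (meson le_iff_add order_trans)
  qed
  moreover have "\<forall>b\<in>T. b \<le> enat m"
  proof
    fix b assume "b \<in> T"
    then have "a0 + b \<le> enat m" using assms(3) ab enat by blast
    then show "b \<le> enat m" by (metis add.commute le_iff_add order_trans)
  qed
  ultimately have "finite S" "finite T" using fin by auto
  then show ?thesis using assms by (simp add: Sup_enat_def)
qed auto

lemma chain_len_nonempty: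
  assumes "X \<in> L" "Y \<in> L" "X \<subseteq> Y"
  shows "{enat k | k. \<exists>C :: nat \<Rightarrow> 'c set.
      C 0 = X \<and> C k = Y \<and> (\<forall>i\<le>k. C i \<in> L) \<and> (\<forall>i<k. C i \<subset> C (Suc i))} \<noteq> {}"
proof (cases "X = Y")
  case True
  then show ?thesis using assms by (auto intro!: exI[of _ "0::nat"] exI[of _ "\<lambda>_. X"])
next
  case False
  then show ?thesis using assms
    by (auto intro!: exI[of _ "1::nat"] exI[of _ "\<lambda>i. if i = 0 then X else Y"])
qed

lemma chain_len_superadd:
  assumes "X \<in> L" "Y \<in> L" "Z \<in> L" "X \<subseteq> Y" "Y \<subseteq> Z"
  shows "chain_len L X Y + chain_len L Y Z \<le> chain_len L X Z"
  unfolding chain_len_def[of L X Y] chain_len_def[of L Y Z]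
proof (rule Sup_enat_add_le[OF chain_len_nonempty chain_len_nonempty], (rule assms)+)
  fix a b
  assume "a \<in> {enat k | k. \<exists>C. C 0 = X \<and> C k = Y \<and> (\<forall>i\<le>k. C i \<in> L) \<and> (\<forall>i<k. C i \<subset> C (Suc i))}"
    and "b \<in> {enat k | k. \<exists>C. C 0 = Y \<and> C k = Z \<and> (\<forall>i\<le>k. C i \<in> L) \<and> (\<forall>i<k. C i \<subset> C (Suc i))}"
  then obtain k C l D where k: "a = enat k" "C 0 = X" "C k = Y" "\<forall>i\<le>k. C i \<in> L" "\<forall>i<k. C i \<subset> C (Suc i)"
    and l: "b = enat l" "D 0 = Y" "D l = Z" "\<forall>i\<le>l. D i \<in> L" "\<forall>i<l. D i \<subset> D (Suc i)" by auto
  have "enat (k + l) \<le> chain_len L X Z"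
  proof (rule chain_len_ge[of "\<lambda>i. if i \<le> k then C i else D (i - k)"])
    show "(if i \<le> k then C i else D (i - k)) \<subset> (if Suc i \<le> k then C (Suc i) else D (Suc i - k))"
      if "i < k + l" for i
    proof (cases "i < k")
      case False
      then have "D (i - k) \<subset> D (Suc (i - k))" "i = k \<Longrightarrow> D 0 = C k" using k l that by auto
      then show ?thesis using False that by (cases "i = k") (auto simp: Suc_diff_le)
    qed (use k in auto)
  qed (use k l in auto)
  then show "a + b \<le> chain_len L X Z" using k l by simp
qed

text \<open>Steps at which the chain stands still are skipped. Intersecting a strict chain with a
  submodule, or adding a submodule to it, gives only a weakly increasing chain, and its strict steps
  are what has to be counted.\<close>

lemma weak_chain_le:
  assumes "\<And>i. i \<le> k \<Longrightarrow> D i \<in> L" "\<And>i. i < k \<Longrightarrow> D i \<subseteq> D (Suc i)"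
  shows "enat (card {i. i < k \<and> D i \<noteq> D (Suc i)}) \<le> chain_len L (D 0) (D k)"
  using assms
proof (induction k)
  case (Suc k)
  have sub: "D 0 \<subseteq> D i" if "i \<le> Suc k" for i using that
  proof (induction i)
    case (Suc i)
    then show ?case using Suc.prems \<open>\<And>i. i < Suc k \<Longrightarrow> D i \<subseteq> D (Suc i)\<close>[of i] by auto
  qed auto
  have IH: "enat (card {i. i < k \<and> D i \<noteq> D (Suc i)}) \<le> chain_len L (D 0) (D k)" using Suc by auto
  show ?case
  proof (cases "D k = D (Suc k)")
    case True
    then have "{i. i < Suc k \<and> D i \<noteq> D (Suc i)} = {i. i < k \<and> D i \<noteq> D (Suc i)}"
      using less_Suc_eq by auto
    then show ?thesis using IH True by simp
  next
    case False
    then have eq: "{i. i < Suc k \<and> D i \<noteq> D (Suc i)} = insert k {i. i < k \<and> D i \<noteq> D (Suc i)}"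
      using less_Suc_eq by auto
    have "enat 1 \<le> chain_len L (D k) (D (Suc k))"
      by (rule chain_len_ge[of "\<lambda>i. if i = 0 then D k else D (Suc k)"]) (use Suc.prems(1)[of k] Suc.prems(1)[of "Suc k"] Suc.prems(2)[of k] False in auto)
    then have "enat (card {i. i < k \<and> D i \<noteq> D (Suc i)}) + enat 1 \<le> chain_len L (D 0) (D k) + chain_len L (D k) (D (Suc k))"
      using IH add_mono by blast
    also have "\<dots> \<le> chain_len L (D 0) (D (Suc k))"
      using Suc.prems sub by (intro chain_len_superadd) auto
    finally show ?thesis unfolding eq by simp
  qed
qed (simp add: zero_enat_def[symmetric])

text \<open>Each step of a strict chain from \<open>X\<close> to \<open>Z\<close> stays strict after
  meeting with \<open>Y\<close> or after joining with \<open>Y\<close>; this is the modular law,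
  assumed as \<open>modular\<close>. The two projected chains together therefore count every step.
  \<open>J\<close> stands for the join with \<open>Y\<close>.\<close>

lemma chain_len_additive:
  assumes XYZ: "X \<in> L" "Y \<in> L" "Z \<in> L" "X \<subseteq> Y" "Y \<subseteq> Z"
    and meet: "\<And>A. A \<in> L \<Longrightarrow> A \<inter> Y \<in> L" and join: "\<And>A. A \<in> L \<Longrightarrow> J A \<in> L"
    and mono: "\<And>A B. A \<subseteq> B \<Longrightarrow> J A \<subseteq> J B" and ends: "J X = Y" "J Z = Z"
    and modular: "\<And>A B. A \<in> L \<Longrightarrow> B \<in> L \<Longrightarrow> A \<subseteq> B \<Longrightarrow> A \<inter> Y = B \<inter> Y \<Longrightarrow> J A = J B \<Longrightarrow> A = B"
  shows "chain_len L X Z = chain_len L X Y + chain_len L Y Z"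
proof (rule antisym)
  show "chain_len L X Z \<le> chain_len L X Y + chain_len L Y Z"
  proof (rule chain_len_le)
    fix k and C :: "nat \<Rightarrow> 'a set"
    assume C: "C 0 = X" "C k = Z" "\<forall>i\<le>k. C i \<in> L" "\<forall>i<k. C i \<subset> C (Suc i)"
    define S T where "S = {i. i < k \<and> C i \<inter> Y \<noteq> C (Suc i) \<inter> Y}" and "T = {i. i < k \<and> J (C i) \<noteq> J (C (Suc i))}"
    have "enat (card S) \<le> chain_len L (C 0 \<inter> Y) (C k \<inter> Y)"
      unfolding S_def by (rule weak_chain_le) (use C meet in auto)
    moreover have "enat (card T) \<le> chain_len L (J (C 0)) (J (C k))"
      unfolding T_def by (rule weak_chain_le) (use C join mono in \<open>auto simp: psubset_imp_subset\<close>)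
    moreover have "{..<k} \<subseteq> S \<union> T"
    proof
      fix i assume i: "i \<in> {..<k}"
      then have "C i \<subset> C (Suc i)" "C i \<in> L" "C (Suc i) \<in> L" using C by auto
      then show "i \<in> S \<union> T" using modular[of "C i" "C (Suc i)"] i unfolding S_def T_def by auto
    qed
    then have "card {..<k} \<le> card (S \<union> T)" by (intro card_mono) (auto simp: S_def T_def)
    then have "k \<le> card S + card T" using card_Un_le[of S T] by simp
    then have "enat k \<le> enat (card S) + enat (card T)" by simp
    ultimately have "enat k \<le> chain_len L (C 0 \<inter> Y) (C k \<inter> Y) + chain_len L (J (C 0)) (J (C k))"
      using add_mono order_trans by blast
    moreover have "C 0 \<inter> Y = X" "C k \<inter> Y = Y" using C XYZ by auto
    ultimately show "enat k \<le> chain_len L X Y + chain_len L Y Z" using C ends by simp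
  qed
qed (rule chain_len_superadd[OF XYZ])

section \<open>Submodules: additivity of length and isomorphic subquotients\<close>

definition submods :: "('a, 'b) ring_scheme \<Rightarrow> ('a, 'm, 'c) module_scheme \<Rightarrow> 'm set set" where
  "submods R M = {H. submodule H R M}"

context module
begin

lemma submodsI:
  assumes "H \<subseteq> carrier M" "\<zero>\<^bsub>M\<^esub> \<in> H" "\<And>a b. a \<in> H \<Longrightarrow> b \<in> H \<Longrightarrow> a \<oplus>\<^bsub>M\<^esub> b \<in> H"
    "\<And>r a. r \<in> carrier R \<Longrightarrow> a \<in> H \<Longrightarrow> r \<odot>\<^bsub>M\<^esub> a \<in> H"
  shows "H \<in> submods R M"
  unfolding submods_def mem_Collect_eq
proof (rule submoduleI)
  fix a assume a: "a \<in> H"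
  then have "(\<ominus> \<one>) \<odot>\<^bsub>M\<^esub> a = \<ominus>\<^bsub>M\<^esub> a" using assms(1) smult_l_minus[of \<one> a] by auto
  then show "\<ominus>\<^bsub>M\<^esub> a \<in> H" using assms(4)[of "\<ominus> \<one>" a] a by auto
qed (use assms in auto)

lemma submodsD:
  assumes "H \<in> submods R M"
  shows "\<And>a. a \<in> H \<Longrightarrow> a \<in> carrier M" "\<zero>\<^bsub>M\<^esub> \<in> H" "\<And>a b. a \<in> H \<Longrightarrow> b \<in> H \<Longrightarrow> a \<oplus>\<^bsub>M\<^esub> b \<in> H"
    "\<And>r a. r \<in> carrier R \<Longrightarrow> a \<in> H \<Longrightarrow> r \<odot>\<^bsub>M\<^esub> a \<in> H" "\<And>a. a \<in> H \<Longrightarrow> \<ominus>\<^bsub>M\<^esub> a \<in> H"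
    "\<And>a b. a \<in> H \<Longrightarrow> b \<in> H \<Longrightarrow> a \<ominus>\<^bsub>M\<^esub> b \<in> H"
proof -
  note E = submoduleE[OF assms[unfolded submods_def mem_Collect_eq]]
  show c: "\<And>a. a \<in> H \<Longrightarrow> a \<in> carrier M" using E(1) by auto
  show "\<And>a b. a \<in> H \<Longrightarrow> b \<in> H \<Longrightarrow> a \<oplus>\<^bsub>M\<^esub> b \<in> H" by (rule E(5))
  show "\<And>r a. r \<in> carrier R \<Longrightarrow> a \<in> H \<Longrightarrow> r \<odot>\<^bsub>M\<^esub> a \<in> H" by (rule E(4))
  show "\<And>a. a \<in> H \<Longrightarrow> \<ominus>\<^bsub>M\<^esub> a \<in> H" by (rule E(3))
  show "\<And>a b. a \<in> H \<Longrightarrow> b \<in> H \<Longrightarrow> a \<ominus>\<^bsub>M\<^esub> b \<in> H" using E(3,5) by (simp add: a_minus_def)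
  obtain a where a: "a \<in> H" using E(2) by auto
  show "\<zero>\<^bsub>M\<^esub> \<in> H" using E(5)[OF a E(3)[OF a]] c[OF a] by (simp add: M.r_neg)
qed

lemma M_minus_add:
  assumes "x \<in> carrier M" "y \<in> carrier M"
  shows "(x \<oplus>\<^bsub>M\<^esub> y) \<ominus>\<^bsub>M\<^esub> x = y"
  using assms by (simp add: a_minus_def M.a_comm[of x y] M.a_assoc M.r_neg)

lemma submods_inter: "H \<in> submods R M \<Longrightarrow> K \<in> submods R M \<Longrightarrow> H \<inter> K \<in> submods R M"
  by (rule submodsI) (auto dest: submodsD)

lemma mem_set_add: "x \<in> H <+>\<^bsub>M\<^esub> K \<longleftrightarrow> (\<exists>h\<in>H. \<exists>k\<in>K. x = h \<oplus>\<^bsub>M\<^esub> k)"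
  by (auto simp: set_add_def')

lemma submods_add:
  assumes "H \<in> submods R M" "K \<in> submods R M"
  shows "H <+>\<^bsub>M\<^esub> K \<in> submods R M"
proof (rule submodsI)
  note H = submodsD[OF assms(1)] and K = submodsD[OF assms(2)]
  show "H <+>\<^bsub>M\<^esub> K \<subseteq> carrier M" using H K by (auto simp: mem_set_add)
  show "\<zero>\<^bsub>M\<^esub> \<in> H <+>\<^bsub>M\<^esub> K" using H(2) K(2) by (force simp: mem_set_add)
  fix a b assume "a \<in> H <+>\<^bsub>M\<^esub> K" "b \<in> H <+>\<^bsub>M\<^esub> K"
  then obtain h k h' k' where 1: "h \<in> H" "k \<in> K" "h' \<in> H" "k' \<in> K" "a = h \<oplus>\<^bsub>M\<^esub> k" "b = h' \<oplus>\<^bsub>M\<^esub> k'"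
    by (auto simp: mem_set_add)
  then have "a \<oplus>\<^bsub>M\<^esub> b = (h \<oplus>\<^bsub>M\<^esub> h') \<oplus>\<^bsub>M\<^esub> (k \<oplus>\<^bsub>M\<^esub> k')"
    using H(1) K(1) by (auto simp: M.a_ac)
  then show "a \<oplus>\<^bsub>M\<^esub> b \<in> H <+>\<^bsub>M\<^esub> K" unfolding mem_set_add using 1 H(3) K(3) by blast
next
  note H = submodsD[OF assms(1)] and K = submodsD[OF assms(2)]
  fix r a assume r: "r \<in> carrier R" "a \<in> H <+>\<^bsub>M\<^esub> K"
  then obtain h k where 1: "h \<in> H" "k \<in> K" "a = h \<oplus>\<^bsub>M\<^esub> k" by (auto simp: mem_set_add)
  then have "r \<odot>\<^bsub>M\<^esub> a = r \<odot>\<^bsub>M\<^esub> h \<oplus>\<^bsub>M\<^esub> r \<odot>\<^bsub>M\<^esub> k" using H(1) K(1) r smult_r_distr by auto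
  then show "r \<odot>\<^bsub>M\<^esub> a \<in> H <+>\<^bsub>M\<^esub> K" unfolding mem_set_add using 1 H(4) K(4) r by blast
qed

lemma submods_length_add:
  assumes "X \<in> submods R M" "Y \<in> submods R M" "Z \<in> submods R M" "X \<subseteq> Y" "Y \<subseteq> Z"
  shows "chain_len (submods R M) X Z = chain_len (submods R M) X Y + chain_len (submods R M) Y Z"
proof (rule chain_len_additive[where J = "\<lambda>A. A <+>\<^bsub>M\<^esub> Y"])
  note X = submodsD[OF assms(1)] and Y = submodsD[OF assms(2)] and Z = submodsD[OF assms(3)]
  show "X <+>\<^bsub>M\<^esub> Y = Y"
  proof
    show "X <+>\<^bsub>M\<^esub> Y \<subseteq> Y" using assms(4) Y(3) by (auto simp: mem_set_add subset_iff)
    show "Y \<subseteq> X <+>\<^bsub>M\<^esub> Y"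
    proof
      fix z assume z: "z \<in> Y"
      then have "z = \<zero>\<^bsub>M\<^esub> \<oplus>\<^bsub>M\<^esub> z" using Y(1) by auto
      then show "z \<in> X <+>\<^bsub>M\<^esub> Y" unfolding mem_set_add using z X(2) by blast
    qed
  qed
  show "Z <+>\<^bsub>M\<^esub> Y = Z"
  proof
    show "Z <+>\<^bsub>M\<^esub> Y \<subseteq> Z" using assms(5) Z(3) by (auto simp: mem_set_add subset_iff)
    show "Z \<subseteq> Z <+>\<^bsub>M\<^esub> Y"
    proof
      fix z assume "z \<in> Z"
      then have "z = z \<oplus>\<^bsub>M\<^esub> \<zero>\<^bsub>M\<^esub>" using Z(1) by auto
      then show "z \<in> Z <+>\<^bsub>M\<^esub> Y" unfolding mem_set_add using \<open>z \<in> Z\<close> Y(2) by blast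
    qed
  qed
  fix A B assume AB: "A \<in> submods R M" "B \<in> submods R M" "A \<subseteq> B" "A \<inter> Y = B \<inter> Y" "A <+>\<^bsub>M\<^esub> Y = B <+>\<^bsub>M\<^esub> Y"
  note A = submodsD[OF AB(1)] and B = submodsD[OF AB(2)]
  \<comment> \<open>Modular law: the difference of \<open>b\<close> and its \<open>A\<close>-part
    lies in \<open>B\<close> and in \<open>Y\<close>, hence in \<open>A\<close>.\<close>
  have "b \<in> A" if "b \<in> B" for b
  proof -
    have "b = b \<oplus>\<^bsub>M\<^esub> \<zero>\<^bsub>M\<^esub>" using B(1) that by auto
    then have "b \<in> A <+>\<^bsub>M\<^esub> Y" unfolding AB(5) mem_set_add using that Y(2) by blast
    then obtain a y where ay: "a \<in> A" "y \<in> Y" "b = a \<oplus>\<^bsub>M\<^esub> y" unfolding mem_set_add by blast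
    then have "y = b \<ominus>\<^bsub>M\<^esub> a" using M_minus_add[of a y] A(1) Y(1) by simp
    moreover have "b \<ominus>\<^bsub>M\<^esub> a \<in> B" using ay AB(3) B(6) that by blast
    ultimately have "y \<in> B \<inter> Y" using ay by simp
    then show ?thesis using ay AB(4) A(3) by auto
  qed
  then show "A = B" using AB by auto
qed (use assms submods_add submods_inter in \<open>auto simp: set_add_def'\<close>)

end

text \<open>The length of a subquotient only depends on the subquotient: \<open>\<phi>\<close> induces an isomorphism
  from \<open>Y / X\<close> onto \<open>Y' / X'\<close>.\<close>

lemma length_linear_iso:
  assumes M: "module R M" and M': "module R M'"
    and X: "X \<in> submods R M" and Y: "Y \<in> submods R M" and X': "X' \<in> submods R M'" and Y': "Y' \<in> submods R M'"
    and XY: "X' \<subseteq> Y'"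
    and closed: "\<And>a. a \<in> Y \<Longrightarrow> \<phi> a \<in> Y'"
    and add: "\<And>a b. a \<in> Y \<Longrightarrow> b \<in> Y \<Longrightarrow> \<phi> (a \<oplus>\<^bsub>M\<^esub> b) = \<phi> a \<oplus>\<^bsub>M'\<^esub> \<phi> b"
    and smult: "\<And>r a. r \<in> carrier R \<Longrightarrow> a \<in> Y \<Longrightarrow> \<phi> (r \<odot>\<^bsub>M\<^esub> a) = r \<odot>\<^bsub>M'\<^esub> \<phi> a"
    and ker: "{a \<in> Y. \<phi> a \<in> X'} = X"
    and surj: "\<And>y. y \<in> Y' \<Longrightarrow> \<exists>a\<in>Y. \<exists>x\<in>X'. y = \<phi> a \<oplus>\<^bsub>M'\<^esub> x"
  shows "chain_len (submods R M) X Y = chain_len (submods R M') X' Y'"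
proof -
  interpret M: module R M by fact
  interpret M': module R M' by fact
  note Xd = M.submodsD[OF X] and Yd = M.submodsD[OF Y] and Xd' = M'.submodsD[OF X'] and Yd' = M'.submodsD[OF Y']
  have phi0: "\<phi> \<zero>\<^bsub>M\<^esub> = \<zero>\<^bsub>M'\<^esub>"
    using smult[of "\<zero>\<^bsub>R\<^esub>" "\<zero>\<^bsub>M\<^esub>"] Yd(2) closed[of "\<zero>\<^bsub>M\<^esub>"] Yd'(1) by auto
  \<comment> \<open>Image plus \<open>X'\<close>, and preimage: the two directions of the
    correspondence theorem. As \<open>\<phi>\<close> is linear on \<open>Y\<close> only, both are
    cut down to \<open>Y\<close>.\<close>
  define f where "f Z = {y. \<exists>a\<in>Z\<inter>Y. \<exists>x\<in>X'. y = \<phi> a \<oplus>\<^bsub>M'\<^esub> x}" for Z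
  define g where "g Z = {a\<in>Y. \<phi> a \<in> Z}" for Z
  have fsub: "f Z \<in> submods R M' \<and> X' \<subseteq> f Z \<and> f Z \<subseteq> Y' \<and> g (f Z) = Z"
    if Z: "Z \<in> submods R M" "X \<subseteq> Z" "Z \<subseteq> Y" for Z
  proof (intro conjI)
    note Zd = M.submodsD[OF Z(1)]
    show XZ: "X' \<subseteq> f Z"
      unfolding f_def using Zd(2) Yd(2) phi0 Xd'(1) by (auto intro!: bexI[of _ "\<zero>\<^bsub>M\<^esub>"])
    show fY: "f Z \<subseteq> Y'" unfolding f_def using closed Z XY Yd' by auto
    show "f Z \<in> submods R M'"
    proof (rule M'.submodsI)
      show "f Z \<subseteq> carrier M'" using fY Yd' by auto
      show "\<zero>\<^bsub>M'\<^esub> \<in> f Z" using XZ Xd'(2) by auto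
      fix y z assume "y \<in> f Z" "z \<in> f Z"
      then obtain a b x x' where 1: "a \<in> Z" "b \<in> Z" "x \<in> X'" "x' \<in> X'" "y = \<phi> a \<oplus>\<^bsub>M'\<^esub> x" "z = \<phi> b \<oplus>\<^bsub>M'\<^esub> x'"
        unfolding f_def by auto
      then have "y \<oplus>\<^bsub>M'\<^esub> z = \<phi> (a \<oplus>\<^bsub>M\<^esub> b) \<oplus>\<^bsub>M'\<^esub> (x \<oplus>\<^bsub>M'\<^esub> x')"
        using closed[of a] closed[of b] Z Xd'(1) Yd'(1) add[of a b] by (auto simp: M'.M.a_ac subset_iff)
      moreover have "a \<oplus>\<^bsub>M\<^esub> b \<in> Z \<inter> Y" "x \<oplus>\<^bsub>M'\<^esub> x' \<in> X'" using 1 Zd Xd' Z by auto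
      ultimately show "y \<oplus>\<^bsub>M'\<^esub> z \<in> f Z" unfolding f_def by blast
    next
      fix r y assume r: "r \<in> carrier R" "y \<in> f Z"
      then obtain a x where 1: "a \<in> Z" "x \<in> X'" "y = \<phi> a \<oplus>\<^bsub>M'\<^esub> x" unfolding f_def by auto
      then have "r \<odot>\<^bsub>M'\<^esub> y = \<phi> (r \<odot>\<^bsub>M\<^esub> a) \<oplus>\<^bsub>M'\<^esub> (r \<odot>\<^bsub>M'\<^esub> x)"
        using closed[of a] Z Xd'(1) Yd'(1) smult[of r a] r M'.smult_r_distr[of r "\<phi> a" x] by auto
      moreover have "r \<odot>\<^bsub>M\<^esub> a \<in> Z \<inter> Y" "r \<odot>\<^bsub>M'\<^esub> x \<in> X'" using 1 Zd Xd' Z r by auto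
      ultimately show "r \<odot>\<^bsub>M'\<^esub> y \<in> f Z" unfolding f_def by blast
    qed
    show "g (f Z) = Z"
    proof
      show "Z \<subseteq> g (f Z)"
      proof
        fix a assume "a \<in> Z"
        then have "\<phi> a = \<phi> a \<oplus>\<^bsub>M'\<^esub> \<zero>\<^bsub>M'\<^esub>" "a \<in> Y" using closed[of a] Yd'(1) Z by auto
        then show "a \<in> g (f Z)" unfolding f_def g_def using \<open>a \<in> Z\<close> Xd'(2) by blast
      qed
      show "g (f Z) \<subseteq> Z"
      proof
        fix a assume "a \<in> g (f Z)"
        then obtain b x where 1: "a \<in> Y" "b \<in> Z" "x \<in> X'" "\<phi> a = \<phi> b \<oplus>\<^bsub>M'\<^esub> x" "b \<in> Y"
          unfolding f_def g_def by auto
        have nb: "(\<ominus>\<^bsub>R\<^esub> \<one>\<^bsub>R\<^esub>) \<odot>\<^bsub>M\<^esub> b = \<ominus>\<^bsub>M\<^esub> b" "(\<ominus>\<^bsub>R\<^esub> \<one>\<^bsub>R\<^esub>) \<odot>\<^bsub>M'\<^esub> \<phi> b = \<ominus>\<^bsub>M'\<^esub> \<phi> b"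
          using M.smult_l_minus[of "\<one>\<^bsub>R\<^esub>" b] M'.smult_l_minus[of "\<one>\<^bsub>R\<^esub>" "\<phi> b"] 1 Yd(1) Yd'(1) closed[of b] by auto
        have "\<phi> (\<ominus>\<^bsub>M\<^esub> b) = \<ominus>\<^bsub>M'\<^esub> \<phi> b" using smult[of "\<ominus>\<^bsub>R\<^esub> \<one>\<^bsub>R\<^esub>" b] 1 nb by auto
        then have "\<phi> (a \<oplus>\<^bsub>M\<^esub> (\<ominus>\<^bsub>M\<^esub> b)) = \<phi> b \<oplus>\<^bsub>M'\<^esub> x \<oplus>\<^bsub>M'\<^esub> (\<ominus>\<^bsub>M'\<^esub> \<phi> b)"
          using add[of a "\<ominus>\<^bsub>M\<^esub> b"] 1 Yd by auto
        also have "\<dots> = x" using M'.M_minus_add[of "\<phi> b" x] closed[of b] Yd'(1) Xd'(1) 1 by (simp add: a_minus_def)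
        finally have "a \<oplus>\<^bsub>M\<^esub> (\<ominus>\<^bsub>M\<^esub> b) \<in> X" using ker 1 Yd by auto
        then have "(a \<oplus>\<^bsub>M\<^esub> (\<ominus>\<^bsub>M\<^esub> b)) \<oplus>\<^bsub>M\<^esub> b \<in> Z" using Z 1 Zd by auto
        then show "a \<in> Z" using 1 Yd(1) by (simp add: M.M.a_assoc M.M.l_neg)
      qed
    qed
  qed
  have gsub: "g Z \<in> submods R M \<and> X \<subseteq> g Z \<and> g Z \<subseteq> Y \<and> f (g Z) = Z"
    if Z: "Z \<in> submods R M'" "X' \<subseteq> Z" "Z \<subseteq> Y'" for Z
  proof (intro conjI)
    note Zd = M'.submodsD[OF Z(1)]
    show "g Z \<in> submods R M"
      by (rule M.submodsI) (use Yd Zd phi0 add smult in \<open>auto simp: g_def\<close>)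
    show "X \<subseteq> g Z" "g Z \<subseteq> Y" using ker Z unfolding g_def by auto
    show "f (g Z) = Z"
    proof
      show "f (g Z) \<subseteq> Z" unfolding f_def g_def using Z Zd by auto
      show "Z \<subseteq> f (g Z)"
      proof
        fix z assume z: "z \<in> Z"
        then obtain a x where 1: "a \<in> Y" "x \<in> X'" "z = \<phi> a \<oplus>\<^bsub>M'\<^esub> x" using surj Z by blast
        then have "\<phi> a = z \<ominus>\<^bsub>M'\<^esub> x" using M'.M_minus_add[of x "\<phi> a"] closed[of a] Yd'(1) Xd'(1)
          by (simp add: M'.M.a_comm)
        moreover have "z \<ominus>\<^bsub>M'\<^esub> x \<in> Z" using Zd(6) z 1 Z by blast
        ultimately have "\<phi> a \<in> Z" by simp
        then show "z \<in> f (g Z)" unfolding f_def g_def using 1 by auto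
      qed
    qed
  qed
  have "X \<subseteq> Y" using ker by auto
  show ?thesis
    by (rule chain_len_cong_iso[where f = f and g = g])
      (use X Y X' Y' XY \<open>X \<subseteq> Y\<close> fsub gsub in \<open>auto simp: f_def g_def\<close>)
qed

section \<open>The ring as a module over itself and modules of families\<close>

definition self_mod :: "('a, 'b) ring_scheme \<Rightarrow> ('a, 'a) module" where
  "self_mod R = \<lparr>carrier = carrier R, mult = mult R, one = one R, zero = zero R, add = add R, smult = mult R\<rparr>"

definition fun_mod :: "('a, 'b) ring_scheme \<Rightarrow> ('a, 'i \<Rightarrow> 'a) module" where
  "fun_mod R = \<lparr>carrier = {c. \<forall>l. c l \<in> carrier R}, mult = undefined, one = undefined,
     zero = (\<lambda>_. \<zero>\<^bsub>R\<^esub>), add = (\<lambda>c d l. c l \<oplus>\<^bsub>R\<^esub> d l), smult = (\<lambda>r c l. r \<otimes>\<^bsub>R\<^esub> c l)\<rparr>"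

lemma self_mod_simps [simp]:
  "carrier (self_mod R) = carrier R" "zero (self_mod R) = zero R" "add (self_mod R) = add R"
  "smult (self_mod R) = mult R"
  by (simp_all add: self_mod_def)

lemma fun_mod_simps [simp]:
  "carrier (fun_mod R) = {c. \<forall>l. c l \<in> carrier R}" "zero (fun_mod R) = (\<lambda>_. \<zero>\<^bsub>R\<^esub>)"
  "add (fun_mod R) = (\<lambda>c d l. c l \<oplus>\<^bsub>R\<^esub> d l)" "smult (fun_mod R) = (\<lambda>r c l. r \<otimes>\<^bsub>R\<^esub> c l)"
  by (simp_all add: fun_mod_def)

context cring
begin

lemma self_mod_module: "module R (self_mod R)"
proof (rule moduleI)
  show "abelian_group (self_mod R)"
    by (rule abelian_groupI) (auto simp: a_ac intro: bexI[of _ "\<ominus> _"] l_neg)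
qed (auto simp: l_distr r_distr m_assoc cring_axioms)

lemma fun_mod_module: "module R (fun_mod R :: ('a, 'i \<Rightarrow> 'a) module)"
proof (rule moduleI)
  show "abelian_group (fun_mod R :: ('a, 'i \<Rightarrow> 'a) module)"
  proof (rule abelian_groupI)
    fix x :: "'i \<Rightarrow> 'a" assume "x \<in> carrier (fun_mod R)"
    then show "\<exists>y\<in>carrier (fun_mod R). y \<oplus>\<^bsub>fun_mod R\<^esub> x = \<zero>\<^bsub>fun_mod R\<^esub>"
      by (intro bexI[of _ "\<lambda>l. \<ominus> x l"]) (auto simp: l_neg)
  qed (auto simp: a_ac)
qed (auto simp: l_distr r_distr m_assoc cring_axioms)

lemma submods_self: "submods R (self_mod R) = {I. ideal I R}"
proof -
  interpret M: module R "self_mod R" by (rule self_mod_module)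
  show ?thesis
  proof (intro Set.set_eqI iffI CollectI)
    fix H assume H: "H \<in> submods R (self_mod R)"
    note d = M.submodsD[OF H]
    have "additive_subgroup H R"
    proof (rule additive_subgroupI)
      have "submodule H R (self_mod R)" using H by (simp add: submods_def)
      then have "subgroup H (add_monoid (self_mod R))" by (rule submodule.axioms)
      then show "subgroup H (add_monoid R)" by (auto simp: subgroup_def m_inv_def)
    qed
    moreover have "a \<otimes> x \<in> H" if "a \<in> H" "x \<in> carrier R" for a x
      using d(4)[of x a] d(1)[of a] that by (simp add: m_comm)
    moreover have "x \<otimes> a \<in> H" if "a \<in> H" "x \<in> carrier R" for a x
      using d(4)[of x a] that by simp
    ultimately show "ideal H R"
      by (intro idealI ring_axioms) (auto dest: additive_subgroup.a_subgroup)
  next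
    fix H assume "H \<in> {I. ideal I R}"
    then interpret ideal H R by simp
    show "H \<in> submods R (self_mod R)"
      by (rule M.submodsI) (auto simp: a_subset I_l_closed)
  qed
qed

definition ideal_len :: "'a set \<Rightarrow> 'a set \<Rightarrow> enat" where
  "ideal_len X Y = chain_len {I. ideal I R} X Y"

lemma ideal_len_add:
  assumes "ideal X R" "ideal Y R" "ideal Z R" "X \<subseteq> Y" "Y \<subseteq> Z"
  shows "ideal_len X Z = ideal_len X Y + ideal_len Y Z"
  using module.submods_length_add[OF self_mod_module, of X Y Z] assms
  by (simp add: submods_self ideal_len_def)

lemma ideal_len_same: "ideal_len X X = 0"
proof -
  have "ideal_len X X \<le> 0"
    unfolding ideal_len_def
  proof (rule chain_len_le)
    fix k and C :: "nat \<Rightarrow> _ set"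
    assume C: "C 0 = X" "C k = X" "\<forall>i<k. C i \<subset> C (Suc i)"
    show "enat k \<le> 0"
    proof (cases k)
      case (Suc n)
      then have "C 0 \<subset> C 1" "C 1 \<subseteq> C k" using C(3) strict_chain_mono[OF C(3), of 1 k] by auto
      then show ?thesis using C by auto
    qed (simp add: zero_enat_def)
  qed
  then show ?thesis by simp
qed

text \<open>The submodule \<open>\<Prod>\<^sub>l V\<^sub>l\<close> of the module of functions.\<close>

definition fam :: "('i \<Rightarrow> 'a set) \<Rightarrow> ('i \<Rightarrow> 'a) set" where
  "fam V = {c. \<forall>l. c l \<in> V l}"

lemma fam_submod: "(\<And>l. ideal (V l) R) \<Longrightarrow> fam V \<in> submods R (fun_mod R)"
  by (rule module.submodsI[OF fun_mod_module])
    (auto simp: fam_def ideal.I_l_closed intro: ideal.Icarr simp: additive_subgroup.zero_closed additive_subgroup.a_closed ideal.axioms(1))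

lemma fam_mono: "(\<And>l. V l \<subseteq> W l) \<Longrightarrow> fam V \<subseteq> fam W"
  by (auto simp: fam_def)

text \<open>The coordinates in \<open>S\<close> are lowered from \<open>W\<close> to
  \<open>V\<close> one at a time. The step at \<open>s\<close> contributes the length of
  \<open>W s\<close> over \<open>V s\<close>, since evaluation at \<open>s\<close> identifies the
  two subquotients. Outside \<open>S\<close> the ideals agree, so the index type may be
  infinite.\<close>

lemma length_fam:
  fixes V W :: "'i \<Rightarrow> 'a set"
  assumes S: "finite S" and V: "\<And>l. ideal (V l) R" and W: "\<And>l. ideal (W l) R"
    and sub: "\<And>l. V l \<subseteq> W l" and eq: "\<And>l. l \<notin> S \<Longrightarrow> V l = W l"
  shows "chain_len (submods R (fun_mod R)) (fam V) (fam W) = (\<Sum>l\<in>S. ideal_len (V l) (W l))"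
  using S W sub eq
proof (induction S arbitrary: W rule: finite_induct)
  case empty
  then have "V = W" by auto
  have "chain_len (submods R (fun_mod R)) (fam V) (fam V) \<le> 0"
  proof (rule chain_len_le)
    fix k and C :: "nat \<Rightarrow> _ set"
    assume C: "C 0 = fam V" "C k = fam V" "\<forall>i<k. C i \<subset> C (Suc i)"
    show "enat k \<le> 0"
    proof (cases k)
      case (Suc n)
      then have "C 0 \<subset> C 1" "C 1 \<subseteq> C k" using C(3) strict_chain_mono[OF C(3), of 1 k] by auto
      then show ?thesis using C by auto
    qed (simp add: zero_enat_def)
  qed
  then show ?case using \<open>V = W\<close> by simp
next
  case (insert s S)
  interpret F: module R "fun_mod R :: ('a, 'i \<Rightarrow> 'a) module" by (rule fun_mod_module)
  interpret Ws: ideal "W s" R by (rule insert)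
  interpret Vs: ideal "V s" R by (rule V)
  define W' where "W' = W(s := V s)"
  have W': "ideal (W' l) R" for l using V insert(4) by (auto simp: W'_def)
  have sub': "V l \<subseteq> W' l" "W' l \<subseteq> W l" for l using insert(5) by (auto simp: W'_def)
  have "chain_len (submods R (fun_mod R)) (fam V) (fam W) =
      chain_len (submods R (fun_mod R)) (fam V) (fam W') + chain_len (submods R (fun_mod R)) (fam W') (fam W)"
    by (rule F.submods_length_add) (intro fam_submod fam_mono V insert(4) W' sub')+
  also have "chain_len (submods R (fun_mod R)) (fam V) (fam W') = (\<Sum>l\<in>S. ideal_len (V l) (W' l))"
    by (rule insert.IH) (use W' sub' insert(6) in \<open>auto simp: W'_def\<close>)
  also have "\<dots> = (\<Sum>l\<in>S. ideal_len (V l) (W l))"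
    using insert(2) by (intro sum.cong) (auto simp: W'_def)
  also have "chain_len (submods R (fun_mod R)) (fam W') (fam W) = chain_len (submods R (self_mod R)) (V s) (W s)"
  proof (rule length_linear_iso[where \<phi> = "\<lambda>c. c s", OF fun_mod_module self_mod_module])
    show "fam W' \<in> submods R (fun_mod R)" "fam W \<in> submods R (fun_mod R)"
      using fam_submod W' insert(4) by auto
    show "V s \<in> submods R (self_mod R)" "W s \<in> submods R (self_mod R)"
      using V insert(4) by (auto simp: submods_self)
    show "{a \<in> fam W. a s \<in> V s} = fam W'"
      using insert(5) by (auto simp: fam_def W'_def split: if_splits)
    fix y assume y: "y \<in> W s"
    have "(\<lambda>l. if l = s then y else \<zero>) \<in> fam W"
      using y insert(4) by (auto simp: fam_def additive_subgroup.zero_closed ideal.axioms(1))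
    then show "\<exists>a\<in>fam W. \<exists>x\<in>V s. y = a s \<oplus>\<^bsub>self_mod R\<^esub> x"
      using y Ws.Icarr by (intro bexI[of _ "\<lambda>l. if l = s then y else \<zero>"] bexI[of _ \<zero>]) auto
  qed (use insert(5) in \<open>auto simp: fam_def\<close>)
  finally show ?case using insert(1,2) by (simp add: submods_self ideal_len_def add.commute)
qed

end

section \<open>Ideals and their powers\<close>

no_notation Sum_Type.Plus (infixr "<+>" 65)

context cring
begin

lemma mem_sum_iff: "x \<in> H <+> K \<longleftrightarrow> (\<exists>h\<in>H. \<exists>k\<in>K. x = h \<oplus> k)"
  by (auto simp: set_add_def')

lemma idealD:
  assumes "ideal I R"
  shows "\<And>x. x \<in> I \<Longrightarrow> x \<in> carrier R" "\<zero> \<in> I" "\<And>x y. x \<in> I \<Longrightarrow> y \<in> I \<Longrightarrow> x \<oplus> y \<in> I"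
    "\<And>x. x \<in> I \<Longrightarrow> \<ominus> x \<in> I" "\<And>x y. x \<in> I \<Longrightarrow> y \<in> I \<Longrightarrow> x \<ominus> y \<in> I"
    "\<And>r x. r \<in> carrier R \<Longrightarrow> x \<in> I \<Longrightarrow> r \<otimes> x \<in> I" "\<And>r x. r \<in> carrier R \<Longrightarrow> x \<in> I \<Longrightarrow> x \<otimes> r \<in> I"
proof -
  interpret I: ideal I R by fact
  show "\<And>x. x \<in> I \<Longrightarrow> x \<in> carrier R" "\<zero> \<in> I" "\<And>x y. x \<in> I \<Longrightarrow> y \<in> I \<Longrightarrow> x \<oplus> y \<in> I"
    "\<And>x. x \<in> I \<Longrightarrow> \<ominus> x \<in> I" "\<And>x y. x \<in> I \<Longrightarrow> y \<in> I \<Longrightarrow> x \<ominus> y \<in> I"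
    "\<And>r x. r \<in> carrier R \<Longrightarrow> x \<in> I \<Longrightarrow> r \<otimes> x \<in> I" "\<And>r x. r \<in> carrier R \<Longrightarrow> x \<in> I \<Longrightarrow> x \<otimes> r \<in> I"
    by (auto simp: I.Icarr I.I_l_closed I.I_r_closed a_minus_def)
qed

lemma ideal_subset: "ideal I R \<Longrightarrow> I \<subseteq> carrier R"
  using idealD(1) by auto

lemma idealI':
  assumes "I \<subseteq> carrier R" "\<zero> \<in> I" "\<And>a b. a \<in> I \<Longrightarrow> b \<in> I \<Longrightarrow> a \<oplus> b \<in> I"
    "\<And>r a. r \<in> carrier R \<Longrightarrow> a \<in> I \<Longrightarrow> r \<otimes> a \<in> I"
  shows "ideal I R"
proof -
  have "I \<in> submods R (self_mod R)"
    by (rule module.submodsI[OF self_mod_module]) (use assms in auto)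
  then show ?thesis by (simp add: submods_self)
qed

lemma add_minus_cancel: "x \<in> carrier R \<Longrightarrow> y \<in> carrier R \<Longrightarrow> (x \<oplus> y) \<ominus> x = y"
  by (simp add: a_minus_def a_comm[of x y] a_assoc r_neg)

lemma add_minus_cancel2: "x \<in> carrier R \<Longrightarrow> y \<in> carrier R \<Longrightarrow> (x \<oplus> y) \<ominus> y = x"
  by (simp add: a_minus_def a_assoc r_neg)

lemma minus_add_cancel: "x \<in> carrier R \<Longrightarrow> y \<in> carrier R \<Longrightarrow> (x \<ominus> y) \<oplus> y = x"
  by (simp add: a_minus_def a_assoc l_neg)

lemma ideal_add_cancel:
  assumes "ideal I R" "x \<in> I" "y \<in> carrier R" "x \<oplus> y \<in> I"
  shows "y \<in> I"
  using idealD(5)[OF assms(1) assms(4,2)] add_minus_cancel[of x y] idealD(1)[OF assms(1,2)] assms(3) by simp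

lemma sum_subset_iff:
  assumes "ideal H R" "ideal K R" "ideal X R"
  shows "H <+> K \<subseteq> X \<longleftrightarrow> H \<subseteq> X \<and> K \<subseteq> X"
proof
  assume L: "H <+> K \<subseteq> X"
  show "H \<subseteq> X \<and> K \<subseteq> X"
  proof (intro conjI subsetI)
    fix x assume "x \<in> H"
    then have "x \<oplus> \<zero> \<in> H <+> K" using idealD(2)[OF assms(2)] by (auto simp: mem_sum_iff)
    then show "x \<in> X" using L idealD(1)[OF assms(1) \<open>x \<in> H\<close>] by auto
  next
    fix x assume "x \<in> K"
    then have "\<zero> \<oplus> x \<in> H <+> K" using idealD(2)[OF assms(1)] by (auto simp: mem_sum_iff)
    then show "x \<in> X" using L idealD(1)[OF assms(2) \<open>x \<in> K\<close>] by auto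
  qed
qed (auto simp: mem_sum_iff idealD(3)[OF assms(3)] subset_iff)

lemma sum_upper:
  assumes "ideal H R" "ideal K R"
  shows "H \<subseteq> H <+> K" "K \<subseteq> H <+> K"
  using sum_subset_iff[OF assms add_ideals[OF assms]] by auto

lemma sum_absorb:
  assumes "ideal H R" "ideal K R" "H \<subseteq> K"
  shows "H <+> K = K" "K <+> H = K"
  using sum_upper[OF assms(1,2)] sum_upper[OF assms(2,1)]
    sum_subset_iff[OF assms(1,2,2)] sum_subset_iff[OF assms(2,1,2)] assms(3) by auto

lemma prod_subset_iff:
  assumes "ideal H R" "ideal K R" "ideal X R"
  shows "H \<cdot> K \<subseteq> X \<longleftrightarrow> (\<forall>h\<in>H. \<forall>k\<in>K. h \<otimes> k \<in> X)"
proof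
  assume *: "\<forall>h\<in>H. \<forall>k\<in>K. h \<otimes> k \<in> X"
  have "x \<in> X" if "x \<in> H \<cdot> K" for x
    using that by (induction rule: ideal_prod.induct) (use * idealD(3)[OF assms(3)] in auto)
  then show "H \<cdot> K \<subseteq> X" by auto
qed (auto intro: ideal_prod.prod)

lemma ideal_mult_eq_prod:
  assumes "ideal H R" "ideal K R"
  shows "ideal_mult R H K = H \<cdot> K"
proof -
  have "{i \<otimes> j |i j. i \<in> H \<and> j \<in> K} = H <#> K" by (auto simp: set_mult_def)
  then show ?thesis using ideal_prod_eq_genideal[OF assms] by (simp add: ideal_mult_def)
qed

lemma ideal_pow_ideal [intro]: "ideal M R \<Longrightarrow> ideal (ideal_pow R M n) R"
  by (induction n) (auto simp: oneideal ideal_mult_eq_prod ideal_prod_is_ideal)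

lemma ideal_pow_Suc: "ideal M R \<Longrightarrow> ideal_pow R M (Suc n) = M \<cdot> ideal_pow R M n"
  by (simp add: ideal_mult_eq_prod ideal_pow_ideal)

lemma ideal_pow_1: "ideal M R \<Longrightarrow> ideal_pow R M (Suc 0) = M"
  using ideal_pow_Suc[of M 0] ideal_prod_one[of M] by simp

lemma ideal_pow_add:
  assumes "ideal M R"
  shows "ideal_pow R M (a + b) = ideal_pow R M a \<cdot> ideal_pow R M b"
proof (induction a)
  case 0
  then show ?case using ideal_prod_one[of "ideal_pow R M b"] ideal_prod_commute[OF oneideal, of "ideal_pow R M b"]
    ideal_pow_ideal[OF assms] by simp
next
  case (Suc a)
  have "ideal_pow R M (Suc a + b) = M \<cdot> ideal_pow R M (a + b)"
    using ideal_pow_Suc[OF assms, of "a + b"] by simp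
  also have "\<dots> = (M \<cdot> ideal_pow R M a) \<cdot> ideal_pow R M b"
    unfolding Suc using ideal_prod_assoc[OF assms ideal_pow_ideal[OF assms] ideal_pow_ideal[OF assms]] by simp
  finally show ?case unfolding ideal_pow_Suc[OF assms] .
qed

lemma ideal_pow_mult_mem:
  "ideal M R \<Longrightarrow> x \<in> ideal_pow R M a \<Longrightarrow> y \<in> ideal_pow R M b \<Longrightarrow> x \<otimes> y \<in> ideal_pow R M (a + b)"
  by (simp add: ideal_pow_add ideal_prod.prod)

lemma ideal_pow_antimono:
  assumes "ideal M R" "a \<le> b"
  shows "ideal_pow R M b \<subseteq> ideal_pow R M a"
proof -
  obtain c where "b = c + a" using assms(2) by (metis le_Suc_ex add.commute)
  then show ?thesis
    using ideal_pow_add[OF assms(1), of c a]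
      ideal_prod_inter[OF ideal_pow_ideal[OF assms(1), of c] ideal_pow_ideal[OF assms(1), of a]] by simp
qed

lemma prod_mono:
  assumes "ideal H R" "ideal K R" "ideal H' R" "ideal K' R" "H \<subseteq> H'" "K \<subseteq> K'"
  shows "H \<cdot> K \<subseteq> H' \<cdot> K'"
proof -
  have "h \<otimes> k \<in> H' \<cdot> K'" if "h \<in> H" "k \<in> K" for h k
    using that assms(5,6) by (intro ideal_prod.prod) auto
  then show ?thesis using prod_subset_iff[OF assms(1,2) ideal_prod_is_ideal[OF assms(3,4)]] by simp
qed

lemma sum_mono:
  assumes "H \<subseteq> H'" "K \<subseteq> K'"
  shows "H <+> K \<subseteq> H' <+> K'"
proof
  fix x assume "x \<in> H <+> K"
  then obtain h k where "h \<in> H" "k \<in> K" "x = h \<oplus> k" by (auto simp: mem_sum_iff)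
  then show "x \<in> H' <+> K'" using assms by (auto simp: mem_sum_iff)
qed

lemma Idl_insert:
  assumes "a \<in> carrier R" "A \<subseteq> carrier R"
  shows "Idl (insert a A) = PIdl a <+> Idl A"
proof
  note I = cgenideal_ideal[OF assms(1)] genideal_ideal[OF assms(2)]
  show "Idl (insert a A) \<subseteq> PIdl a <+> Idl A"
    using sum_upper[OF I] cgenideal_self[OF assms(1)] genideal_self[OF assms(2)]
    by (intro genideal_minimal add_ideals I) auto
  have "insert a A \<subseteq> Idl (insert a A)" using assms by (intro genideal_self) auto
  then show "PIdl a <+> Idl A \<subseteq> Idl (insert a A)"
    using sum_subset_iff[OF I genideal_ideal, of "insert a A"] assms
      cgenideal_minimal[OF genideal_ideal, of "insert a A" a] genideal_minimal[OF genideal_ideal, of "insert a A" A]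
    by simp
qed

lemma mem_PIdl: "x \<in> PIdl a \<longleftrightarrow> (\<exists>r\<in>carrier R. x = r \<otimes> a)"
  by (auto simp: cgenideal_def)

lemma mem_sum_PIdl: "x \<in> X <+> PIdl a \<longleftrightarrow> (\<exists>y\<in>X. \<exists>r\<in>carrier R. x = y \<oplus> r \<otimes> a)"
proof
  assume "x \<in> X <+> PIdl a"
  then obtain y k where "y \<in> X" "k \<in> PIdl a" "x = y \<oplus> k" by (auto simp: mem_sum_iff)
  then show "\<exists>y\<in>X. \<exists>r\<in>carrier R. x = y \<oplus> r \<otimes> a" by (auto simp: mem_PIdl)
next
  assume "\<exists>y\<in>X. \<exists>r\<in>carrier R. x = y \<oplus> r \<otimes> a"
  then obtain y r where "y \<in> X" "r \<in> carrier R" "x = y \<oplus> r \<otimes> a" by auto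
  moreover have "r \<otimes> a \<in> PIdl a" using calculation by (auto simp: mem_PIdl)
  ultimately show "x \<in> X <+> PIdl a" by (auto simp: mem_sum_iff)
qed

end

section \<open>Noetherian local rings\<close>

text \<open>In a noetherian ring the union of a nonempty chain of ideals is a member of the chain,
  so Zorn's lemma applies to every nonempty family of ideals.\<close>

lemma (in noetherian_ring) ideal_family_max:
  assumes "I0 \<in> S" "\<And>I. I \<in> S \<Longrightarrow> ideal I R"
  shows "\<exists>X\<in>S. \<forall>Y\<in>S. X \<subseteq> Y \<longrightarrow> Y = X"
proof (rule subset_Zorn_nonempty)
  fix C assume C: "C \<noteq> {}" "subset.chain S C"
  then have "subset.chain {I. ideal I R} C" using assms(2) by (auto simp: pred_on.chain_def)
  then have "\<Union>C \<in> C" using ideal_chain_is_trivial C by simp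
  then show "\<Union>C \<in> S" using C unfolding pred_on.chain_def by blast
next
  show "S \<noteq> {}" using assms(1) by blast
qed

lemma (in noetherian_ring) ideal_max_exists:
  assumes "P I0" "\<And>I. P I \<Longrightarrow> ideal I R"
  obtains X where "P X" "\<And>Y. P Y \<Longrightarrow> X \<subseteq> Y \<Longrightarrow> Y = X"
proof -
  have "\<exists>X\<in>Collect P. \<forall>Y\<in>Collect P. X \<subseteq> Y \<longrightarrow> Y = X"
    by (rule ideal_family_max[of I0]) (simp_all add: assms)
  then show ?thesis using that by (elim bexE) simp
qed

lemma (in noetherian_ring) ideal_seq_stable:
  assumes "\<And>n::nat. ideal (L n) R" "\<And>n. L n \<subseteq> L (Suc n)"
  shows "\<exists>k. \<forall>n\<ge>k. L n = L k"
proof -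
  have "\<exists>X\<in>range L. \<forall>Y\<in>range L. X \<subseteq> Y \<longrightarrow> Y = X"
    by (rule ideal_family_max[of "L 0"]) (auto simp: assms(1))
  then obtain k where k: "\<forall>n. L k \<subseteq> L n \<longrightarrow> L n = L k" by auto
  have "L k \<subseteq> L n" if "k \<le> n" for n using lift_Suc_mono_le[of L k n] assms(2) that by simp
  then show ?thesis using k by (intro exI[of _ k]) simp
qed

lemma (in cring) sum_comm: "ideal H R \<Longrightarrow> ideal K R \<Longrightarrow> H <+> K = K <+> H"
  using set_add_comm ideal_subset by blast

lemma (in cring) sum_assoc:
  assumes "ideal H R" "ideal K R" "ideal X R"
  shows "(H <+> K) <+> X = H <+> (K <+> X)"
  using add.set_mult_assoc[of H K X] ideal_subset assms by (simp add: set_add_def)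

text \<open>The maximal ideal is a parameter and not a description, so that the locale can also be
  entered at a quotient ring with the image of \<open>M\<close>.\<close>

locale noeth_local = cring R + noetherian_ring R for R (structure) +
  fixes M
  assumes max: "maximalideal M R" and uniq: "\<And>P. maximalideal P R \<Longrightarrow> P = M"
begin

lemma M_ideal: "ideal M R" using max by (simp add: maximalideal_def)

lemma M_proper: "M \<noteq> carrier R" using max maximalideal.I_notcarr by blast

lemma pow_ideal [simp]: "ideal (ideal_pow R M n) R" using ideal_pow_ideal[OF M_ideal] .

lemma proper_subset_M:
  assumes "ideal J R" "J \<noteq> carrier R"
  shows "J \<subseteq> M"
proof -
  obtain X where X: "ideal X R \<and> X \<noteq> carrier R \<and> J \<subseteq> X"
    and m: "\<And>Y. ideal Y R \<and> Y \<noteq> carrier R \<and> J \<subseteq> Y \<Longrightarrow> X \<subseteq> Y \<Longrightarrow> Y = X"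
    by (rule ideal_max_exists[of "\<lambda>X. ideal X R \<and> X \<noteq> carrier R \<and> J \<subseteq> X" J]) (use assms in simp_all)
  have "maximalideal X R"
  proof (rule maximalidealI)
    fix Y assume "ideal Y R" "X \<subseteq> Y" "Y \<subseteq> carrier R"
    then show "Y = X \<or> Y = carrier R" using X m[of Y] by (metis order_trans)
  qed (use X in auto)
  then show ?thesis using uniq[of X] X by simp
qed

lemma unit_outside:
  assumes "a \<in> carrier R" "a \<notin> M"
  obtains b where "b \<in> carrier R" "b \<otimes> a = \<one>"
proof -
  have "PIdl a = carrier R"
    using proper_subset_M[OF cgenideal_ideal] cgenideal_self assms by blast
  then have "\<one> \<in> PIdl a" by simp
  then obtain r where "r \<in> carrier R" "\<one> = r \<otimes> a" by (auto simp: mem_PIdl)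
  then show ?thesis using that[of r] by simp
qed

lemma one_notin_M: "\<one> \<notin> M"
  using ideal.one_imp_carrier[OF M_ideal] M_proper by blast

lemma one_minus_unit:
  assumes "m \<in> M"
  obtains b where "b \<in> carrier R" "b \<otimes> (\<one> \<ominus> m) = \<one>"
proof -
  have mc: "m \<in> carrier R" using idealD(1)[OF M_ideal assms] .
  have "\<one> \<ominus> m \<notin> M"
  proof
    assume "\<one> \<ominus> m \<in> M"
    then have "(\<one> \<ominus> m) \<oplus> m \<in> M" using idealD(3)[OF M_ideal] assms by blast
    then show False using one_notin_M mc by (simp add: minus_add_cancel)
  qed
  then show ?thesis using unit_outside[of "\<one> \<ominus> m"] mc that by auto
qed

text \<open>Induction on the generators. Let \<open>Z\<close> be \<open>Y\<close> plus M times the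
  ideal of the remaining generators. A relation a = z + m a gives (1 - m) a = z, and the unit 1 - m
  puts \<open>a\<close> into \<open>Z\<close>. The remaining generators then satisfy the hypothesis
  by themselves.\<close>

lemma nakayama_gen:
  assumes "finite A" "A \<subseteq> carrier R" "ideal Y R" "A \<subseteq> Y <+> M \<cdot> (Idl A)"
  shows "A \<subseteq> Y"
  using assms(1,2,4)
proof (induction A rule: finite_induct)
  case (insert a A)
  have ac: "a \<in> carrier R" and Ac: "A \<subseteq> carrier R" using insert by auto
  have IA: "ideal (Idl A) R" using genideal_ideal[OF Ac] .
  have MA: "ideal (M \<cdot> (Idl A)) R" by (intro ideal_prod_is_ideal M_ideal IA)
  define Z where "Z = Y <+> M \<cdot> (Idl A)"
  have Z: "ideal Z R" unfolding Z_def by (intro add_ideals assms MA)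
  have YZ: "Y \<subseteq> Z" "M \<cdot> (Idl A) \<subseteq> Z" unfolding Z_def using sum_upper[OF assms(3) MA] by auto
  have prod: "M \<cdot> (Idl (insert a A)) = M \<cdot> (PIdl a) <+> M \<cdot> (Idl A)"
    unfolding Idl_insert[OF ac Ac] by (rule ideal_prod_r_distr[OF M_ideal cgenideal_ideal[OF ac] IA])
  have Ma: "\<exists>m\<in>M. x = m \<otimes> a" if "x \<in> M \<cdot> (PIdl a)" for x
    using that
  proof (induction rule: ideal_prod.induct)
    case (prod i j)
    then obtain r where r: "r \<in> carrier R" "j = r \<otimes> a" by (auto simp: mem_PIdl)
    have "i \<otimes> j = (i \<otimes> r) \<otimes> a" using r ac idealD(1)[OF M_ideal prod(1)] by (simp add: m_assoc)
    then show ?case using idealD(7)[OF M_ideal r(1) prod(1)] by blast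
  next
    case (sum s1 s2)
    then obtain m1 m2 where m: "m1 \<in> M" "m2 \<in> M" "s1 = m1 \<otimes> a" "s2 = m2 \<otimes> a" by auto
    then have "s1 \<oplus> s2 = (m1 \<oplus> m2) \<otimes> a" using ac idealD(1)[OF M_ideal] by (simp add: l_distr)
    then show ?case using idealD(3)[OF M_ideal m(1,2)] by blast
  qed
  have split: "\<exists>m\<in>M. \<exists>z\<in>Z. x = z \<oplus> m \<otimes> a" if "x \<in> insert a A" for x
  proof -
    have "x \<in> Y <+> M \<cdot> (Idl (insert a A))" using insert.prems that by blast
    then obtain y u v where 1: "y \<in> Y" "u \<in> M \<cdot> (PIdl a)" "v \<in> M \<cdot> (Idl A)" "x = y \<oplus> (u \<oplus> v)"
      unfolding prod by (auto simp: mem_sum_iff)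
    obtain m where m: "m \<in> M" "u = m \<otimes> a" using Ma 1 by blast
    have "y \<oplus> v \<in> Z" using idealD(3)[OF Z] 1 YZ by blast
    moreover have "x = (y \<oplus> v) \<oplus> m \<otimes> a"
      using 1 m ac idealD(1)[OF assms(3)] idealD(1)[OF MA] idealD(1)[OF M_ideal] by (simp add: a_ac)
    ultimately show ?thesis using m by blast
  qed
  have aZ: "a \<in> Z"
  proof -
    obtain m z where mz: "m \<in> M" "z \<in> Z" "a = z \<oplus> m \<otimes> a" using split[of a] by auto
    have mc: "m \<in> carrier R" "z \<in> carrier R" using idealD(1)[OF M_ideal] idealD(1)[OF Z] mz by auto
    obtain b where b: "b \<in> carrier R" "b \<otimes> (\<one> \<ominus> m) = \<one>" using one_minus_unit[OF mz(1)] by blast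
    have "(\<one> \<ominus> m) \<otimes> a = a \<ominus> m \<otimes> a" using mc ac by (simp add: a_minus_def l_distr l_minus)
    also have "\<dots> = z" using mz(3) add_minus_cancel2[of z "m \<otimes> a"] mc ac by simp
    finally have "b \<otimes> z = a" using b mc ac by (metis m_assoc l_one minus_closed one_closed)
    then show ?thesis using idealD(6)[OF Z b(1) mz(2)] by simp
  qed
  have "A \<subseteq> Z"
  proof
    fix x assume "x \<in> A"
    then obtain m z where mz: "m \<in> M" "z \<in> Z" "x = z \<oplus> m \<otimes> a" using split[of x] by auto
    then show "x \<in> Z" using idealD(3,6)[OF Z] aZ idealD(1)[OF M_ideal] by auto
  qed
  then have "A \<subseteq> Y" using insert Ac unfolding Z_def by blast
  then have "Idl A \<subseteq> Y" using genideal_minimal assms(3) by blast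
  then have "M \<cdot> (Idl A) \<subseteq> Y" using prod_subset_iff[OF M_ideal IA assms(3)] idealD(6)[OF assms(3)] idealD(1)[OF M_ideal] by blast
  then have "Z \<subseteq> Y" unfolding Z_def using sum_subset_iff[OF assms(3) MA assms(3)] by simp
  then show ?case using aZ \<open>A \<subseteq> Y\<close> by auto
qed auto

lemma nakayama:
  assumes "ideal K R" "ideal Y R" "K \<subseteq> Y <+> M \<cdot> K"
  shows "K \<subseteq> Y"
proof -
  obtain A where A: "A \<subseteq> carrier R" "finite A" "K = Idl A" using finetely_gen[OF assms(1)] by auto
  have "A \<subseteq> Y" using nakayama_gen[OF A(2,1) assms(2)] assms(3) A(3) genideal_self[OF A(1)] by blast
  then show ?thesis using A genideal_minimal[OF assms(2)] by simp
qed

text \<open>The subquotient is generated by one element killed by \<open>M\<close>, so it is a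
  quotient of the residue field: an element outside \<open>X\<close> has a unit as coefficient of
  \<open>a\<close>, and therefore generates \<open>a\<close> modulo \<open>X\<close>.\<close>

lemma ideal_len_cyclic:
  assumes "ideal X R" "a \<in> carrier R" "\<And>m. m \<in> M \<Longrightarrow> m \<otimes> a \<in> X"
  shows "ideal_len X (X <+> PIdl a) \<le> enat 1"
  unfolding ideal_len_def
proof (rule chain_len_le, rule ccontr)
  fix k and C :: "nat \<Rightarrow> 'a set"
  assume C: "C 0 = X" "C k = X <+> PIdl a" "\<forall>i\<le>k. C i \<in> {I. ideal I R}" "\<forall>i<k. C i \<subset> C (Suc i)"
  assume "\<not> enat k \<le> enat 1"
  then have k: "k \<ge> 2" by simp
  have s: "C 0 \<subset> C 1" "C 1 \<subset> C k"
  proof -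
    have "C 1 \<subset> C 2" using C(4) k by (auto simp: numeral_2_eq_2)
    moreover have "C 2 \<subseteq> C k" by (rule strict_chain_mono[OF C(4)]) (use k in auto)
    ultimately show "C 1 \<subset> C k" by blast
    show "C 0 \<subset> C 1" using C(4) k by auto
  qed
  obtain c where c: "c \<in> C 1" "c \<notin> X" using s C by auto
  have C1: "ideal (C 1) R" using C(3) k by auto
  have "c \<in> X <+> PIdl a" using c s C by auto
  then obtain x r where xr: "x \<in> X" "r \<in> carrier R" "c = x \<oplus> r \<otimes> a" by (auto simp: mem_sum_PIdl)
  have "r \<notin> M" using xr assms(3)[of r] c(2) idealD(3)[OF assms(1)] by auto
  then obtain b where b: "b \<in> carrier R" "b \<otimes> r = \<one>" using unit_outside xr by blast
  have "x \<in> C 1" using s xr C by auto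
  then have "r \<otimes> a \<in> C 1" using ideal_add_cancel[OF C1, of x "r \<otimes> a"] c(1) xr assms(2) by simp
  then have "b \<otimes> (r \<otimes> a) \<in> C 1" using idealD(6)[OF C1] b by blast
  then have "a \<in> C 1" using b xr assms(2) by (simp add: m_assoc[symmetric])
  then have "PIdl a \<subseteq> C 1" by (rule cgenideal_minimal[OF C1])
  moreover have "X \<subseteq> C 1" using s C(1) by blast
  ultimately have "X <+> PIdl a \<subseteq> C 1"
    using sum_subset_iff[OF assms(1) cgenideal_ideal[OF assms(2)] C1] by simp
  then show False using s(2) C(2) by blast
qed

lemma ideal_len_finite_gen:
  assumes "finite A" "A \<subseteq> carrier R" "ideal X R" "\<And>m a. m \<in> M \<Longrightarrow> a \<in> A \<Longrightarrow> m \<otimes> a \<in> X"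
  shows "ideal_len X (X <+> Idl A) < \<infinity>"
  using assms(1,2,4)
proof (induction A rule: finite_induct)
  case empty
  have "Idl {} = {\<zero>}" using genideal_minimal[OF zeroideal, of "{}"] idealD(2)[OF genideal_ideal[of "{}"]] by fast
  then have "X <+> Idl {} = X" using sum_absorb(2)[OF zeroideal assms(3)] idealD(2)[OF assms(3)] by simp
  then show ?case using ideal_len_same by simp
next
  case (insert a A)
  have ac: "a \<in> carrier R" and Ac: "A \<subseteq> carrier R" using insert by auto
  have IA: "ideal (Idl A) R" using genideal_ideal[OF Ac] .
  define Z where "Z = X <+> Idl A"
  have Z: "ideal Z R" "X \<subseteq> Z" unfolding Z_def using add_ideals[OF assms(3) IA] sum_upper[OF assms(3) IA] by auto
  have eq: "X <+> Idl (insert a A) = Z <+> PIdl a"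
    unfolding Z_def Idl_insert[OF ac Ac]
    using sum_assoc[OF assms(3) IA cgenideal_ideal[OF ac]] sum_comm[OF IA cgenideal_ideal[OF ac]] by simp
  have "ideal_len X (Z <+> PIdl a) = ideal_len X Z + ideal_len Z (Z <+> PIdl a)"
    by (intro ideal_len_add assms Z add_ideals cgenideal_ideal ac sum_upper)
  moreover have "ideal_len X Z < \<infinity>" unfolding Z_def using insert Ac by blast
  moreover have "ideal_len Z (Z <+> PIdl a) \<le> enat 1"
    using Z insert by (intro ideal_len_cyclic ac) auto
  ultimately show ?case unfolding eq by (auto simp: plus_enat_def split: enat.splits)
qed

text \<open>The subquotient is a finitely generated vector space over the residue field. Finiteness
  is what allows Hilbert functions to be treated as integer functions that can be
  subtracted.\<close>

lemma ideal_len_finite: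
  assumes "ideal K R" "ideal X R" "M \<cdot> K \<subseteq> X"
  shows "ideal_len X (X <+> K) < \<infinity>"
proof -
  obtain A where A: "A \<subseteq> carrier R" "finite A" "K = Idl A" using finetely_gen[OF assms(1)] by auto
  have "m \<otimes> a \<in> X" if "m \<in> M" "a \<in> A" for m a
    using assms(3) ideal_prod.prod[of m M a K R] that genideal_self[OF A(1)] A(3) by blast
  then show ?thesis unfolding A(3) using ideal_len_finite_gen[OF A(2,1) assms(2)] by blast
qed

end

section \<open>The Koszul complex\<close>

text \<open>A Koszul chain assigns to every list \<open>l\<close> the coefficient of the exterior product of the basis vectors
  \<open>e\<^sub>i\<close> with \<open>l ! i = True\<close>, so it lives in homological degree \<open>cnt l\<close>.  Multiplication by \<open>e\<^sub>j\<close> is \<open>koszul_h\<close>,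
  which is a homotopy between \<open>0\<close> and multiplication by \<open>xs ! j\<close>.\<close>

fun koszul_d :: "('a, 'b) ring_scheme \<Rightarrow> 'a list \<Rightarrow> (bool list \<Rightarrow> 'a) \<Rightarrow> bool list \<Rightarrow> 'a" where
  "koszul_d R [] c l = \<zero>\<^bsub>R\<^esub>"
| "koszul_d R (x # xs) c [] = \<zero>\<^bsub>R\<^esub>"
| "koszul_d R (x # xs) c (True # l) = \<ominus>\<^bsub>R\<^esub> koszul_d R xs (\<lambda>l. c (True # l)) l"
| "koszul_d R (x # xs) c (False # l) = koszul_d R xs (\<lambda>l. c (False # l)) l \<oplus>\<^bsub>R\<^esub> x \<otimes>\<^bsub>R\<^esub> c (True # l)"

fun koszul_h :: "('a, 'b) ring_scheme \<Rightarrow> nat \<Rightarrow> (bool list \<Rightarrow> 'a) \<Rightarrow> bool list \<Rightarrow> 'a" where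
  "koszul_h R j c [] = \<zero>\<^bsub>R\<^esub>"
| "koszul_h R 0 c (True # l) = c (False # l)"
| "koszul_h R 0 c (False # l) = \<zero>\<^bsub>R\<^esub>"
| "koszul_h R (Suc j) c (True # l) = \<ominus>\<^bsub>R\<^esub> koszul_h R j (\<lambda>l. c (True # l)) l"
| "koszul_h R (Suc j) c (False # l) = koszul_h R j (\<lambda>l. c (False # l)) l"

abbreviation cnt :: "bool list \<Rightarrow> nat" where "cnt l \<equiv> count_list l True"

text \<open>The internal degree of the basis vector indexed by the list, when the i-th generator is
  given the degree \<open>ss ! i\<close>.\<close>

fun weight :: "nat list \<Rightarrow> bool list \<Rightarrow> nat" where
  "weight [] l = 0"
| "weight (s # ss) [] = 0"
| "weight (s # ss) (b # l) = (if b then s else 0) + weight ss l"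

context cring
begin

lemma minus_self: "x \<in> carrier R \<Longrightarrow> x \<ominus> x = \<zero>"
  by (simp add: a_minus_def r_neg)

lemma koszul_d_closed [simp]:
  "set xs \<subseteq> carrier R \<Longrightarrow> (\<And>l. c l \<in> carrier R) \<Longrightarrow> koszul_d R xs c l \<in> carrier R"
proof (induction xs arbitrary: c l)
  case (Cons x xs)
  show ?case
  proof (cases l)
    case l: (Cons b l')
    show ?thesis unfolding l using Cons by (cases b) simp_all
  qed simp
qed simp

lemma koszul_d_zero [simp]: "set xs \<subseteq> carrier R \<Longrightarrow> koszul_d R xs (\<lambda>_. \<zero>) l = \<zero>"
proof (induction xs arbitrary: l)
  case (Cons x xs)
  show ?case
  proof (cases l)
    case l: (Cons b l')
    show ?thesis unfolding l using Cons by (cases b) simp_all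
  qed simp
qed simp

lemma koszul_d_add:
  "set xs \<subseteq> carrier R \<Longrightarrow> (\<And>l. c l \<in> carrier R) \<Longrightarrow> (\<And>l. d l \<in> carrier R) \<Longrightarrow>
    koszul_d R xs (\<lambda>l. c l \<oplus> d l) l = koszul_d R xs c l \<oplus> koszul_d R xs d l"
proof (induction xs arbitrary: c d l)
  case (Cons x xs)
  show ?case
  proof (cases l)
    case l: (Cons b l')
    show ?thesis unfolding l using Cons by (cases b) (simp_all add: minus_add r_distr a_ac)
  qed simp
qed simp

lemma koszul_d_smult:
  "set xs \<subseteq> carrier R \<Longrightarrow> (\<And>l. c l \<in> carrier R) \<Longrightarrow> r \<in> carrier R \<Longrightarrow>
    koszul_d R xs (\<lambda>l. r \<otimes> c l) l = r \<otimes> koszul_d R xs c l"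
proof (induction xs arbitrary: c l)
  case (Cons x xs)
  show ?case
  proof (cases l)
    case l: (Cons b l')
    show ?thesis unfolding l using Cons by (cases b) (simp_all add: r_minus r_distr m_lcomm)
  qed (simp add: Cons)
qed simp

lemma koszul_d_uminus:
  assumes "set xs \<subseteq> carrier R" "\<And>l. c l \<in> carrier R"
  shows "koszul_d R xs (\<lambda>l. \<ominus> c l) l = \<ominus> koszul_d R xs c l"
proof -
  have "(\<lambda>l. \<ominus> c l) = (\<lambda>l. (\<ominus> \<one>) \<otimes> c l)" using assms(2) by (simp add: l_minus)
  then show ?thesis using koszul_d_smult[OF assms, of "\<ominus> \<one>"] assms by (simp add: l_minus)
qed

lemma koszul_d_minus:
  assumes "set xs \<subseteq> carrier R" "\<And>l. c l \<in> carrier R" "\<And>l. d l \<in> carrier R"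
  shows "koszul_d R xs (\<lambda>l. c l \<ominus> d l) l = koszul_d R xs c l \<ominus> koszul_d R xs d l"
  unfolding a_minus_def using assms by (simp add: koszul_d_add koszul_d_uminus)

lemma koszul_d_koszul_d:
  "set xs \<subseteq> carrier R \<Longrightarrow> (\<And>l. c l \<in> carrier R) \<Longrightarrow> koszul_d R xs (koszul_d R xs c) l = \<zero>"
proof (induction xs arbitrary: c l)
  case (Cons x xs)
  have xs: "set xs \<subseteq> carrier R" "x \<in> carrier R" using Cons.prems by auto
  note c = Cons.prems(2)
  show ?case
  proof (cases l)
    case l: (Cons b l')
    show ?thesis
      unfolding l using xs c Cons.IH[OF xs(1)]
      by (cases b) (simp_all add: koszul_d_uminus koszul_d_add koszul_d_smult a_assoc r_minus r_neg)
  qed simp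
qed simp

text \<open>Removing a basis vector of weight s from the index lowers the weight by s, and the
  coefficient is multiplied by an element that raises the filtration by s; so the differential
  respects the weighted filtration. Only positions one homological degree higher are read, which
  makes statements about a single degree possible.\<close>

lemma koszul_d_mem_weighted:
  assumes "\<And>n. ideal (F n) R" "length ss = length xs" "length l = length xs" "set xs \<subseteq> carrier R"
    and "\<And>i n a. i < length xs \<Longrightarrow> a \<in> F (n - ss ! i) \<Longrightarrow> xs ! i \<otimes> a \<in> F n"
    and "\<And>l'. length l' = length xs \<Longrightarrow> cnt l' = Suc (cnt l) \<Longrightarrow> u l' \<in> F (n - weight ss l')"
  shows "koszul_d R xs u l \<in> F (n - weight ss l)"
  using assms(2-)
proof (induction xs arbitrary: ss l u n)
  case Nil
  then show ?case using idealD(2)[OF assms(1)] by simp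
next
  case (Cons x xs)
  obtain s ss' where ss: "ss = s # ss'" using Cons.prems(1) by (cases ss) auto
  obtain b l' where l: "l = b # l'" using Cons.prems(2) by (cases l) auto
  have step: "xs ! i \<otimes> a \<in> F m" if "i < length xs" "a \<in> F (m - ss' ! i)" for i m a
    using Cons.prems(4)[of "Suc i" a m] that ss by simp
  have IH: "koszul_d R xs v l' \<in> F (m - weight ss' l')"
    if "\<And>l''. length l'' = length xs \<Longrightarrow> cnt l'' = Suc (cnt l') \<Longrightarrow> v l'' \<in> F (m - weight ss' l'')" for v m
    by (rule Cons.IH) (use Cons.prems ss l that step in auto)
  show ?case
  proof (cases b)
    case True
    have "koszul_d R xs (\<lambda>l. u (True # l)) l' \<in> F (n - s - weight ss' l')"
    proof (rule IH)
      fix l'' assume "length l'' = length xs" "cnt l'' = Suc (cnt l')"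
      then show "u (True # l'') \<in> F (n - s - weight ss' l'')"
        using Cons.prems(5)[of "True # l''"] l ss True by simp
    qed
    then show ?thesis unfolding l ss using True idealD(4)[OF assms(1)] by simp
  next
    case False
    have 1: "koszul_d R xs (\<lambda>l. u (False # l)) l' \<in> F (n - weight ss' l')"
    proof (rule IH)
      fix l'' assume "length l'' = length xs" "cnt l'' = Suc (cnt l')"
      then show "u (False # l'') \<in> F (n - weight ss' l'')"
        using Cons.prems(5)[of "False # l''"] l ss False by simp
    qed
    have "u (True # l') \<in> F (n - (s + weight ss' l'))"
      using Cons.prems(2) Cons.prems(5)[of "True # l'"] l ss False by simp
    then have "u (True # l') \<in> F ((n - weight ss' l') - s)" by (simp add: add.commute)
    then have "x \<otimes> u (True # l') \<in> F (n - weight ss' l')" using Cons.prems(4)[of 0] ss by simp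
    then show ?thesis unfolding l ss using False 1 idealD(3)[OF assms(1)] by simp
  qed
qed

text \<open>The case of a constant filtration. With the zero ideal it says that the differential at
  \<open>l\<close> depends only on positions one homological degree higher.\<close>

lemma koszul_d_mem:
  assumes "ideal N R" "set xs \<subseteq> carrier R" "length l = length xs"
    and "\<And>l'. length l' = length xs \<Longrightarrow> cnt l' = Suc (cnt l) \<Longrightarrow> u l' \<in> N"
  shows "koszul_d R xs u l \<in> N"
  using koszul_d_mem_weighted[of "\<lambda>_. N" "replicate (length xs) 0" xs l u 0] assms idealD(6)[OF assms(1)]
  by (simp add: subset_iff)

lemma koszul_h_closed [simp]: "(\<And>l. c l \<in> carrier R) \<Longrightarrow> koszul_h R j c l \<in> carrier R"
proof (induction j arbitrary: c l)
  case 0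
  show ?case
  proof (cases l)
    case l: (Cons b l')
    show ?thesis unfolding l using 0 by (cases b) simp_all
  qed simp
next
  case (Suc j)
  show ?case
  proof (cases l)
    case l: (Cons b l')
    show ?thesis unfolding l using Suc by (cases b) simp_all
  qed simp
qed

lemma koszul_h_mem:
  assumes "ideal N R" "\<And>l'. length l' = length l \<Longrightarrow> Suc (cnt l') = cnt l \<Longrightarrow> u l' \<in> N"
  shows "koszul_h R j u l \<in> N"
  using assms(2)
proof (induction j arbitrary: l u)
  case 0
  show ?case
  proof (cases l)
    case (Cons b l')
    then show ?thesis using 0[of "False # l'"] idealD(2)[OF assms(1)] by (cases b) auto
  qed (simp add: idealD(2)[OF assms(1)])
next
  case (Suc j)
  show ?case
  proof (cases l)
    case (Cons b l')
    have "koszul_h R j (\<lambda>l. u (b # l)) l' \<in> N"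
      by (rule Suc.IH) (use Suc.prems[of "b # _"] Cons in \<open>auto split: if_splits\<close>)
    then show ?thesis using Cons idealD(4)[OF assms(1)] by (cases b) auto
  qed (simp add: idealD(2)[OF assms(1)])
qed

lemma koszul_h_add:
  "(\<And>l. c l \<in> carrier R) \<Longrightarrow> (\<And>l. d l \<in> carrier R) \<Longrightarrow> koszul_h R j (\<lambda>l. c l \<oplus> d l) l = koszul_h R j c l \<oplus> koszul_h R j d l"
proof (induction j arbitrary: c d l)
  case 0
  show ?case
  proof (cases l)
    case l: (Cons b l')
    show ?thesis unfolding l using 0 by (cases b) simp_all
  qed (simp add: 0)
next
  case (Suc j)
  show ?case
  proof (cases l)
    case l: (Cons b l')
    show ?thesis unfolding l using Suc by (cases b) (simp_all add: minus_add)
  qed simp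
qed

lemma koszul_h_smult:
  "(\<And>l. c l \<in> carrier R) \<Longrightarrow> r \<in> carrier R \<Longrightarrow> koszul_h R j (\<lambda>l. r \<otimes> c l) l = r \<otimes> koszul_h R j c l"
proof (induction j arbitrary: c l)
  case 0
  show ?case
  proof (cases l)
    case l: (Cons b l')
    show ?thesis unfolding l using 0 by (cases b) simp_all
  qed (simp add: 0)
next
  case (Suc j)
  show ?case
  proof (cases l)
    case l: (Cons b l')
    show ?thesis unfolding l using Suc by (cases b) (simp_all add: r_minus)
  qed (simp add: Suc)
qed

lemma koszul_h_uminus:
  assumes "\<And>l. c l \<in> carrier R"
  shows "koszul_h R j (\<lambda>l. \<ominus> c l) l = \<ominus> koszul_h R j c l"
proof -
  have "(\<lambda>l. \<ominus> c l) = (\<lambda>l. (\<ominus> \<one>) \<otimes> c l)" using assms by (simp add: l_minus)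
  then show ?thesis using koszul_h_smult[OF assms, of "\<ominus> \<one>"] assms by (simp add: l_minus)
qed

text \<open>If \<open>j\<close> is the first coordinate, contracting the basis vector that was just
  multiplied in leaves the factor \<open>xs ! j\<close>. For a later coordinate the terms that
  contain \<open>x\<close> occur twice with opposite signs and cancel.\<close>

lemma koszul_d_koszul_h:
  "set xs \<subseteq> carrier R \<Longrightarrow> (\<And>l. c l \<in> carrier R) \<Longrightarrow> j < length xs \<Longrightarrow> length l = length xs \<Longrightarrow>
    koszul_d R xs (koszul_h R j c) l \<oplus> koszul_h R j (koszul_d R xs c) l = xs ! j \<otimes> c l"
proof (induction xs arbitrary: j c l)
  case (Cons x xs)
  have xs: "set xs \<subseteq> carrier R" "x \<in> carrier R" using Cons.prems by auto
  note c = Cons.prems(2)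
  obtain b l' where l: "l = b # l'" using Cons.prems(4) by (cases l) auto
  show ?case
  proof (cases j)
    case 0
    show ?thesis unfolding 0 l using xs c by (cases b) (simp_all add: r_neg1)
  next
    case (Suc i)
    have IH: "koszul_d R xs (koszul_h R i v) l' \<oplus> koszul_h R i (koszul_d R xs v) l' = xs ! i \<otimes> v l'" if "\<And>l. v l \<in> carrier R" for v
      using Cons.IH[of v i l'] xs that Cons.prems Suc l by simp
    show ?thesis
    proof (cases b)
      case True
      have "koszul_d R xs (koszul_h R i (\<lambda>l. c (True # l))) l' \<oplus> koszul_h R i (koszul_d R xs (\<lambda>l. c (True # l))) l' = xs ! i \<otimes> c (True # l')"
        using IH[of "\<lambda>l. c (True # l)"] c by simp
      then show ?thesis unfolding Suc l using True xs c
        by (simp add: koszul_d_uminus koszul_h_uminus)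
    next
      case False
      have i: "xs ! i \<in> carrier R" using xs Cons.prems(3) Suc by (simp add: subset_iff)
      let ?A = "koszul_d R xs (koszul_h R i (\<lambda>l. c (False # l))) l'" and ?B = "koszul_h R i (koszul_d R xs (\<lambda>l. c (False # l))) l'"
        and ?C = "x \<otimes> koszul_h R i (\<lambda>l. c (True # l)) l'"
      have cl: "?A \<in> carrier R" "?B \<in> carrier R" "?C \<in> carrier R" using xs c by auto
      have "koszul_d R (x # xs) (koszul_h R j c) l \<oplus> koszul_h R j (koszul_d R (x # xs) c) l = (?A \<oplus> \<ominus> ?C) \<oplus> (?B \<oplus> ?C)"
        unfolding Suc l using False xs c by (simp add: koszul_h_add koszul_h_smult r_minus)
      also have "\<dots> = ?A \<oplus> ?B" using cl by (simp add: a_assoc a_comm[of ?B ?C] r_neg1)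
      also have "\<dots> = xs ! i \<otimes> c (False # l')" using IH[of "\<lambda>l. c (False # l)"] c by simp
      finally show ?thesis unfolding Suc l using False by simp
    qed
  qed
qed simp

text \<open>Exactness of the Koszul complex modulo \<open>N\<close> in homological degree \<open>i\<close>.\<close>

definition koszul_exact :: "'a list \<Rightarrow> 'a set \<Rightarrow> nat \<Rightarrow> bool" where
  "koszul_exact xs N i \<longleftrightarrow> (\<forall>c. (\<forall>l. c l \<in> carrier R) \<longrightarrow>
     (\<forall>l. length l = length xs \<longrightarrow> Suc (cnt l) = i \<longrightarrow> koszul_d R xs c l \<in> N) \<longrightarrow>
     (\<exists>b. (\<forall>l. b l \<in> carrier R) \<and> (\<forall>l. length l = length xs \<longrightarrow> cnt l = i \<longrightarrow> c l \<ominus> koszul_d R xs b l \<in> N)))"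

text \<open>The elements already used are absorbed into \<open>N\<close> instead of being divided
  out, so no tower of quotient rings is formed.\<close>

fun regular_mod :: "'a set \<Rightarrow> 'a list \<Rightarrow> bool" where
  "regular_mod N [] \<longleftrightarrow> True"
| "regular_mod N (y # ys) \<longleftrightarrow> (\<forall>z\<in>carrier R. y \<otimes> z \<in> N \<longrightarrow> z \<in> N) \<and> regular_mod (N <+> PIdl y) ys"

text \<open>The connecting step of the long exact sequence for multiplication by y. If y c is the
  boundary of b modulo \<open>N\<close>, then b is a cycle modulo \<open>N\<close> and y, hence b =
  d e + n + y f in degree i + 1 with n in \<open>N\<close>. Applying d gives y c = y (d f) modulo
  \<open>N\<close>, and y cancels by regularity.\<close>

lemma koszul_exact_cancel:
  assumes N: "ideal N R" and xs: "set xs \<subseteq> carrier R" and y: "y \<in> carrier R"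
    and reg: "\<And>z. z \<in> carrier R \<Longrightarrow> y \<otimes> z \<in> N \<Longrightarrow> z \<in> N"
    and ex: "koszul_exact xs (N <+> PIdl y) (Suc i)"
    and c: "\<And>l. c l \<in> carrier R" and b: "\<And>l. b l \<in> carrier R"
    and yc: "\<And>l. length l = length xs \<Longrightarrow> cnt l = i \<Longrightarrow> y \<otimes> c l \<ominus> koszul_d R xs b l \<in> N"
  shows "\<exists>f. (\<forall>l. f l \<in> carrier R) \<and> (\<forall>l. length l = length xs \<longrightarrow> cnt l = i \<longrightarrow> c l \<ominus> koszul_d R xs f l \<in> N)"
proof -
  let ?N = "N <+> PIdl y"
  have Y: "ideal (PIdl y) R" by (rule cgenideal_ideal[OF y])
  have N': "ideal ?N R" by (rule add_ideals[OF N Y])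
  have NN: "N \<subseteq> ?N" "PIdl y \<subseteq> ?N" using sum_upper[OF N Y] by auto
  have Nc: "\<And>x. x \<in> N \<Longrightarrow> x \<in> carrier R" by (rule idealD(1)[OF N])
  have "koszul_d R xs b l \<in> ?N" if l: "length l = length xs" "Suc (cnt l) = Suc i" for l
  proof -
    have "koszul_d R xs b l = y \<otimes> c l \<ominus> (y \<otimes> c l \<ominus> koszul_d R xs b l)"
      using y c b xs by (simp add: a_minus_def minus_add r_neg1 r_neg2)
    moreover have "y \<otimes> c l \<in> PIdl y" using c[of l] m_comm[OF y c] by (auto simp: mem_PIdl)
    moreover have "y \<otimes> c l \<ominus> koszul_d R xs b l \<in> N" using yc l by simp
    ultimately show ?thesis using idealD(5)[OF N', of "y \<otimes> c l" "y \<otimes> c l \<ominus> koszul_d R xs b l"] NN by auto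
  qed
  then obtain e where e: "\<And>l. e l \<in> carrier R"
      "\<And>l. length l = length xs \<Longrightarrow> cnt l = Suc i \<Longrightarrow> b l \<ominus> koszul_d R xs e l \<in> ?N"
    using ex b unfolding koszul_exact_def by blast
  have "\<exists>n f. n \<in> N \<and> f \<in> carrier R \<and> (length l = length xs \<longrightarrow> cnt l = Suc i \<longrightarrow> b l \<ominus> koszul_d R xs e l = n \<oplus> f \<otimes> y)" for l
  proof (cases "length l = length xs \<and> cnt l = Suc i")
    case True
    then have "b l \<ominus> koszul_d R xs e l \<in> N <+> PIdl y" using e(2) by simp
    then show ?thesis using True unfolding mem_sum_PIdl by auto
  next
    case False
    then show ?thesis using idealD(2)[OF N] zero_closed by blast
  qed
  then obtain n f where nf: "\<And>l. n l \<in> N" "\<And>l. f l \<in> carrier R"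
    "\<And>l. length l = length xs \<Longrightarrow> cnt l = Suc i \<Longrightarrow> b l \<ominus> koszul_d R xs e l = n l \<oplus> f l \<otimes> y"
    by metis
  have nc: "\<And>l. n l \<in> carrier R" using nf(1) Nc by blast
  have kec: "\<And>l. koszul_d R xs e l \<in> carrier R" using xs e by simp
  have "c l \<ominus> koszul_d R xs f l \<in> N" if l: "length l = length xs" "cnt l = i" for l
  proof (rule reg)
    \<comment> \<open>The decomposition of \<open>b\<close> holds only in homological degree i + 1.
      The differential at \<open>l\<close> reads nothing else, so the difference of the two sides
      has boundary zero there.\<close>
    have z: "koszul_d R xs (\<lambda>l. (b l \<ominus> koszul_d R xs e l) \<ominus> (n l \<oplus> y \<otimes> f l)) l \<in> {\<zero>}"
    proof (rule koszul_d_mem[OF zeroideal xs l(1)])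
      fix l' assume "length l' = length xs" "cnt l' = Suc (cnt l)"
      then have "b l' \<ominus> koszul_d R xs e l' = n l' \<oplus> y \<otimes> f l'" using nf l y by (simp add: m_comm)
      then show "(b l' \<ominus> koszul_d R xs e l') \<ominus> (n l' \<oplus> y \<otimes> f l') \<in> {\<zero>}"
        using nc nf(2) y by (simp add: minus_self)
    qed
    have "koszul_d R xs (\<lambda>l. (b l \<ominus> koszul_d R xs e l) \<ominus> (n l \<oplus> y \<otimes> f l)) l
        = (koszul_d R xs b l \<ominus> \<zero>) \<ominus> (koszul_d R xs n l \<oplus> y \<otimes> koszul_d R xs f l)"
      using xs b e nc nf(2) y kec by (simp add: koszul_d_minus koszul_d_add koszul_d_smult koszul_d_koszul_d)
    also have "koszul_d R xs b l \<ominus> \<zero> = koszul_d R xs b l" using xs b by (simp add: a_minus_def)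
    finally have "koszul_d R xs b l \<ominus> (koszul_d R xs n l \<oplus> y \<otimes> koszul_d R xs f l) = \<zero>" using z by simp
    then have eq: "koszul_d R xs b l = koszul_d R xs n l \<oplus> y \<otimes> koszul_d R xs f l"
      using minus_add_cancel[of "koszul_d R xs b l" "koszul_d R xs n l \<oplus> y \<otimes> koszul_d R xs f l"] xs b nc nf(2) y by simp
    show "c l \<ominus> koszul_d R xs f l \<in> carrier R" using c xs nf by simp
    have "koszul_d R xs n l \<in> N" by (rule koszul_d_mem[OF N xs l(1)]) (rule nf(1))
    moreover have "y \<otimes> c l \<ominus> koszul_d R xs b l \<in> N" using yc l by blast
    ultimately have "(y \<otimes> c l \<ominus> koszul_d R xs b l) \<oplus> koszul_d R xs n l \<in> N" by (rule idealD(3)[OF N, rotated])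
    moreover have "(y \<otimes> c l \<ominus> koszul_d R xs b l) \<oplus> koszul_d R xs n l = y \<otimes> (c l \<ominus> koszul_d R xs f l)"
    proof -
      let ?n = "koszul_d R xs n l" and ?f = "y \<otimes> koszul_d R xs f l" and ?c = "y \<otimes> c l"
      have cl: "?n \<in> carrier R" "?f \<in> carrier R" "?c \<in> carrier R" using xs nc nf y c by auto
      have "(?c \<ominus> (?n \<oplus> ?f)) \<oplus> ?n = ?c \<ominus> ?f"
        using cl by (simp add: a_minus_def minus_add a_assoc a_comm[of "\<ominus> ?f" ?n] r_neg1)
      then show ?thesis using eq y c xs nf by (simp add: a_minus_def r_distr r_minus)
    qed
    ultimately show "y \<otimes> (c l \<ominus> koszul_d R xs f l) \<in> N" by simp
  qed
  then show ?thesis using nf by blast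
qed

text \<open>Depth sensitivity of the Koszul complex.  The homology in degree \<open>i\<close> is killed by the entries of
  \<open>xs\<close>, hence by a power of the first element \<open>y\<close> of the regular sequence; on the other hand
  \<open>y\<close> acts injectively on it, by exactness modulo \<open>y\<close> in degree \<open>i + 1\<close>.\<close>

lemma koszul_exact_of_regular:
  assumes "ideal N R" "set xs \<subseteq> carrier R" "set ys \<subseteq> carrier R" "regular_mod N ys"
    and "\<And>y. y \<in> set ys \<Longrightarrow> \<exists>t::nat. y [^] t \<in> N <+> Idl (set xs)"
    and "length xs < i + length ys"
  shows "koszul_exact xs N i"
  using assms(1,3-)
proof (induction ys arbitrary: N i)
  case Nil
  \<comment> \<open>With no regular elements left, \<open>i\<close> exceeds \<open>length xs\<close>
    and the complex has no positions in that degree.\<close>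
  have "cnt l \<noteq> i" if "length l = length xs" for l
    using count_le_length[of l True] that Nil by auto
  then show ?case unfolding koszul_exact_def using zero_closed by blast
next
  case (Cons y ys)
  note N = Cons.prems(1) and xs = assms(2)
  have y: "y \<in> carrier R" using Cons.prems by simp
  have Y: "ideal (PIdl y) R" by (rule cgenideal_ideal[OF y])
  have X: "ideal (Idl (set xs)) R" by (rule genideal_ideal[OF xs])
  let ?N = "N <+> PIdl y"
  have N': "ideal ?N R" by (rule add_ideals[OF N Y])
  have NN: "N \<subseteq> ?N" using sum_upper[OF N Y] by auto
  have ex: "koszul_exact xs ?N (Suc i)"
  proof (rule Cons.IH[OF N'])
    fix z assume "z \<in> set ys"
    then obtain t :: nat where "z [^] t \<in> N <+> Idl (set xs)" using Cons.prems(4)[of z] by auto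
    then show "\<exists>t::nat. z [^] t \<in> ?N <+> Idl (set xs)" using sum_mono[OF NN order_refl] by blast
  qed (use Cons.prems in auto)
  have reg: "\<And>z. z \<in> carrier R \<Longrightarrow> y \<otimes> z \<in> N \<Longrightarrow> z \<in> N" using Cons.prems(3) by simp
  show ?case
    unfolding koszul_exact_def
  proof (intro allI impI)
    fix c
    assume c': "\<forall>l. c l \<in> carrier R"
      and cyc: "\<forall>l. length l = length xs \<longrightarrow> Suc (cnt l) = i \<longrightarrow> koszul_d R xs c l \<in> N"
    have c: "\<And>l. c l \<in> carrier R" using c' by simp
    \<comment> \<open>The annihilator of the class of \<open>c\<close> in homology; the aim is to
      bring 1 into it.\<close>
    define T where "T = {r \<in> carrier R. \<exists>b. (\<forall>l. b l \<in> carrier R) \<and>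
        (\<forall>l. length l = length xs \<longrightarrow> cnt l = i \<longrightarrow> r \<otimes> c l \<ominus> koszul_d R xs b l \<in> N)}"
    have T: "ideal T R"
    proof (rule idealI')
      show "T \<subseteq> carrier R" by (auto simp: T_def)
      show "\<zero> \<in> T"
        unfolding T_def using xs c idealD(2)[OF N] by (auto intro!: exI[of _ "\<lambda>_. \<zero>"] simp: minus_self)
    next
      fix r s assume "r \<in> T" "s \<in> T"
      then obtain b b' where b: "r \<in> carrier R" "s \<in> carrier R" "\<And>l. b l \<in> carrier R" "\<And>l. b' l \<in> carrier R"
        "\<And>l. length l = length xs \<Longrightarrow> cnt l = i \<Longrightarrow> r \<otimes> c l \<ominus> koszul_d R xs b l \<in> N"
        "\<And>l. length l = length xs \<Longrightarrow> cnt l = i \<Longrightarrow> s \<otimes> c l \<ominus> koszul_d R xs b' l \<in> N"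
        unfolding T_def by blast
      have "(r \<oplus> s) \<otimes> c l \<ominus> koszul_d R xs (\<lambda>l. b l \<oplus> b' l) l \<in> N" if l: "length l = length xs" "cnt l = i" for l
      proof -
        have "(r \<oplus> s) \<otimes> c l \<ominus> koszul_d R xs (\<lambda>l. b l \<oplus> b' l) l = (r \<otimes> c l \<ominus> koszul_d R xs b l) \<oplus> (s \<otimes> c l \<ominus> koszul_d R xs b' l)"
          using b(1-4) c xs by (simp add: koszul_d_add a_minus_def l_distr minus_add a_ac)
        then show ?thesis using idealD(3)[OF N b(5,6)] l by simp
      qed
      then show "r \<oplus> s \<in> T" unfolding T_def using b(1-4) by (auto intro!: exI[of _ "\<lambda>l. b l \<oplus> b' l"])
    next
      fix r s assume "r \<in> carrier R" "s \<in> T"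
      then obtain b where b: "r \<in> carrier R" "s \<in> carrier R" "\<And>l. b l \<in> carrier R"
        "\<And>l. length l = length xs \<Longrightarrow> cnt l = i \<Longrightarrow> s \<otimes> c l \<ominus> koszul_d R xs b l \<in> N"
        unfolding T_def by blast
      have "(r \<otimes> s) \<otimes> c l \<ominus> koszul_d R xs (\<lambda>l. r \<otimes> b l) l \<in> N" if l: "length l = length xs" "cnt l = i" for l
      proof -
        have "(r \<otimes> s) \<otimes> c l \<ominus> koszul_d R xs (\<lambda>l. r \<otimes> b l) l = r \<otimes> (s \<otimes> c l \<ominus> koszul_d R xs b l)"
          using b(1-3) c xs by (simp add: koszul_d_smult a_minus_def r_distr r_minus m_assoc)
        then show ?thesis using idealD(6)[OF N b(1) b(4)] l by simp
      qed
      then show "r \<otimes> s \<in> T" unfolding T_def using b(1-3) by (auto intro!: exI[of _ "\<lambda>l. r \<otimes> b l"])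
    qed
    have "N \<subseteq> T"
    proof
      fix r assume r: "r \<in> N"
      have "r \<otimes> c l \<ominus> koszul_d R xs (\<lambda>_. \<zero>) l \<in> N" for l
        using idealD(7)[OF N c r] xs c idealD(1)[OF N r] by (simp add: a_minus_def)
      then show "r \<in> T" unfolding T_def using idealD(1)[OF N r] by (auto intro!: exI[of _ "\<lambda>_. \<zero>"])
    qed
    moreover have "set xs \<subseteq> T"
    proof
      fix x assume "x \<in> set xs"
      then obtain j where j: "j < length xs" "x = xs ! j" by (auto simp: in_set_conv_nth)
      have xc: "x \<in> carrier R" using xs \<open>x \<in> set xs\<close> by auto
      have "x \<otimes> c l \<ominus> koszul_d R xs (koszul_h R j c) l \<in> N" if l: "length l = length xs" "cnt l = i" for l
      proof -
        have "koszul_h R j (koszul_d R xs c) l \<in> N"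
          by (rule koszul_h_mem[OF N]) (use cyc l in simp)
        moreover have "x \<otimes> c l = koszul_d R xs (koszul_h R j c) l \<oplus> koszul_h R j (koszul_d R xs c) l"
          using koszul_d_koszul_h[OF xs c j(1) l(1)] j by simp
        ultimately show ?thesis using add_minus_cancel xs c by simp
      qed
      then show "x \<in> T" unfolding T_def using xc c by (auto intro!: exI[of _ "koszul_h R j c"])
    qed
    then have "Idl (set xs) \<subseteq> T" by (rule genideal_minimal[OF T])
    ultimately have "N <+> Idl (set xs) \<subseteq> T" using sum_subset_iff[OF N X T] by simp
    moreover obtain t :: nat where "y [^] t \<in> N <+> Idl (set xs)" using Cons.prems(4)[of y] by auto
    ultimately have "y [^] t \<in> T" by blast
    then have "\<one> \<in> T"
    proof (induction t)
      case (Suc t)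
      have yt: "y [^] t \<in> carrier R" using y by simp
      obtain b where b: "\<And>l. b l \<in> carrier R"
        "\<And>l. length l = length xs \<Longrightarrow> cnt l = i \<Longrightarrow> y [^] Suc t \<otimes> c l \<ominus> koszul_d R xs b l \<in> N"
        using Suc.prems unfolding T_def by blast
      have "\<exists>f. (\<forall>l. f l \<in> carrier R) \<and> (\<forall>l. length l = length xs \<longrightarrow> cnt l = i \<longrightarrow> y [^] t \<otimes> c l \<ominus> koszul_d R xs f l \<in> N)"
      proof (rule koszul_exact_cancel[OF N xs y reg ex])
        fix l assume "length l = length xs" "cnt l = i"
        then show "y \<otimes> (y [^] t \<otimes> c l) \<ominus> koszul_d R xs b l \<in> N" using b(2)[of l] y yt c by (simp add: m_ac)
      qed (use b c yt in auto)
      then show ?case using Suc.IH yt unfolding T_def by blast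
    qed simp
    then show "\<exists>b. (\<forall>l. b l \<in> carrier R) \<and> (\<forall>l. length l = length xs \<longrightarrow> cnt l = i \<longrightarrow> c l \<ominus> koszul_d R xs b l \<in> N)"
      unfolding T_def using c by simp
  qed
qed

end

section \<open>The Rees algebra and the associated graded ring\<close>

declare ideal_pow.simps(2) [simp del]

text \<open>A regular sequence in the image of a surjection is regular modulo the preimage of the
  ideal, for any choice of lifts. \<open>A\<close> collects the elements already passed: moving the
  next one from \<open>ys\<close> to \<open>A\<close> leaves every ideal in the hypothesis
  unchanged, so the induction runs over all \<open>A\<close>.\<close>

lemma (in cring) regular_mod_lift:
  assumes h: "ring_hom_ring R S h" and S: "cring S" and surj: "h ` carrier R = carrier S"
    and A: "A \<subseteq> carrier S" and ys: "set ys \<subseteq> carrier R"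
    and reg: "\<And>i z. i < length ys \<Longrightarrow> z \<in> carrier S \<Longrightarrow>
      h (ys ! i) \<otimes>\<^bsub>S\<^esub> z \<in> genideal S (A \<union> set (take i (map h ys))) \<Longrightarrow> z \<in> genideal S (A \<union> set (take i (map h ys)))"
  shows "regular_mod {z \<in> carrier R. h z \<in> genideal S A} ys"
  using A ys reg
proof (induction ys arbitrary: A)
  case (Cons y ys)
  interpret S: cring S by fact
  interpret h: ring_hom_ring R S h by fact
  have y: "y \<in> carrier R" and hy: "h y \<in> carrier S" using Cons.prems by auto
  let ?N = "{z \<in> carrier R. h z \<in> genideal S A}"
  have IA: "ideal (genideal S A) S" by (rule S.genideal_ideal[OF Cons.prems(1)])
  have nzd: "z \<in> ?N" if "z \<in> carrier R" "y \<otimes> z \<in> ?N" for z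
    using Cons.prems(3)[of 0 "h z"] that y by simp
  have eq: "?N <+> PIdl y = {z \<in> carrier R. h z \<in> genideal S (insert (h y) A)}"
  proof (intro Set.set_eqI iffI)
    fix z assume "z \<in> ?N <+> PIdl y"
    then obtain n r where nr: "n \<in> carrier R" "h n \<in> genideal S A" "r \<in> carrier R" "z = n \<oplus> r \<otimes> y"
      by (auto simp: mem_sum_PIdl)
    then have "h z = h r \<otimes>\<^bsub>S\<^esub> h y \<oplus>\<^bsub>S\<^esub> h n" using y by (simp add: S.a_comm)
    moreover have "h r \<otimes>\<^bsub>S\<^esub> h y \<in> cgenideal S (h y)" using nr by (auto simp: S.mem_PIdl)
    ultimately have "h z \<in> genideal S (insert (h y) A)"
      unfolding S.Idl_insert[OF hy Cons.prems(1)] S.mem_sum_iff using nr by blast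
    then show "z \<in> {z \<in> carrier R. h z \<in> genideal S (insert (h y) A)}" using nr y by simp
  next
    fix z assume "z \<in> {z \<in> carrier R. h z \<in> genideal S (insert (h y) A)}"
    then have z: "z \<in> carrier R" "h z \<in> genideal S (insert (h y) A)" by auto
    then obtain u v where uv: "u \<in> carrier S" "v \<in> genideal S A" "h z = u \<otimes>\<^bsub>S\<^esub> h y \<oplus>\<^bsub>S\<^esub> v"
      unfolding S.Idl_insert[OF hy Cons.prems(1)] by (auto simp: S.mem_sum_iff S.mem_PIdl)
    obtain r where r: "r \<in> carrier R" "h r = u" using uv(1) surj by (metis imageE)
    have vc: "v \<in> carrier S" by (rule S.idealD(1)[OF IA uv(2)])
    have "h (z \<ominus> r \<otimes> y) = v"
      using z r y uv vc hy by (simp add: a_minus_def S.a_comm[of _ v] S.a_assoc S.r_neg)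
    then have "z \<ominus> r \<otimes> y \<in> ?N" using z r y uv by simp
    moreover have "z = (z \<ominus> r \<otimes> y) \<oplus> r \<otimes> y" using minus_add_cancel z r y by simp
    ultimately show "z \<in> ?N <+> PIdl y" unfolding mem_sum_PIdl using r by blast
  qed
  have "regular_mod {z \<in> carrier R. h z \<in> genideal S (insert (h y) A)} ys"
  proof (rule Cons.IH)
    fix i z
    assume "i < length ys" "z \<in> carrier S"
      "h (ys ! i) \<otimes>\<^bsub>S\<^esub> z \<in> genideal S (insert (h y) A \<union> set (take i (map h ys)))"
    then show "z \<in> genideal S (insert (h y) A \<union> set (take i (map h ys)))"
      using Cons.prems(3)[of "Suc i" z] by simp
  qed (use Cons.prems hy in auto)
  then show ?case using nzd eq by simp
qed simp

context cring
begin

text \<open>The Rees algebra of \<open>M\<close>, as a subring of the polynomial ring.\<close>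

definition rees :: "'a set \<Rightarrow> ('a, nat \<Rightarrow> 'a) up_ring" where
  "rees M = (UP R)\<lparr>carrier := {p \<in> up R. \<forall>n. p n \<in> ideal_pow R M n}\<rparr>"

lemma rees_simps:
  "carrier (rees M) = {p \<in> up R. \<forall>n. p n \<in> ideal_pow R M n}"
  "\<zero>\<^bsub>rees M\<^esub> = (\<lambda>_. \<zero>)" "\<one>\<^bsub>rees M\<^esub> = (\<lambda>n. if n = 0 then \<one> else \<zero>)"
  "p \<in> up R \<Longrightarrow> q \<in> up R \<Longrightarrow> p \<oplus>\<^bsub>rees M\<^esub> q = (\<lambda>n. p n \<oplus> q n)"
  "p \<in> up R \<Longrightarrow> q \<in> up R \<Longrightarrow> p \<otimes>\<^bsub>rees M\<^esub> q = (\<lambda>n. \<Oplus>i\<in>{..n}. p i \<otimes> q (n - i))"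
  by (simp_all add: rees_def UP_def)

lemma ideal_finsum:
  assumes "ideal I R" "finite A" "\<And>i. i \<in> A \<Longrightarrow> f i \<in> I"
  shows "finsum R f A \<in> I"
  using assms(2,3)
proof (induction A rule: finite_induct)
  case (insert a A)
  have "f \<in> A \<rightarrow> carrier R" "f a \<in> carrier R" using insert.prems idealD(1)[OF assms(1)] by blast+
  then show ?case using insert idealD(3)[OF assms(1)] by simp
qed (simp add: idealD(2)[OF assms(1)])

lemma rees_cring:
  assumes M: "ideal M R"
  shows "cring (rees M)"
proof -
  interpret U: UP_cring R "UP R" by unfold_locales
  let ?H = "{p \<in> up R. \<forall>n. p n \<in> ideal_pow R M n}"
  have I: "\<And>n. ideal (ideal_pow R M n) R" using ideal_pow_ideal[OF M] .
  have c: "carrier (UP R) = up R" by (simp add: UP_def)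
  have "subring ?H (UP R)"
  proof (rule U.subringI)
    show "?H \<subseteq> carrier (UP R)" by (auto simp: c)
    have "\<one> \<in> ideal_pow R M 0" by simp
    then show "\<one>\<^bsub>UP R\<^esub> \<in> ?H" using up_one_closed idealD(2)[OF I] by (simp add: UP_def)
  next
    fix p assume p: "p \<in> ?H"
    have pu: "p \<in> carrier (UP R)" using p by (simp add: c)
    then have mu: "\<ominus>\<^bsub>UP R\<^esub> p \<in> up R" using U.P.a_inv_closed[OF pu] by (simp add: c)
    have "coeff (UP R) q n = q n" if "q \<in> up R" for q n using that by (simp add: UP_def)
    then have "(\<ominus>\<^bsub>UP R\<^esub> p) n = \<ominus> p n" for n
      using U.coeff_a_inv[OF pu, of n] mu p by simp
    then show "\<ominus>\<^bsub>UP R\<^esub> p \<in> ?H" using p mu idealD(4)[OF I] by simp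
  next
    fix p q assume pq: "p \<in> ?H" "q \<in> ?H"
    have "(p \<otimes>\<^bsub>UP R\<^esub> q) n \<in> ideal_pow R M n" for n
    proof -
      have "(p \<otimes>\<^bsub>UP R\<^esub> q) n = (\<Oplus>i\<in>{..n}. p i \<otimes> q (n - i))" using pq by (simp add: UP_def)
      also have "\<dots> \<in> ideal_pow R M n"
      proof (rule ideal_finsum[OF I])
        fix i assume "i \<in> {..n}"
        then show "p i \<otimes> q (n - i) \<in> ideal_pow R M n"
          using ideal_pow_mult_mem[OF M, of "p i" i "q (n - i)" "n - i"] pq by simp
      qed simp
      finally show ?thesis .
    qed
    then show "p \<otimes>\<^bsub>UP R\<^esub> q \<in> ?H" using pq U.UP_mult_closed[of p q] by (simp add: c)
    have "(p \<oplus>\<^bsub>UP R\<^esub> q) n = p n \<oplus> q n" for n using pq by (simp add: UP_def)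
    then show "p \<oplus>\<^bsub>UP R\<^esub> q \<in> ?H" using pq U.UP_a_closed[of p q] idealD(3)[OF I] by (simp add: c)
  qed
  then have "subcring ?H (UP R)" by (rule U.P.subcringI')
  then show ?thesis unfolding rees_def using U.P.subcring_iff[of ?H] by (auto simp: c)
qed

section \<open>The projection of the Rees algebra onto the associated graded ring\<close>

definition rees_proj :: "'a set \<Rightarrow> (nat \<Rightarrow> 'a) \<Rightarrow> nat \<Rightarrow> 'a set" where
  "rees_proj M p = (\<lambda>n. ideal_pow R M (Suc n) +> p n)"

lemma coset_eq_iff:
  assumes "ideal I R" "a \<in> carrier R" "b \<in> carrier R"
  shows "I +> a = I +> b \<longleftrightarrow> a \<ominus> b \<in> I"
  using quotient_eq_iff_same_a_r_cos[OF assms] by simp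

lemma mem_coset_iff:
  assumes "ideal I R" "a \<in> carrier R"
  shows "b \<in> I +> a \<longleftrightarrow> b \<in> carrier R \<and> b \<ominus> a \<in> I"
proof -
  have "b \<in> I +> a \<longleftrightarrow> (\<exists>i\<in>I. b = i \<oplus> a)" by (auto simp: a_r_coset_def')
  also have "\<dots> \<longleftrightarrow> b \<in> carrier R \<and> b \<ominus> a \<in> I"
  proof
    assume "\<exists>i\<in>I. b = i \<oplus> a"
    then obtain i where "i \<in> I" "b = i \<oplus> a" by blast
    then show "b \<in> carrier R \<and> b \<ominus> a \<in> I" using add_minus_cancel2 assms(2) idealD(1)[OF assms(1)] by simp
  next
    assume "b \<in> carrier R \<and> b \<ominus> a \<in> I"
    then show "\<exists>i\<in>I. b = i \<oplus> a" using minus_add_cancel[of b a] assms(2) by (intro bexI[of _ "b \<ominus> a"]) auto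
  qed
  finally show ?thesis .
qed

lemma coset_zero: "ideal I R \<Longrightarrow> I +> \<zero> = I"
  using a_coset_add_zero ideal_subset by blast

lemma gr_rep_coset:
  assumes "ideal I R" "a \<in> carrier R"
  shows "gr_rep (I +> a) \<in> carrier R" "gr_rep (I +> a) \<ominus> a \<in> I"
proof -
  have "a \<in> I +> a" using mem_coset_iff[OF assms] assms(2) idealD(2)[OF assms(1)] by (simp add: minus_self)
  then have "gr_rep (I +> a) \<in> I +> a" unfolding gr_rep_def by (rule someI)
  then show "gr_rep (I +> a) \<in> carrier R" "gr_rep (I +> a) \<ominus> a \<in> I" using mem_coset_iff[OF assms] by auto
qed

text \<open>The difference is (a' - a) b' + a (b' - b), and both summands have order at least i + j
  + 1. Hence the class of a product does not depend on the representatives.\<close>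

lemma mult_diff_mem:
  assumes M: "ideal M R" and a: "a \<in> ideal_pow R M i" and b: "b \<in> ideal_pow R M j"
    and a': "a' \<in> carrier R" "a' \<ominus> a \<in> ideal_pow R M (Suc i)"
    and b': "b' \<in> carrier R" "b' \<ominus> b \<in> ideal_pow R M (Suc j)"
  shows "a' \<otimes> b' \<ominus> a \<otimes> b \<in> ideal_pow R M (Suc (i + j))"
proof -
  have I: "\<And>n. ideal (ideal_pow R M n) R" using ideal_pow_ideal[OF M] .
  have ac: "a \<in> carrier R" "b \<in> carrier R" using a b idealD(1)[OF I] by auto
  have "b' = (b' \<ominus> b) \<oplus> b" using minus_add_cancel b' ac by simp
  moreover have "b' \<ominus> b \<in> ideal_pow R M j" using b' ideal_pow_antimono[OF M, of j "Suc j"] by auto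
  ultimately have b'': "b' \<in> ideal_pow R M j" using idealD(3)[OF I, of "b' \<ominus> b" j b] b by simp
  have "a' \<otimes> b' \<ominus> a \<otimes> b = (a' \<ominus> a) \<otimes> b' \<oplus> a \<otimes> (b' \<ominus> b)"
  proof -
    have "(a' \<ominus> a) \<otimes> b' \<oplus> a \<otimes> (b' \<ominus> b) = (a' \<otimes> b' \<oplus> \<ominus> (a \<otimes> b')) \<oplus> (a \<otimes> b' \<oplus> \<ominus> (a \<otimes> b))"
      using ac a' b' by (simp add: a_minus_def l_distr r_distr l_minus r_minus)
    also have "\<dots> = a' \<otimes> b' \<oplus> \<ominus> (a \<otimes> b)"
      using ac a' b' by (simp add: a_assoc r_neg1)
    finally show ?thesis by (simp add: a_minus_def)
  qed
  moreover have "(a' \<ominus> a) \<otimes> b' \<in> ideal_pow R M (Suc (i + j))"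
    using ideal_pow_mult_mem[OF M a'(2) b''] by simp
  moreover have "a \<otimes> (b' \<ominus> b) \<in> ideal_pow R M (Suc (i + j))"
    using ideal_pow_mult_mem[OF M a b'(2)] by simp
  ultimately show ?thesis using idealD(3)[OF I] by simp
qed

text \<open>Coefficientwise reduction, with kernel the polynomials whose n-th coefficient lies in
  M^(n+1). Compatibility with products is the independence of the representatives picked by
  \<open>gr_rep\<close>.\<close>

lemma rees_proj_hom:
  assumes M: "ideal M R"
  shows "rees_proj M \<in> ring_hom (rees M) (assoc_graded R M)"
    and "rees_proj M ` carrier (rees M) = carrier (assoc_graded R M)"
proof -
  have I: "\<And>n. ideal (ideal_pow R M n) R" using ideal_pow_ideal[OF M] .
  have upc: "\<And>p n. p \<in> up R \<Longrightarrow> p n \<in> carrier R" by (rule mem_upD)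
  have closed: "rees_proj M p \<in> carrier (assoc_graded R M)" if p: "p \<in> carrier (rees M)" for p
  proof -
    have p': "p \<in> up R" "\<And>n. p n \<in> ideal_pow R M n" using p by (auto simp: rees_simps)
    obtain b where b: "bound \<zero> b p" using p'(1) by auto
    have big: "rees_proj M p n = ideal_pow R M (Suc n)" if "b < n" for n
      using bound.bound[OF b that] coset_zero[OF I] by (simp add: rees_proj_def)
    have "{n. rees_proj M p n \<noteq> ideal_pow R M (Suc n)} \<subseteq> {..b}"
    proof
      fix n assume "n \<in> {n. rees_proj M p n \<noteq> ideal_pow R M (Suc n)}"
      then show "n \<in> {..b}" using big[of n] by (cases "b < n") auto
    qed
    then have "finite {n. rees_proj M p n \<noteq> ideal_pow R M (Suc n)}" by (rule finite_subset) simp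
    moreover have "rees_proj M p n \<in> gr_comp R M n" for n
      unfolding gr_comp_def rees_proj_def using p'(2) by blast
    ultimately show ?thesis by (simp add: assoc_graded_def gr_carrier_def)
  qed
  show "rees_proj M \<in> ring_hom (rees M) (assoc_graded R M)"
  proof (rule ring_hom_memI)
    fix p q assume p: "p \<in> carrier (rees M)" and q: "q \<in> carrier (rees M)"
    have p': "p \<in> up R" "\<And>n. p n \<in> ideal_pow R M n" using p by (auto simp: rees_simps)
    have q': "q \<in> up R" "\<And>n. q n \<in> ideal_pow R M n" using q by (auto simp: rees_simps)
    note pc = upc[OF p'(1)] and qc = upc[OF q'(1)]
    show "rees_proj M (p \<oplus>\<^bsub>rees M\<^esub> q) = rees_proj M p \<oplus>\<^bsub>assoc_graded R M\<^esub> rees_proj M q"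
    proof (rule ext)
      fix n
      have "abelian_subgroup (ideal_pow R M (Suc n)) R"
        using I[of "Suc n"] by (simp add: abelian_subgroupI3 ideal_def is_abelian_group)
      then show "rees_proj M (p \<oplus>\<^bsub>rees M\<^esub> q) n = (rees_proj M p \<oplus>\<^bsub>assoc_graded R M\<^esub> rees_proj M q) n"
        using abelian_subgroup.a_rcos_sum[of "ideal_pow R M (Suc n)" R "p n" "q n"] pc qc
        by (simp add: rees_proj_def assoc_graded_def rees_simps p'(1) q'(1))
    qed
    show "rees_proj M (p \<otimes>\<^bsub>rees M\<^esub> q) = rees_proj M p \<otimes>\<^bsub>assoc_graded R M\<^esub> rees_proj M q"
    proof (rule ext)
      fix n
      let ?I = "ideal_pow R M (Suc n)"
      interpret H: ring_hom_ring R "R Quot ?I" "(+>) ?I" by (rule ideal.rcos_ring_hom_ring[OF I])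
      have "(rees_proj M p \<otimes>\<^bsub>assoc_graded R M\<^esub> rees_proj M q) n =
          finsum (R Quot ?I) (\<lambda>i. ?I +> (gr_rep (rees_proj M p i) \<otimes> gr_rep (rees_proj M q (n - i)))) {..n}"
        by (simp add: assoc_graded_def gr_mult_def)
      also have "\<dots> = finsum (R Quot ?I) (\<lambda>i. ?I +> (p i \<otimes> q (n - i))) {..n}"
      proof (rule H.S.finsum_cong')
        fix i assume i: "i \<in> {..n}"
        note rp = gr_rep_coset[OF I[of "Suc i"] pc[of i]] and rq = gr_rep_coset[OF I[of "Suc (n - i)"] qc[of "n - i"]]
        have "gr_rep (rees_proj M p i) \<otimes> gr_rep (rees_proj M q (n - i)) \<ominus> p i \<otimes> q (n - i) \<in> ideal_pow R M (Suc (i + (n - i)))"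
          unfolding rees_proj_def
          by (rule mult_diff_mem[OF M p'(2) q'(2) rp rq])
        then show "?I +> (gr_rep (rees_proj M p i) \<otimes> gr_rep (rees_proj M q (n - i))) = ?I +> (p i \<otimes> q (n - i))"
          using i coset_eq_iff[OF I[of "Suc n"]] rp(1) rq(1) pc qc by (simp add: rees_proj_def del: H.hom_mult)
      next
        show "(\<lambda>i. ?I +> (p i \<otimes> q (n - i))) \<in> {..n} \<rightarrow> carrier (R Quot ?I)"
          using H.hom_closed pc qc by (simp)
      qed simp
      also have "\<dots> = ?I +> (\<Oplus>i\<in>{..n}. p i \<otimes> q (n - i))"
        using H.hom_finsum[of "\<lambda>i. p i \<otimes> q (n - i)" "{..n}"] pc qc by (simp add: o_def)
      finally show "rees_proj M (p \<otimes>\<^bsub>rees M\<^esub> q) n = (rees_proj M p \<otimes>\<^bsub>assoc_graded R M\<^esub> rees_proj M q) n"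
        by (simp add: rees_proj_def rees_simps p'(1) q'(1))
    qed
  next
    show "rees_proj M \<one>\<^bsub>rees M\<^esub> = \<one>\<^bsub>assoc_graded R M\<^esub>"
      using coset_zero[OF I] by (intro ext) (simp add: rees_proj_def rees_simps assoc_graded_def)
  qed (rule closed)
  show "rees_proj M ` carrier (rees M) = carrier (assoc_graded R M)"
  proof (intro equalityI subsetI)
    fix f assume "f \<in> carrier (assoc_graded R M)"
    then have f: "\<And>n. f n \<in> gr_comp R M n" "finite {n. f n \<noteq> ideal_pow R M (Suc n)}"
      by (auto simp: assoc_graded_def gr_carrier_def)
    \<comment> \<open>Taking zero as representative of each trivial coset keeps the support finite,
      so that the chosen coefficients form a polynomial.\<close>
    have "\<exists>a. a \<in> ideal_pow R M n \<and> f n = ideal_pow R M (Suc n) +> a \<and> (f n = ideal_pow R M (Suc n) \<longrightarrow> a = \<zero>)" for n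
    proof (cases "f n = ideal_pow R M (Suc n)")
      case True
      then show ?thesis using coset_zero[OF I, of "Suc n"] idealD(2)[OF I] by (intro exI[of _ \<zero>]) simp
    next
      case False
      then show ?thesis using f(1)[of n] unfolding gr_comp_def by blast
    qed
    then obtain p where p: "\<And>n. p n \<in> ideal_pow R M n" "\<And>n. f n = ideal_pow R M (Suc n) +> p n"
      "\<And>n. f n = ideal_pow R M (Suc n) \<Longrightarrow> p n = \<zero>" by metis
    obtain b where b: "\<And>n. f n \<noteq> ideal_pow R M (Suc n) \<Longrightarrow> n \<le> b"
      using f(2) unfolding finite_nat_set_iff_bounded_le by blast
    have "p \<in> up R"
    proof (rule mem_upI)
      show "p n \<in> carrier R" for n using p(1) idealD(1)[OF I] by blast
      have "bound \<zero> b p" using b p(3) by (metis bound.intro linorder_not_le)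
      then show "\<exists>n. bound \<zero> n p" by blast
    qed
    then have "p \<in> carrier (rees M)" using p(1) by (simp add: rees_simps)
    moreover have "rees_proj M p = f" using p(2) by (auto simp: rees_proj_def)
    ultimately show "f \<in> rees_proj M ` carrier (rees M)" by blast
  qed (use closed in auto)
qed

text \<open>The ring axioms are those of a homomorphic image of the Rees algebra, so no
  associativity has to be computed with chosen representatives.\<close>

lemma assoc_graded_cring:
  assumes M: "ideal M R"
  shows "cring (assoc_graded R M)" "ring_hom_ring (rees M) (assoc_graded R M) (rees_proj M)"
proof -
  interpret S: cring "rees M" by (rule rees_cring[OF M])
  note hom = rees_proj_hom[OF M]
  have z: "rees_proj M \<zero>\<^bsub>rees M\<^esub> = \<zero>\<^bsub>assoc_graded R M\<^esub>"
    using coset_zero[OF ideal_pow_ideal[OF M]]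
    by (intro ext) (simp add: rees_proj_def rees_simps assoc_graded_def)
  have "ring (assoc_graded R M\<lparr>carrier := rees_proj M ` carrier (rees M), zero := rees_proj M \<zero>\<^bsub>rees M\<^esub>\<rparr>)"
    by (rule S.ring_hom_imp_img_ring[OF hom(1)])
  then have r: "ring (assoc_graded R M)" using hom(2) z by simp
  interpret G: ring "assoc_graded R M" by (rule r)
  show "ring_hom_ring (rees M) (assoc_graded R M) (rees_proj M)"
    by (rule ring_hom_ringI2[OF S.ring_axioms r hom(1)])
  have "f \<otimes>\<^bsub>assoc_graded R M\<^esub> g = g \<otimes>\<^bsub>assoc_graded R M\<^esub> f"
    if "f \<in> carrier (assoc_graded R M)" "g \<in> carrier (assoc_graded R M)" for f g
  proof -
    have "f \<in> rees_proj M ` carrier (rees M)" "g \<in> rees_proj M ` carrier (rees M)" using that hom(2) by auto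
    then obtain p q where pq: "p \<in> carrier (rees M)" "q \<in> carrier (rees M)" and fg: "f = rees_proj M p" "g = rees_proj M q"
      by blast
    show ?thesis
      unfolding fg ring_hom_mult[OF hom(1) pq, symmetric] ring_hom_mult[OF hom(1) pq(2,1), symmetric] S.m_comm[OF pq] ..
  qed
  then show "cring (assoc_graded R M)"
    by (intro cring.intro comm_monoid.intro comm_monoid_axioms.intro r G.monoid_axioms)
qed

end

text \<open>The ideal \<open>\<Sum>\<^sub>i x\<^sub>i F(n - s\<^sub>i)\<close>; truncated subtraction makes \<open>F\<close> constant in negative degrees.\<close>

fun wsum :: "('a, 'b) ring_scheme \<Rightarrow> (nat \<Rightarrow> 'a set) \<Rightarrow> 'a list \<Rightarrow> nat list \<Rightarrow> nat \<Rightarrow> 'a set" where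
  "wsum R F (x # xs) (s # ss) n = (\<lambda>a. x \<otimes>\<^bsub>R\<^esub> a) ` F (n - s) <+>\<^bsub>R\<^esub> wsum R F xs ss n"
| "wsum R F _ _ n = {\<zero>\<^bsub>R\<^esub>}"

abbreviation monomial :: "('a, 'b) ring_scheme \<Rightarrow> 'a \<Rightarrow> nat \<Rightarrow> nat \<Rightarrow> 'a" where
  "monomial R x s \<equiv> (\<lambda>m. if m = s then x else \<zero>\<^bsub>R\<^esub>)"

context cring
begin

section \<open>Weighted sums of ideals and Koszul chains over the Rees algebra\<close>

lemma image_mult_ideal:
  assumes I: "ideal I R" and x: "x \<in> carrier R"
  shows "ideal ((\<lambda>a. x \<otimes> a) ` I) R"
proof (rule idealI')
  note d = idealD[OF I]
  show "(\<lambda>a. x \<otimes> a) ` I \<subseteq> carrier R" using x d(1) by blast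
  have "\<zero> = x \<otimes> \<zero>" using x by simp
  then show "\<zero> \<in> (\<lambda>a. x \<otimes> a) ` I" using d(2) by blast
next
  fix a b assume "a \<in> (\<lambda>a. x \<otimes> a) ` I" "b \<in> (\<lambda>a. x \<otimes> a) ` I"
  then obtain a' b' where ab: "a' \<in> I" "b' \<in> I" "a = x \<otimes> a'" "b = x \<otimes> b'" by blast
  then have "a \<oplus> b = x \<otimes> (a' \<oplus> b')" using x idealD(1)[OF I] by (simp add: r_distr)
  then show "a \<oplus> b \<in> (\<lambda>a. x \<otimes> a) ` I" using idealD(3)[OF I ab(1,2)] by blast
next
  fix r a assume r: "r \<in> carrier R" "a \<in> (\<lambda>a. x \<otimes> a) ` I"
  then obtain a' where ab: "a' \<in> I" "a = x \<otimes> a'" by blast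
  then have "r \<otimes> a = x \<otimes> (r \<otimes> a')" using x r(1) idealD(1)[OF I] by (simp add: m_lcomm)
  then show "r \<otimes> a \<in> (\<lambda>a. x \<otimes> a) ` I" using idealD(6)[OF I r(1) ab(1)] by blast
qed

lemma wsum_ideal:
  assumes "\<And>n. ideal (F n) R" "set xs \<subseteq> carrier R" "length ss = length xs"
  shows "ideal (wsum R F xs ss n) R"
  using assms(2,3)
proof (induction xs arbitrary: ss)
  case Nil
  then show ?case using zeroideal by simp
next
  case (Cons x xs)
  obtain s ss' where ss: "ss = s # ss'" using Cons.prems by (cases ss) auto
  have x: "x \<in> carrier R" using Cons.prems by simp
  have "ideal ((\<lambda>a. x \<otimes> a) ` F (n - s)) R" by (rule image_mult_ideal[OF assms(1) x])
  then show ?case unfolding ss using Cons add_ideals ss by simp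
qed

text \<open>Elements of the weighted sum are boundaries in homological degree 0, the position with
  all entries \<open>False\<close>, of chains that respect the filtration.\<close>

lemma wsum_chain:
  assumes F: "\<And>n. ideal (F n) R" and "set xs \<subseteq> carrier R" "length ss = length xs" "z \<in> wsum R F xs ss n"
  shows "\<exists>a. (\<forall>l. a l \<in> F (n - weight ss l)) \<and> koszul_d R xs a (replicate (length xs) False) = z"
  using assms(2-4)
proof (induction xs arbitrary: ss z)
  case Nil
  then show ?case using idealD(2)[OF F] by (intro exI[of _ "\<lambda>_. \<zero>"]) simp
next
  case (Cons x xs)
  obtain s ss' where ss: "ss = s # ss'" using Cons.prems by (cases ss) auto
  obtain b v where bv: "b \<in> F (n - s)" "v \<in> wsum R F xs ss' n" "z = x \<otimes> b \<oplus> v"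
    using Cons.prems(3) unfolding ss by (auto simp: mem_sum_iff)
  obtain a where a: "\<And>l. a l \<in> F (n - weight ss' l)" "koszul_d R xs a (replicate (length xs) False) = v"
    using Cons.IH[of ss' v] Cons.prems ss bv by auto
  have wt0: "weight ts (replicate k False) = 0" for ts k
  proof (induction k arbitrary: ts)
    case 0
    show ?case by (cases ts) auto
  next
    case (Suc k)
    then show ?case by (cases ts) auto
  qed
  \<comment> \<open>The chain on the remaining generators, extended by the coefficient
    \<open>b\<close> at the single basis vector that belongs to \<open>x\<close>.\<close>
  define c where "c l = (case l of [] \<Rightarrow> \<zero> | False # l' \<Rightarrow> a l' | True # l' \<Rightarrow> if l' = replicate (length xs) False then b else \<zero>)" for l
  have c: "c l \<in> F (n - weight ss l)" for l
  proof (cases l)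
    case Nil
    then show ?thesis using idealD(2)[OF F] by (simp add: c_def)
  next
    case (Cons e l')
    then show ?thesis using idealD(2)[OF F] a(1) bv(1) wt0 by (cases e) (auto simp: c_def ss)
  qed
  have "koszul_d R (x # xs) c (replicate (length (x # xs)) False) = v \<oplus> x \<otimes> b"
    using a(2) by (simp add: c_def)
  also have "\<dots> = z" using bv(3) idealD(1)[OF F bv(1)] idealD(1)[OF wsum_ideal[OF F] bv(2)] Cons.prems ss
    by (simp add: a_comm)
  finally show ?case using c by blast
qed

lemma rees_add_apply: "p \<in> carrier (rees M) \<Longrightarrow> q \<in> carrier (rees M) \<Longrightarrow> (p \<oplus>\<^bsub>rees M\<^esub> q) n = p n \<oplus> q n"
  by (simp add: rees_simps)

lemma rees_carrier: "p \<in> carrier (rees M) \<Longrightarrow> p n \<in> carrier R"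
  by (auto simp: rees_simps)

lemma rees_uminus_apply:
  assumes M: "ideal M R" and p: "p \<in> carrier (rees M)"
  shows "(\<ominus>\<^bsub>rees M\<^esub> p) n = \<ominus> p n"
proof -
  interpret S: cring "rees M" by (rule rees_cring[OF M])
  have q: "\<ominus>\<^bsub>rees M\<^esub> p \<in> carrier (rees M)" using p by simp
  have "(\<ominus>\<^bsub>rees M\<^esub> p \<oplus>\<^bsub>rees M\<^esub> p) n = \<zero>" using S.l_neg[OF p] by (simp add: rees_simps)
  then have "(\<ominus>\<^bsub>rees M\<^esub> p) n \<oplus> p n = \<zero>" using rees_add_apply[OF q p] by simp
  then show ?thesis using minus_equality rees_carrier[OF p] rees_carrier[OF q] by (simp add: sum_zero_eq_neg)
qed

lemma monomial_rees:
  assumes M: "ideal M R" and x: "x \<in> ideal_pow R M s"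
  shows "monomial R x s \<in> carrier (rees M)"
proof -
  have I: "\<And>n. ideal (ideal_pow R M n) R" using ideal_pow_ideal[OF M] .
  have "monomial R x s \<in> up R"
  proof (rule mem_upI)
    show "monomial R x s n \<in> carrier R" for n using idealD(1)[OF I x] by simp
    have "bound \<zero> s (monomial R x s)" by (rule bound.intro) simp
    then show "\<exists>n. bound \<zero> n (monomial R x s)" by blast
  qed
  then show ?thesis using x idealD(2)[OF I] by (simp add: rees_simps)
qed

lemma monomial_mult:
  assumes M: "ideal M R" and x: "x \<in> ideal_pow R M s" and p: "p \<in> carrier (rees M)"
  shows "(monomial R x s \<otimes>\<^bsub>rees M\<^esub> p) n = (if s \<le> n then x \<otimes> p (n - s) else \<zero>)"
proof -
  have I: "\<And>n. ideal (ideal_pow R M n) R" using ideal_pow_ideal[OF M] .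
  have xc: "x \<in> carrier R" using idealD(1)[OF I x] .
  have pc: "\<And>n. p n \<in> carrier R" using rees_carrier[OF p] .
  have "(monomial R x s \<otimes>\<^bsub>rees M\<^esub> p) n = (\<Oplus>i\<in>{..n}. monomial R x s i \<otimes> p (n - i))"
    using monomial_rees[OF M x] p by (simp add: rees_simps)
  also have "\<dots> = (\<Oplus>i\<in>{..n}. if s = i then x \<otimes> p (n - i) else \<zero>)"
    using xc pc by (intro finsum_cong') auto
  also have "\<dots> = (if s \<le> n then x \<otimes> p (n - s) else \<zero>)"
  proof (cases "s \<le> n")
    case True
    then show ?thesis using finsum_singleton[of s "{..n}" "\<lambda>i. x \<otimes> p (n - i)"] xc pc by simp
  next
    case False
    then have "(\<Oplus>i\<in>{..n}. if s = i then x \<otimes> p (n - i) else \<zero>) = (\<Oplus>i\<in>{..n}. \<zero>)"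
      by (intro finsum_cong') auto
    then show ?thesis using False by simp
  qed
  finally show ?thesis .
qed

text \<open>The coefficients of a Koszul differential over the Rees algebra are Koszul differentials over the
  ring, once each position \<open>l\<close> of the complex is shifted by its weight.\<close>

lemma koszul_d_rees_coeff:
  assumes M: "ideal M R" and "length ss = length xs" "length l = length xs"
    and "\<And>i. i < length xs \<Longrightarrow> xs ! i \<in> ideal_pow R M (ss ! i)"
    and "\<And>l. q l \<in> carrier (rees M)" and "weight ss l \<le> n"
  shows "koszul_d (rees M) (map2 (monomial R) xs ss) q l (n - weight ss l) =
    koszul_d R xs (\<lambda>l'. if weight ss l' \<le> n then q l' (n - weight ss l') else \<zero>) l"
  using assms(2-)
proof (induction xs arbitrary: ss l q n)
  case Nil
  then show ?case by (simp add: rees_simps)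
next
  case (Cons x xs)
  interpret S: cring "rees M" by (rule rees_cring[OF M])
  obtain s ss' where ss: "ss = s # ss'" using Cons.prems(1) by (cases ss) auto
  obtain b l' where l: "l = b # l'" using Cons.prems(2) by (cases l) auto
  have xs: "xs ! i \<in> ideal_pow R M (ss' ! i)" if "i < length xs" for i
    using Cons.prems(3)[of "Suc i"] that ss by simp
  have x: "x \<in> ideal_pow R M s" using Cons.prems(3)[of 0] ss by simp
  note q = Cons.prems(4)
  have mono: "set (map2 (monomial R) xs ss') \<subseteq> carrier (rees M)"
  proof
    fix p assume "p \<in> set (map2 (monomial R) xs ss')"
    then obtain i where "i < length xs" "p = monomial R (xs ! i) (ss' ! i)"
      using Cons.prems(1) ss by (auto simp: set_zip)
    then show "p \<in> carrier (rees M)" using monomial_rees[OF M xs] by simp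
  qed
  have IH: "koszul_d (rees M) (map2 (monomial R) xs ss') v l' (m - weight ss' l') =
    koszul_d R xs (\<lambda>l'. if weight ss' l' \<le> m then v l' (m - weight ss' l') else \<zero>) l'"
    if "\<And>l. v l \<in> carrier (rees M)" "weight ss' l' \<le> m" for v m
    by (rule Cons.IH) (use Cons.prems ss l that xs in auto)
  show ?case
  proof (cases b)
    case True
    then have n: "s \<le> n" "weight ss' l' \<le> n - s" using Cons.prems(5) ss l by auto
    have eq: "(\<lambda>l''. if weight ss' l'' \<le> n - s then q (True # l'') (n - s - weight ss' l'') else \<zero>) =
        (\<lambda>l''. if weight ss (True # l'') \<le> n then q (True # l'') (n - weight ss (True # l'')) else \<zero>)"
      using n by (intro ext) (auto simp: ss)
    have "koszul_d (rees M) (map2 (monomial R) xs ss') (\<lambda>l. q (True # l)) l' (n - s - weight ss' l') =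
      koszul_d R xs (\<lambda>l''. if weight ss (True # l'') \<le> n then q (True # l'') (n - weight ss (True # l'')) else \<zero>) l'"
      using IH[of "\<lambda>l. q (True # l)" "n - s"] q n unfolding eq by simp
    moreover have "koszul_d (rees M) (map2 (monomial R) xs ss') (\<lambda>l. q (True # l)) l' \<in> carrier (rees M)"
      using mono q by simp
    ultimately show ?thesis unfolding l using True
      by (simp add: ss rees_uminus_apply[OF M] del: weight.simps) (simp add: ss)
  next
    case False
    then have n: "weight ss' l' \<le> n" using Cons.prems(5) ss l by auto
    let ?A = "koszul_d (rees M) (map2 (monomial R) xs ss') (\<lambda>l. q (False # l)) l'" and ?B = "monomial R x s \<otimes>\<^bsub>rees M\<^esub> q (True # l')"
    have A: "?A \<in> carrier (rees M)" and B: "?B \<in> carrier (rees M)"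
      using mono q monomial_rees[OF M x] by simp_all
    have "(?A \<oplus>\<^bsub>rees M\<^esub> ?B) (n - weight ss' l') = ?A (n - weight ss' l') \<oplus> ?B (n - weight ss' l')"
      by (rule rees_add_apply[OF A B])
    also have "?A (n - weight ss' l') = koszul_d R xs (\<lambda>l''. if weight ss' l'' \<le> n then q (False # l'') (n - weight ss' l'') else \<zero>) l'"
      using IH[of "\<lambda>l. q (False # l)" n] q n by simp
    also have "?B (n - weight ss' l') = x \<otimes> (if weight ss (True # l') \<le> n then q (True # l') (n - weight ss (True # l')) else \<zero>)"
      using monomial_mult[OF M x q] n monomial_rees[OF M x] idealD(1)[OF ideal_pow_ideal[OF M] x]
      by (auto simp: ss add.commute)
    finally show ?thesis unfolding l using False by (simp add: ss cong: if_cong)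
  qed
qed

lemma coset_eq_self_iff:
  assumes "ideal I R" "a \<in> carrier R"
  shows "I +> a = I \<longleftrightarrow> a \<in> I"
proof -
  have "I +> a = I +> \<zero> \<longleftrightarrow> a \<ominus> \<zero> \<in> I" using coset_eq_iff[OF assms(1,2)] by simp
  then show ?thesis using coset_zero[OF assms(1)] assms(2) by (simp add: a_minus_def)
qed

lemma wsum_subset_Idl:
  assumes F: "\<And>n. ideal (F n) R" and xs: "set xs \<subseteq> carrier R" and len: "length ss = length xs"
  shows "wsum R F xs ss n \<subseteq> Idl (set xs)"
  using xs len
proof (induction xs arbitrary: ss)
  case Nil
  then show ?case using idealD(2)[OF genideal_ideal[of "{}"]] by simp
next
  case (Cons x xs)
  obtain s ss' where ss: "ss = s # ss'" using Cons.prems by (cases ss) auto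
  have x: "x \<in> carrier R" and xs: "set xs \<subseteq> carrier R" using Cons.prems by auto
  have X: "ideal (Idl (set xs)) R" by (rule genideal_ideal[OF xs])
  have "(\<lambda>a. x \<otimes> a) ` F (n - s) \<subseteq> PIdl x"
  proof
    fix y assume "y \<in> (\<lambda>a. x \<otimes> a) ` F (n - s)"
    then obtain a where a: "a \<in> F (n - s)" "y = x \<otimes> a" by blast
    then show "y \<in> PIdl x" unfolding mem_PIdl using m_comm[OF x] idealD(1)[OF F a(1)] by blast
  qed
  then have "(\<lambda>a. x \<otimes> a) ` F (n - s) <+> wsum R F xs ss' n \<subseteq> PIdl x <+> Idl (set xs)"
    using Cons.IH[OF xs] Cons.prems ss by (intro sum_mono) auto
  then show ?case unfolding ss using Idl_insert[OF x xs] by simp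
qed

text \<open>An element whose constant coefficient lies in \<open>M\<close> vanishes in degree 0 of
  the graded ring, so a product of t copies vanishes there in all degrees below t.\<close>

lemma rees_pow_coeff:
  assumes M: "ideal M R" and p: "p \<in> carrier (rees M)" "p 0 \<in> M" and n: "n < t"
  shows "(p [^]\<^bsub>rees M\<^esub> t) n \<in> ideal_pow R M (Suc n)"
  using n
proof (induction t arbitrary: n)
  case (Suc t)
  interpret S: cring "rees M" by (rule rees_cring[OF M])
  have I: "\<And>n. ideal (ideal_pow R M n) R" using ideal_pow_ideal[OF M] .
  let ?q = "p [^]\<^bsub>rees M\<^esub> t"
  have q: "?q \<in> carrier (rees M)" using p by simp
  have pq: "\<And>i. p i \<in> ideal_pow R M i" "\<And>i. ?q i \<in> ideal_pow R M i" using p q by (auto simp: rees_simps)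
  have "(p [^]\<^bsub>rees M\<^esub> Suc t) n = (\<Oplus>i\<in>{..n}. ?q i \<otimes> p (n - i))"
    using p q by (simp add: rees_simps)
  also have "\<dots> \<in> ideal_pow R M (Suc n)"
  proof (rule ideal_finsum[OF I])
    fix i assume i: "i \<in> {..n}"
    show "?q i \<otimes> p (n - i) \<in> ideal_pow R M (Suc n)"
    proof (cases "i = n")
      case True
      have "p 0 \<in> ideal_pow R M (Suc 0)" using p(2) ideal_pow_1[OF M] by simp
      then show ?thesis using True ideal_pow_mult_mem[OF M pq(2)[of n], of "p 0" "Suc 0"] by simp
    next
      case False
      then have "?q i \<in> ideal_pow R M (Suc i)" using Suc.IH[of i] Suc.prems i by simp
      then show ?thesis using ideal_pow_mult_mem[OF M _ pq(1)[of "n - i"], of "?q i" "Suc i"] i by simp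
    qed
  qed simp
  finally show ?case .
qed simp

text \<open>\<open>p\<close> is the sum of its monomials. Those of degree below \<open>r\<close>
  represent zero in the graded ring and lie in \<open>T\<close> by \<open>low\<close>; the others
  lie in \<open>T\<close> by \<open>mono\<close>.\<close>

lemma rees_mem_high:
  assumes M: "ideal M R" and T: "ideal T (rees M)"
    and mono: "\<And>n a. a \<in> ideal_pow R M n \<Longrightarrow> monomial R a n \<in> T \<or> n < r"
    and low: "{p \<in> carrier (rees M). \<forall>n. p n \<in> ideal_pow R M (Suc n)} \<subseteq> T"
    and p: "p \<in> carrier (rees M)" "\<And>n. n < r \<Longrightarrow> p n \<in> ideal_pow R M (Suc n)"
  shows "p \<in> T"
proof -
  interpret S: cring "rees M" by (rule rees_cring[OF M])
  have I: "\<And>n. ideal (ideal_pow R M n) R" using ideal_pow_ideal[OF M] .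
  have pn: "\<And>n. p n \<in> ideal_pow R M n" and pu: "p \<in> up R" using p by (auto simp: rees_simps)
  have monoT: "monomial R (p n) n \<in> T" for n
  proof (cases "n < r")
    case True
    then have "monomial R (p n) n \<in> {p \<in> carrier (rees M). \<forall>n. p n \<in> ideal_pow R M (Suc n)}"
      using monomial_rees[OF M pn, of n] p(2)[OF True] idealD(2)[OF I] by simp
    then show ?thesis using low by blast
  qed (use mono[OF pn, of n] in simp)
  have trunc: "(\<lambda>m. if m < k then p m else \<zero>) \<in> T" for k
  proof (induction k)
    case 0
    have "(\<lambda>m. if m < 0 then p m else \<zero>) = \<zero>\<^bsub>rees M\<^esub>" by (simp add: rees_simps)
    then show ?case using S.idealD(2)[OF T] by simp
  next
    case (Suc k)
    have c: "(\<lambda>m. if m < k then p m else \<zero>) \<in> carrier (rees M)" "monomial R (p k) k \<in> carrier (rees M)"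
      using S.idealD(1)[OF T] Suc monoT by blast+
    have "(\<lambda>m. if m < Suc k then p m else \<zero>) = (\<lambda>m. if m < k then p m else \<zero>) \<oplus>\<^bsub>rees M\<^esub> monomial R (p k) k"
    proof (rule ext)
      fix m
      show "(if m < Suc k then p m else \<zero>) = ((\<lambda>m. if m < k then p m else \<zero>) \<oplus>\<^bsub>rees M\<^esub> monomial R (p k) k) m"
        using rees_add_apply[OF c] rees_carrier[OF p(1)] by (auto simp: less_Suc_eq)
    qed
    then show ?case using S.idealD(3)[OF T Suc monoT] by simp
  qed
  obtain b where b: "bound \<zero> b p" using pu by auto
  have "(\<lambda>m. if m < Suc b then p m else \<zero>) = p"
    using bound.bound[OF b] by (auto simp: not_less_eq)
  then show ?thesis using trunc[of "Suc b"] by simp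
qed

text \<open>A representation of \<open>z\<close> by the \<open>xs\<close> lifts to a combination of
  the monomials of the \<open>xs\<close>, each multiplied by a monomial of complementary
  degree.\<close>

lemma monomial_wsum_mem:
  assumes M: "ideal M R" and T: "ideal T (rees M)"
    and low: "{p \<in> carrier (rees M). \<forall>n. p n \<in> ideal_pow R M (Suc n)} \<subseteq> T"
    and len: "length ss = length xs"
    and x: "\<And>i. i < length xs \<Longrightarrow> xs ! i \<in> ideal_pow R M (ss ! i)"
    and X: "set (map2 (monomial R) xs ss) \<subseteq> T"
    and z: "z \<in> wsum R (ideal_pow R M) xs ss n"
  shows "monomial R z n \<in> T"
  using len x X z
proof (induction xs arbitrary: ss z)
  case Nil
  interpret S: cring "rees M" by (rule rees_cring[OF M])
  have "monomial R z n = \<zero>\<^bsub>rees M\<^esub>" using Nil by (auto simp: rees_simps)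
  then show ?case using S.idealD(2)[OF T] by simp
next
  case (Cons x xs)
  interpret S: cring "rees M" by (rule rees_cring[OF M])
  have I: "\<And>n. ideal (ideal_pow R M n) R" using ideal_pow_ideal[OF M] .
  obtain s ss' where ss: "ss = s # ss'" using Cons.prems by (cases ss) auto
  have xs: "xs ! i \<in> ideal_pow R M (ss' ! i)" if "i < length xs" for i
    using Cons.prems(2)[of "Suc i"] that ss by simp
  have x: "x \<in> ideal_pow R M s" using Cons.prems(2)[of 0] ss by simp
  have xc: "x \<in> carrier R" using idealD(1)[OF I x] .
  obtain a v where av: "a \<in> ideal_pow R M (n - s)" "v \<in> wsum R (ideal_pow R M) xs ss' n" "z = x \<otimes> a \<oplus> v"
    using Cons.prems(4) unfolding ss by (auto simp: mem_sum_iff)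
  have ac: "a \<in> carrier R" using idealD(1)[OF I av(1)] .
  have vT: "monomial R v n \<in> T" by (rule Cons.IH) (use Cons.prems ss xs av in auto)
  have vc: "v \<in> carrier R" using rees_carrier[of "monomial R v n" M n] S.idealD(1)[OF T vT] by simp
  have XT: "monomial R x s \<in> T" using Cons.prems(3) ss by simp
  have xaT: "monomial R (x \<otimes> a) n \<in> T"
  proof (cases "s \<le> n")
    case True
    have "monomial R (x \<otimes> a) n = monomial R x s \<otimes>\<^bsub>rees M\<^esub> monomial R a (n - s)"
    proof (rule ext)
      fix m
      show "monomial R (x \<otimes> a) n m = (monomial R x s \<otimes>\<^bsub>rees M\<^esub> monomial R a (n - s)) m"
        using monomial_mult[OF M x monomial_rees[OF M av(1)], of m] True xc by auto
    qed
    then show ?thesis using S.idealD(7)[OF T monomial_rees[OF M av(1)] XT] by simp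
  next
    case False
    \<comment> \<open>The exponent n - s is truncated here, so there is no monomial of complementary
      degree. But the product lies in M^s, hence in M^(n+1), and its monomial represents zero in the
      graded ring.\<close>
    have "x \<otimes> a \<in> ideal_pow R M s" using idealD(7)[OF I ac x] .
    then have 1: "x \<otimes> a \<in> ideal_pow R M (Suc n)" "x \<otimes> a \<in> ideal_pow R M n"
      using ideal_pow_antimono[OF M, of "Suc n" s] ideal_pow_antimono[OF M, of n s] False by auto
    then have "monomial R (x \<otimes> a) n \<in> {p \<in> carrier (rees M). \<forall>n. p n \<in> ideal_pow R M (Suc n)}"
      using monomial_rees[OF M 1(2)] idealD(2)[OF I] by simp
    then show ?thesis using low by blast
  qed
  have "monomial R z n = monomial R (x \<otimes> a) n \<oplus>\<^bsub>rees M\<^esub> monomial R v n"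
  proof (rule ext)
    fix m
    show "monomial R z n m = (monomial R (x \<otimes> a) n \<oplus>\<^bsub>rees M\<^esub> monomial R v n) m"
      using rees_add_apply[OF S.idealD(1)[OF T xaT] S.idealD(1)[OF T vT], of m] av(3) by simp
  qed
  then show ?case using S.idealD(3)[OF T xaT vT] by simp
qed

text \<open>Depth sensitivity, applied in the Rees algebra modulo the kernel of the projection, with
  lifts \<open>ys\<close> of the regular sequence \<open>gs\<close>. The lifts are nilpotent modulo
  that kernel and the monomials of the \<open>xs\<close>, because these generate everything in
  degrees from \<open>r\<close> on.\<close>

lemma rees_koszul_exact:
  assumes M: "ideal M R" and len: "length ss = length xs"
    and x: "\<And>i. i < length xs \<Longrightarrow> xs ! i \<in> ideal_pow R M (ss ! i)"
    and r: "\<And>n. r \<le> n \<Longrightarrow> ideal_pow R M n \<subseteq> wsum R (ideal_pow R M) xs ss n"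
    and gs: "regular_seq (assoc_graded R M) (gr_hom_max_ideal R M) gs"
    and i: "length xs < i + length gs"
  shows "cring.koszul_exact (rees M) (map2 (monomial R) xs ss)
    {p \<in> carrier (rees M). \<forall>n. p n \<in> ideal_pow R M (Suc n)} i"
proof -
  interpret S: cring "rees M" by (rule rees_cring[OF M])
  interpret G: cring "assoc_graded R M" by (rule assoc_graded_cring[OF M])
  interpret h: ring_hom_ring "rees M" "assoc_graded R M" "rees_proj M" by (rule assoc_graded_cring[OF M])
  have I: "\<And>n. ideal (ideal_pow R M n) R" using ideal_pow_ideal[OF M] .
  let ?N = "{p \<in> carrier (rees M). \<forall>n. p n \<in> ideal_pow R M (Suc n)}"
  let ?X = "map2 (monomial R) xs ss"
  have proj_iff: "rees_proj M p n = ideal_pow R M (Suc n) \<longleftrightarrow> p n \<in> ideal_pow R M (Suc n)"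
    if "p \<in> carrier (rees M)" for p n
    using coset_eq_self_iff[OF I rees_carrier[OF that]] by (simp add: rees_proj_def)
  have "genideal (assoc_graded R M) {} = {\<zero>\<^bsub>assoc_graded R M\<^esub>}"
    using G.genideal_minimal[OF G.zeroideal, of "{}"] G.idealD(2)[OF G.genideal_ideal[of "{}"]] by fast
  moreover have "rees_proj M p = \<zero>\<^bsub>assoc_graded R M\<^esub> \<longleftrightarrow> (\<forall>n. p n \<in> ideal_pow R M (Suc n))"
    if "p \<in> carrier (rees M)" for p
    using proj_iff[OF that] by (auto simp: assoc_graded_def fun_eq_iff)
  ultimately have N: "{p \<in> carrier (rees M). rees_proj M p \<in> genideal (assoc_graded R M) {}} = ?N"
    by auto
  have Ni: "ideal ?N (rees M)"
    using h.ideal_vimage[OF G.genideal_ideal[of "{}"]] unfolding N by simp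
  have "set gs \<subseteq> rees_proj M ` {p \<in> carrier (rees M). p 0 \<in> M}"
  proof
    fix g assume "g \<in> set gs"
    then have g: "g \<in> carrier (assoc_graded R M)" "g 0 = ideal_pow R M (Suc 0)"
      using gs by (auto simp: regular_seq_def gr_hom_max_ideal_def)
    then obtain p where p: "p \<in> carrier (rees M)" "g = rees_proj M p"
      using rees_proj_hom(2)[OF M] by (metis imageE)
    then show "g \<in> rees_proj M ` {p \<in> carrier (rees M). p 0 \<in> M}"
      using proj_iff[OF p(1), of 0] g(2) ideal_pow_1[OF M] by auto
  qed
  then obtain ys where ys: "gs = map (rees_proj M) ys" "set ys \<subseteq> {p \<in> carrier (rees M). p 0 \<in> M}"
  proof (induction gs arbitrary: thesis)
    case (Cons g gs)
    obtain p where p: "p \<in> carrier (rees M)" "p 0 \<in> M" "g = rees_proj M p" using Cons.prems(2) by auto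
    obtain ys where ys: "gs = map (rees_proj M) ys" "set ys \<subseteq> {p \<in> carrier (rees M). p 0 \<in> M}"
      using Cons.IH Cons.prems(2) by auto
    show ?case by (rule Cons.prems(1)[of "p # ys"]) (use p ys in auto)
  qed auto
  have "S.regular_mod {p \<in> carrier (rees M). rees_proj M p \<in> genideal (assoc_graded R M) {}} ys"
  proof (rule S.regular_mod_lift[OF assoc_graded_cring(2)[OF M] assoc_graded_cring(1)[OF M] rees_proj_hom(2)[OF M]])
    fix j z assume "j < length ys" "z \<in> carrier (assoc_graded R M)"
      "rees_proj M (ys ! j) \<otimes>\<^bsub>assoc_graded R M\<^esub> z \<in> genideal (assoc_graded R M) ({} \<union> set (take j (map (rees_proj M) ys)))"
    then show "z \<in> genideal (assoc_graded R M) ({} \<union> set (take j (map (rees_proj M) ys)))"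
      using gs unfolding regular_seq_def ys(1) by simp
  qed (use ys in auto)
  then have reg: "S.regular_mod ?N ys" unfolding N .
  have Xc: "set ?X \<subseteq> carrier (rees M)"
  proof
    fix p assume "p \<in> set ?X"
    then obtain j where "j < length xs" "p = monomial R (xs ! j) (ss ! j)"
      using len by (auto simp: set_zip)
    then show "p \<in> carrier (rees M)" using monomial_rees[OF M x] by simp
  qed
  have XI: "ideal (genideal (rees M) (set ?X)) (rees M)" by (rule S.genideal_ideal[OF Xc])
  let ?T = "?N <+>\<^bsub>rees M\<^esub> genideal (rees M) (set ?X)"
  have T: "ideal ?T (rees M)" by (rule S.add_ideals[OF Ni XI])
  have NT: "?N \<subseteq> ?T" and XT: "set ?X \<subseteq> ?T"
    using S.sum_upper[OF Ni XI] S.genideal_self[OF Xc] by auto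
  show ?thesis
  proof (rule S.koszul_exact_of_regular[OF Ni Xc _ reg])
    fix y assume "y \<in> set ys"
    then have y: "y \<in> carrier (rees M)" "y 0 \<in> M" using ys by auto
    \<comment> \<open>The exponent \<open>r\<close> disposes of the degrees below \<open>r\<close>;
      the remaining degrees are covered by the inclusion of powers in weighted sums.\<close>
    have "y [^]\<^bsub>rees M\<^esub> r \<in> ?T"
    proof (rule rees_mem_high[OF M T _ NT])
      fix n a assume "a \<in> ideal_pow R M n"
      then show "monomial R a n \<in> ?T \<or> n < r"
        using monomial_wsum_mem[OF M T NT len x XT, of a n] r[of n] by (cases "n < r") auto
    qed (use rees_pow_coeff[OF M y] y in auto)
    then show "\<exists>t::nat. y [^]\<^bsub>rees M\<^esub> t \<in> ?T" by blast
  qed (use ys i len in auto)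
qed

text \<open>The degree \<open>n\<close> part of the Koszul complex over the associated graded ring.\<close>

lemma graded_exact:
  assumes M: "ideal M R" and len: "length ss = length xs"
    and x: "\<And>i. i < length xs \<Longrightarrow> xs ! i \<in> ideal_pow R M (ss ! i)"
    and ex: "cring.koszul_exact (rees M) (map2 (monomial R) xs ss)
      {p \<in> carrier (rees M). \<forall>n. p n \<in> ideal_pow R M (Suc n)} i"
    and c: "\<And>l. c l \<in> ideal_pow R M (n - weight ss l)"
    and cyc: "\<And>l. length l = length xs \<Longrightarrow> Suc (cnt l) = i \<Longrightarrow> koszul_d R xs c l \<in> ideal_pow R M (Suc n - weight ss l)"
  shows "\<exists>b. (\<forall>l. b l \<in> ideal_pow R M (n - weight ss l)) \<and>
    (\<forall>l. length l = length xs \<longrightarrow> cnt l = i \<longrightarrow> c l \<ominus> koszul_d R xs b l \<in> ideal_pow R M (Suc n - weight ss l))"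
proof -
  interpret S: cring "rees M" by (rule rees_cring[OF M])
  have I: "\<And>n. ideal (ideal_pow R M n) R" using ideal_pow_ideal[OF M] .
  have xc: "set xs \<subseteq> carrier R"
  proof
    fix y assume "y \<in> set xs"
    then obtain j where "j < length xs" "y = xs ! j" by (auto simp: in_set_conv_nth)
    then show "y \<in> carrier R" using idealD(1)[OF I x] by simp
  qed
  have xF: "xs ! j \<otimes> a \<in> ideal_pow R M m" if "j < length xs" "a \<in> ideal_pow R M (m - ss ! j)" for j m a
    by (rule subsetD[OF ideal_pow_antimono[OF M] ideal_pow_mult_mem[OF M x[OF that(1)] that(2)]]) simp
  let ?N = "{p \<in> carrier (rees M). \<forall>n. p n \<in> ideal_pow R M (Suc n)}"
  let ?X = "map2 (monomial R) xs ss"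
  have Xc: "set ?X \<subseteq> carrier (rees M)"
  proof
    fix p assume "p \<in> set ?X"
    then obtain j where "j < length xs" "p = monomial R (xs ! j) (ss ! j)"
      using len by (auto simp: set_zip)
    then show "p \<in> carrier (rees M)" using monomial_rees[OF M x] by simp
  qed
  have cc: "\<And>l. c l \<in> carrier R" using c idealD(1)[OF I] by blast
  \<comment> \<open>Where the weight exceeds \<open>n\<close>, both exponents truncate to 0 and the
    filtration condition is void, while the graded complex is zero. \<open>c'\<close> clears these
    positions.\<close>
  define c' where "c' l = (if weight ss l \<le> n then c l else \<zero>)" for l
  have c': "c' l \<in> ideal_pow R M (n - weight ss l)" for l using c idealD(2)[OF I] by (simp add: c'_def)
  have cc': "\<And>l. c' l \<in> carrier R" using c' idealD(1)[OF I] by blast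
  \<comment> \<open>Each coefficient is put in the degree that makes the whole chain homogeneous of
    internal degree \<open>n\<close>.\<close>
  define p where "p l = monomial R (c' l) (n - weight ss l)" for l
  have p: "\<And>l. p l \<in> carrier (rees M)" unfolding p_def by (rule monomial_rees[OF M c'])
  have cyc': "koszul_d R xs c' l \<in> ideal_pow R M (Suc n - weight ss l)" if l: "length l = length xs" "Suc (cnt l) = i" for l
  proof -
    have "koszul_d R xs (\<lambda>l. c l \<ominus> c' l) l \<in> ideal_pow R M (Suc n - weight ss l)"
    proof (rule koszul_d_mem_weighted[OF I len l(1) xc xF])
      fix l' :: "bool list"
      show "c l' \<ominus> c' l' \<in> ideal_pow R M (Suc n - weight ss l')"
        using cc idealD(2)[OF I] by (auto simp: c'_def minus_self)
    qed
    then have 1: "koszul_d R xs c l \<ominus> koszul_d R xs c' l \<in> ideal_pow R M (Suc n - weight ss l)"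
      using koszul_d_minus[OF xc cc cc'] by simp
    let ?k = "koszul_d R xs c l" and ?k' = "koszul_d R xs c' l"
    have "?k' = ?k \<ominus> (?k \<ominus> ?k')"
      using xc cc cc' by (simp add: a_minus_def minus_add r_neg1 r_neg2)
    then show ?thesis using idealD(5)[OF I cyc[OF l] 1] by simp
  qed
  have cycp: "koszul_d (rees M) ?X p l \<in> ?N" if l: "length l = length ?X" "Suc (cnt l) = i" for l
  proof -
    have l': "length l = length xs" using l len by simp
    have "koszul_d (rees M) ?X p l m \<in> ideal_pow R M (Suc m)" for m
    proof -
      have eq: "koszul_d (rees M) ?X p l m = koszul_d R xs (\<lambda>l'. if weight ss l' \<le> m + weight ss l then p l' (m + weight ss l - weight ss l') else \<zero>) l"
        using koszul_d_rees_coeff[OF M len l' x p, of "m + weight ss l"] by simp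
      show ?thesis
      proof (cases "m + weight ss l = n")
        case True
        have "(\<lambda>l'. if weight ss l' \<le> m + weight ss l then p l' (m + weight ss l - weight ss l') else \<zero>) = c'"
          unfolding True by (auto simp: p_def c'_def)
        then show ?thesis using eq cyc'[OF l' l(2)] True[symmetric] by (simp add: Suc_diff_le)
      next
        case False
        have "(\<lambda>l'. if weight ss l' \<le> m + weight ss l then p l' (m + weight ss l - weight ss l') else \<zero>) = (\<lambda>_. \<zero>)"
          using False by (auto simp: p_def c'_def fun_eq_iff)
        then show ?thesis using eq koszul_d_zero[OF xc] idealD(2)[OF I] by simp
      qed
    qed
    then show ?thesis using Xc p by simp
  qed
  obtain q where q: "\<And>l. q l \<in> carrier (rees M)"
    "\<And>l. length l = length ?X \<Longrightarrow> cnt l = i \<Longrightarrow> p l \<ominus>\<^bsub>rees M\<^esub> koszul_d (rees M) ?X q l \<in> ?N"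
    using ex[unfolded S.koszul_exact_def, rule_format, of p] p cycp by blast
  define b where "b l = (if weight ss l \<le> n then q l (n - weight ss l) else \<zero>)" for l
  have qc: "\<And>l m. q l m \<in> ideal_pow R M m" using q(1) by (simp add: rees_simps)
  have b: "\<And>l. b l \<in> ideal_pow R M (n - weight ss l)" using qc idealD(2)[OF I] by (simp add: b_def)
  have "c l \<ominus> koszul_d R xs b l \<in> ideal_pow R M (Suc n - weight ss l)" if l: "length l = length xs" "cnt l = i" for l
  proof (cases "weight ss l \<le> n")
    case True
    have kc: "koszul_d (rees M) ?X q l \<in> carrier (rees M)" using Xc q by simp
    have "(p l \<ominus>\<^bsub>rees M\<^esub> koszul_d (rees M) ?X q l) (n - weight ss l) \<in> ideal_pow R M (Suc (n - weight ss l))"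
      using q(2)[of l] l len by simp
    also have "(p l \<ominus>\<^bsub>rees M\<^esub> koszul_d (rees M) ?X q l) (n - weight ss l) = p l (n - weight ss l) \<ominus> koszul_d (rees M) ?X q l (n - weight ss l)"
      using rees_add_apply[OF p S.a_inv_closed[OF kc]] rees_uminus_apply[OF M kc] by (simp add: a_minus_def)
    also have "p l (n - weight ss l) = c l" using True by (simp add: p_def c'_def)
    also have "koszul_d (rees M) ?X q l (n - weight ss l) = koszul_d R xs b l"
    proof -
      have "b = (\<lambda>l'. if weight ss l' \<le> n then q l' (n - weight ss l') else \<zero>)" by (intro ext) (simp add: b_def)
      then show ?thesis using koszul_d_rees_coeff[OF M len l(1) x, of q n] q(1) True by simp
    qed
    finally show ?thesis using True by (simp add: Suc_diff_le)
  next
    case False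
    \<comment> \<open>The exponent truncates to 0, so membership in R is all that is asked.\<close>
    have "koszul_d R xs b l \<in> carrier R" using xc b idealD(1)[OF I] by (intro koszul_d_closed) blast+
    then show ?thesis using False cc by simp
  qed
  then show ?thesis using b by blast
qed

end

section \<open>The filtered Koszul complex\<close>

text \<open>The assumption \<open>gr\<close> is exactness of the Koszul complex of the initial forms of \<open>xs\<close>, in internal degree
  \<open>n\<close> and homological degree at least \<open>2\<close>; it is what depth \<open>\<ge> length xs - 1\<close> provides.\<close>

locale koszul_setting = noeth_local R M for R (structure) and M +
  fixes xs ss and r :: nat
  assumes len: "length ss = length xs"
    and x: "\<And>i. i < length xs \<Longrightarrow> xs ! i \<in> ideal_pow R M (ss ! i)"
    and red: "\<And>n. r \<le> n \<Longrightarrow> ideal_pow R M n \<subseteq> wsum R (ideal_pow R M) xs ss n"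
    and cm: "koszul_exact xs {\<zero>} 1"
    and gr: "\<And>i c n. 2 \<le> i \<Longrightarrow> (\<And>l. c l \<in> ideal_pow R M (n - weight ss l)) \<Longrightarrow>
      (\<And>l. length l = length xs \<Longrightarrow> Suc (cnt l) = i \<Longrightarrow> koszul_d R xs c l \<in> ideal_pow R M (Suc n - weight ss l)) \<Longrightarrow>
      \<exists>b. (\<forall>l. b l \<in> ideal_pow R M (n - weight ss l)) \<and>
        (\<forall>l. length l = length xs \<longrightarrow> cnt l = i \<longrightarrow> c l \<ominus> koszul_d R xs b l \<in> ideal_pow R M (Suc n - weight ss l))"
begin

lemma Pc: "a \<in> ideal_pow R M n \<Longrightarrow> a \<in> carrier R"
  by (rule idealD(1)[OF pow_ideal])

lemma xc: "set xs \<subseteq> carrier R"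
proof
  fix y assume "y \<in> set xs"
  then obtain j where "j < length xs" "y = xs ! j" by (auto simp: in_set_conv_nth)
  then show "y \<in> carrier R" using Pc[OF x] by simp
qed

lemma xF:
  assumes "j < length xs" "a \<in> ideal_pow R M (m - ss ! j)"
  shows "xs ! j \<otimes> a \<in> ideal_pow R M m"
  by (rule subsetD[OF ideal_pow_antimono[OF M_ideal] ideal_pow_mult_mem[OF M_ideal x[OF assms(1)] assms(2)]]) simp

lemma koszul_d_cong:
  assumes "\<And>l. c l \<in> carrier R" "\<And>l. d l \<in> carrier R" "length l = length xs"
    and "\<And>l'. length l' = length xs \<Longrightarrow> cnt l' = Suc (cnt l) \<Longrightarrow> c l' = d l'"
  shows "koszul_d R xs c l = koszul_d R xs d l"
proof -
  have "koszul_d R xs (\<lambda>l. c l \<ominus> d l) l \<in> {\<zero>}"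
    by (rule koszul_d_mem[OF zeroideal xc assms(3)]) (use assms in \<open>simp add: minus_self\<close>)
  then have "koszul_d R xs c l \<ominus> koszul_d R xs d l = \<zero>" using koszul_d_minus[OF xc assms(1,2)] by simp
  then show ?thesis
    using minus_add_cancel[of "koszul_d R xs c l" "koszul_d R xs d l"] xc assms(1,2) by simp
qed

lemma koszul_d_pow:
  assumes "length l = length xs" "\<And>l'. length l' = length xs \<Longrightarrow> cnt l' = Suc (cnt l) \<Longrightarrow> u l' \<in> ideal_pow R M (n - weight ss l')"
  shows "koszul_d R xs u l \<in> ideal_pow R M (n - weight ss l)"
  by (rule koszul_d_mem_weighted[where F = "ideal_pow R M", OF pow_ideal len assms(1) xc xF assms(2)])

lemma Suc_pow_subset: "a \<in> ideal_pow R M (Suc n - k) \<Longrightarrow> a \<in> ideal_pow R M (n - k)"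
  by (rule subsetD[OF ideal_pow_antimono[OF M_ideal, of "n - k" "Suc n - k"]]) (simp_all add: diff_le_mono)

text \<open>Successive approximation on \<open>n\<close>; only the differential of \<open>c\<close>
  is restricted, not \<open>c\<close> itself. Once \<open>c\<close> is corrected by a boundary into
  step n, its differential is unchanged and lies in step n + 1. It is thus a graded cycle, and
  graded exactness supplies the next correction.\<close>

lemma filtered_exact:
  assumes i: "2 \<le> i" and c: "\<And>l. c l \<in> carrier R"
    and cyc: "\<And>l. length l = length xs \<Longrightarrow> Suc (cnt l) = i \<Longrightarrow> koszul_d R xs c l \<in> ideal_pow R M (n - weight ss l)"
  shows "\<exists>b. (\<forall>l. b l \<in> carrier R) \<and>
    (\<forall>l. length l = length xs \<longrightarrow> cnt l = i \<longrightarrow> c l \<ominus> koszul_d R xs b l \<in> ideal_pow R M (n - weight ss l))"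
  using cyc
proof (induction n)
  case 0
  show ?case using c xc by (intro exI[of _ "\<lambda>_. \<zero>"]) simp
next
  case (Suc n)
  have "\<exists>b. (\<forall>l. b l \<in> carrier R) \<and>
    (\<forall>l. length l = length xs \<longrightarrow> cnt l = i \<longrightarrow> c l \<ominus> koszul_d R xs b l \<in> ideal_pow R M (n - weight ss l))"
    by (rule Suc.IH) (rule Suc_pow_subset[OF Suc.prems])
  then obtain b where b: "\<And>l. b l \<in> carrier R"
    "\<And>l. length l = length xs \<Longrightarrow> cnt l = i \<Longrightarrow> c l \<ominus> koszul_d R xs b l \<in> ideal_pow R M (n - weight ss l)" by blast
  \<comment> \<open>Cleared outside homological degree \<open>i\<close>, because graded exactness
    asks for the filtration bound at every position.\<close>
  define f where "f l = (if length l = length xs \<and> cnt l = i then c l \<ominus> koszul_d R xs b l else \<zero>)" for l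
  have f: "\<And>l. f l \<in> ideal_pow R M (n - weight ss l)"
    unfolding f_def using b(2) idealD(2)[OF pow_ideal] by simp
  have kb: "\<And>l. koszul_d R xs b l \<in> carrier R" using xc b by simp
  have "\<exists>g. (\<forall>l. g l \<in> ideal_pow R M (n - weight ss l)) \<and>
        (\<forall>l. length l = length xs \<longrightarrow> cnt l = i \<longrightarrow> f l \<ominus> koszul_d R xs g l \<in> ideal_pow R M (Suc n - weight ss l))"
  proof (rule gr[OF i f])
    fix l :: "bool list" assume l: "length l = length xs" "Suc (cnt l) = i"
    have "koszul_d R xs f l = koszul_d R xs (\<lambda>l. c l \<ominus> koszul_d R xs b l) l"
      by (rule koszul_d_cong) (use Pc[OF f] c kb l in \<open>auto simp: f_def\<close>)
    also have "\<dots> = koszul_d R xs c l \<ominus> koszul_d R xs (koszul_d R xs b) l" by (rule koszul_d_minus[OF xc c kb])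
    also have "\<dots> = koszul_d R xs c l" using koszul_d_koszul_d[OF xc b(1)] xc c by (simp add: a_minus_def)
    finally show "koszul_d R xs f l \<in> ideal_pow R M (Suc n - weight ss l)" using Suc.prems[OF l] by simp
  qed
  then obtain g where g: "\<And>l. g l \<in> ideal_pow R M (n - weight ss l)"
    "\<And>l. length l = length xs \<Longrightarrow> cnt l = i \<Longrightarrow> f l \<ominus> koszul_d R xs g l \<in> ideal_pow R M (Suc n - weight ss l)" by blast
  have gc: "\<And>l. g l \<in> carrier R" using Pc[OF g(1)] .
  have "c l \<ominus> koszul_d R xs (\<lambda>l. b l \<oplus> g l) l \<in> ideal_pow R M (Suc n - weight ss l)"
    if l: "length l = length xs" "cnt l = i" for l
  proof -
    have "c l \<ominus> koszul_d R xs (\<lambda>l. b l \<oplus> g l) l = f l \<ominus> koszul_d R xs g l"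
      using koszul_d_add[OF xc b(1) gc] c[of l] kb[of l] xc gc l
      by (simp add: f_def a_minus_def minus_add a_assoc)
    then show ?thesis using g(2)[OF l] by simp
  qed
  then show ?case using b(1) gc by (intro exI[of _ "\<lambda>l. b l \<oplus> g l"]) simp
qed

lemma cnt_zero: "length l = n \<Longrightarrow> cnt l = 0 \<Longrightarrow> l = replicate n False"
proof (induction l arbitrary: n)
  case (Cons b l)
  then show ?case by (cases b; cases n) auto
qed auto

lemma weight_zero: "weight ts (replicate k False) = 0"
proof (induction k arbitrary: ts)
  case 0
  show ?case by (cases ts) auto
next
  case (Suc k)
  then show ?case by (cases ts) auto
qed

lemma cnt_replicate: "cnt (replicate k False) = 0"
  by (induction k) auto

text \<open>In degree \<open>1\<close> the reduction property rewrites an element of \<open>M^n\<close> in terms of \<open>xs\<close> with small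
  coefficients, and the difference of the two expressions is a syzygy of \<open>xs\<close>.\<close>

lemma filtered_exact_1:
  assumes n: "r \<le> n" and c: "\<And>l. c l \<in> carrier R"
    and cyc: "\<And>l. length l = length xs \<Longrightarrow> cnt l = 0 \<Longrightarrow> koszul_d R xs c l \<in> ideal_pow R M (n - weight ss l)"
  shows "\<exists>b. (\<forall>l. b l \<in> carrier R) \<and>
    (\<forall>l. length l = length xs \<longrightarrow> cnt l = 1 \<longrightarrow> c l \<ominus> koszul_d R xs b l \<in> ideal_pow R M (n - weight ss l))"
proof -
  let ?o = "replicate (length xs) False"
  have "koszul_d R xs c ?o \<in> ideal_pow R M n" using cyc[of ?o] cnt_replicate weight_zero by simp
  then have "koszul_d R xs c ?o \<in> wsum R (ideal_pow R M) xs ss n" using red[OF n] by blast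
  then obtain a where a: "\<And>l. a l \<in> ideal_pow R M (n - weight ss l)" "koszul_d R xs a ?o = koszul_d R xs c ?o"
    using wsum_chain[of "ideal_pow R M", OF pow_ideal xc len] by blast
  have ac: "\<And>l. a l \<in> carrier R" using Pc[OF a(1)] .
  have "koszul_d R xs (\<lambda>l. c l \<ominus> a l) l \<in> {\<zero>}" if "length l = length xs" "Suc (cnt l) = 1" for l
  proof -
    have "l = ?o" using cnt_zero[of l "length xs"] that by simp
    then show ?thesis using koszul_d_minus[OF xc c ac] a(2) xc c by (simp add: minus_self)
  qed
  then obtain b where b: "\<And>l. b l \<in> carrier R"
    "\<And>l. length l = length xs \<Longrightarrow> cnt l = 1 \<Longrightarrow> (c l \<ominus> a l) \<ominus> koszul_d R xs b l \<in> {\<zero>}"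
    using cm[unfolded koszul_exact_def, rule_format, of "\<lambda>l. c l \<ominus> a l"] c ac by auto
  have "c l \<ominus> koszul_d R xs b l \<in> ideal_pow R M (n - weight ss l)" if l: "length l = length xs" "cnt l = 1" for l
  proof -
    have cl: "c l \<in> carrier R" "a l \<in> carrier R" "koszul_d R xs b l \<in> carrier R" using c ac b xc by auto
    have "c l \<ominus> a l = koszul_d R xs b l"
      using minus_add_cancel[of "c l \<ominus> a l" "koszul_d R xs b l"] b(2)[OF l] cl by simp
    then have "c l = koszul_d R xs b l \<oplus> a l" using minus_add_cancel[of "c l" "a l"] cl by simp
    then have "c l \<ominus> koszul_d R xs b l = a l" using add_minus_cancel[of "koszul_d R xs b l" "a l"] cl by simp
    then show ?thesis using a(1) by simp
  qed
  then show ?thesis using b(1) by blast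
qed

text \<open>Degree 0 is the inclusion of powers in weighted sums, degrees from 2 on are the
  assumption \<open>gr\<close>. In degree 1, exactness at step n + 1 gives a bounding chain of no
  controlled order. Its differential lies in step n, so exactness in degree 2 allows it to be
  replaced by a chain in step n with the same differential.\<close>

lemma graded_exact_all:
  assumes n: "r \<le> n" and c: "\<And>l. c l \<in> ideal_pow R M (n - weight ss l)"
    and cyc: "\<And>l. length l = length xs \<Longrightarrow> Suc (cnt l) = i \<Longrightarrow> koszul_d R xs c l \<in> ideal_pow R M (Suc n - weight ss l)"
  shows "\<exists>b. (\<forall>l. b l \<in> ideal_pow R M (n - weight ss l)) \<and>
    (\<forall>l. length l = length xs \<longrightarrow> cnt l = i \<longrightarrow> c l \<ominus> koszul_d R xs b l \<in> ideal_pow R M (Suc n - weight ss l))"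
proof -
  have cc: "\<And>l. c l \<in> carrier R" using Pc[OF c] .
  consider "i = 0" | "i = 1" | "2 \<le> i" by linarith
  then show ?thesis
  proof cases
    case 1
    let ?o = "replicate (length xs) False"
    have "c ?o \<in> ideal_pow R M n" using c[of ?o] weight_zero by simp
    then have "c ?o \<in> wsum R (ideal_pow R M) xs ss n" using red[OF n] by blast
    then obtain a where a: "\<And>l. a l \<in> ideal_pow R M (n - weight ss l)" "koszul_d R xs a ?o = c ?o"
      using wsum_chain[of "ideal_pow R M", OF pow_ideal xc len] by blast
    have "c l \<ominus> koszul_d R xs a l \<in> ideal_pow R M (Suc n - weight ss l)" if "length l = length xs" "cnt l = i" for l
    proof -
      have "l = ?o" using cnt_zero[of l "length xs"] that 1 by simp
      then show ?thesis using a(2) cc idealD(2)[OF pow_ideal] by (simp add: minus_self)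
    qed
    then show ?thesis using a(1) by blast
  next
    case 2
    obtain b where b: "\<And>l. b l \<in> carrier R"
      "\<And>l. length l = length xs \<Longrightarrow> cnt l = 1 \<Longrightarrow> c l \<ominus> koszul_d R xs b l \<in> ideal_pow R M (Suc n - weight ss l)"
      using filtered_exact_1[of "Suc n" c] n cc cyc 2 by auto
    have kb: "\<And>l. koszul_d R xs b l \<in> carrier R" using xc b by simp
    have kbF: "koszul_d R xs b l \<in> ideal_pow R M (n - weight ss l)" if l: "length l = length xs" "Suc (cnt l) = 2" for l
    proof -
      have "c l \<ominus> (c l \<ominus> koszul_d R xs b l) = koszul_d R xs b l"
        using cc[of l] kb[of l] by (simp add: a_minus_def minus_add r_neg1 r_neg2)
      moreover have "c l \<ominus> koszul_d R xs b l \<in> ideal_pow R M (n - weight ss l)" using Suc_pow_subset[OF b(2)] l by simp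
      ultimately show ?thesis using idealD(5)[OF pow_ideal c[of l]] by metis
    qed
    obtain e where e: "\<And>l. e l \<in> carrier R"
      "\<And>l. length l = length xs \<Longrightarrow> cnt l = 2 \<Longrightarrow> b l \<ominus> koszul_d R xs e l \<in> ideal_pow R M (n - weight ss l)"
      using filtered_exact[of 2 b n] b(1) kbF by auto
    have ke: "\<And>l. koszul_d R xs e l \<in> carrier R" using xc e by simp
    define b' where "b' l = (if length l = length xs \<and> cnt l = 2 then b l \<ominus> koszul_d R xs e l else \<zero>)" for l
    have b': "\<And>l. b' l \<in> ideal_pow R M (n - weight ss l)"
      unfolding b'_def using e(2) idealD(2)[OF pow_ideal] by simp
    have "c l \<ominus> koszul_d R xs b' l \<in> ideal_pow R M (Suc n - weight ss l)" if l: "length l = length xs" "cnt l = i" for l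
    proof -
      have "koszul_d R xs b' l = koszul_d R xs (\<lambda>l. b l \<ominus> koszul_d R xs e l) l"
        by (rule koszul_d_cong) (use Pc[OF b'] b ke l 2 in \<open>auto simp: b'_def\<close>)
      also have "\<dots> = koszul_d R xs b l \<ominus> koszul_d R xs (koszul_d R xs e) l" by (rule koszul_d_minus[OF xc b(1) ke])
      also have "\<dots> = koszul_d R xs b l" using koszul_d_koszul_d[OF xc e(1)] kb by (simp add: a_minus_def)
      finally show ?thesis using b(2) l 2 by simp
    qed
    then show ?thesis using b' by blast
  next
    case 3
    show ?thesis by (rule gr[OF 3 c cyc])
  qed
qed

section \<open>Lengths of the even and the odd part of the filtered complex\<close>

definition pos :: "bool \<Rightarrow> bool list set" where
  "pos p = {l. length l = length xs \<and> even (cnt l) = p}"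

text \<open>The chains of even (\<open>p = True\<close>) or odd homological degree that lie in the \<open>n\<close>-th step of the filtration.\<close>

definition Wf :: "nat \<Rightarrow> bool \<Rightarrow> bool list \<Rightarrow> 'a set" where
  "Wf n p l = (if l \<in> pos p then ideal_pow R M (n - weight ss l) else {\<zero>})"

lemma Wf_ideal: "ideal (Wf n p l) R"
  unfolding Wf_def using zeroideal by simp

text \<open>Cut off to the lists that index the complex, so that the values stay in a product of
  ideals whose other components are zero.\<close>

definition kdr :: "(bool list \<Rightarrow> 'a) \<Rightarrow> bool list \<Rightarrow> 'a" where
  "kdr c l = (if length l = length xs then koszul_d R xs c l else \<zero>)"

lemma fam_carrier: "c \<in> fam (Wf n p) \<Longrightarrow> c l \<in> carrier R"
  using idealD(1)[OF Wf_ideal, of "c l" n p l] by (simp add: fam_def)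

lemma kdr_closed:
  assumes "c \<in> fam (Wf n p)"
  shows "kdr c \<in> fam (Wf n (\<not> p))"
proof -
  have cW: "\<And>l. c l \<in> Wf n p l" using assms by (simp add: fam_def)
  have "kdr c l \<in> Wf n (\<not> p) l" for l
  proof (cases "length l = length xs")
    case l: True
    show ?thesis
    proof (cases "even (cnt l) = (\<not> p)")
      case True
      have "koszul_d R xs c l \<in> ideal_pow R M (n - weight ss l)"
      proof (rule koszul_d_pow[OF l])
        fix l' assume "length l' = length xs" "cnt l' = Suc (cnt l)"
        then have "l' \<in> pos p" using True by (auto simp: pos_def)
        then show "c l' \<in> ideal_pow R M (n - weight ss l')" using cW[of l'] by (simp add: Wf_def)
      qed
      then show ?thesis using True l by (simp add: kdr_def Wf_def pos_def)
    next
      case False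
      have "koszul_d R xs c l \<in> {\<zero>}"
      proof (rule koszul_d_mem[OF zeroideal xc l])
        fix l' assume "length l' = length xs" "cnt l' = Suc (cnt l)"
        then have "l' \<notin> pos p" using False by (auto simp: pos_def)
        then show "c l' \<in> {\<zero>}" using cW[of l'] by (simp add: Wf_def)
      qed
      then show ?thesis using False l by (simp add: kdr_def Wf_def pos_def)
    qed
  next
    case False
    then show ?thesis using idealD(2)[OF Wf_ideal] by (simp add: kdr_def)
  qed
  then show ?thesis by (simp add: fam_def)
qed

lemma kdr_kdr:
  assumes "c \<in> fam (Wf n p)"
  shows "kdr (kdr c) = (\<lambda>_. \<zero>)"
proof (rule ext)
  fix l
  have c: "\<And>l. c l \<in> carrier R" using fam_carrier[OF assms] .
  show "kdr (kdr c) l = \<zero>"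
  proof (cases "length l = length xs")
    case True
    have "koszul_d R xs (kdr c) l = koszul_d R xs (koszul_d R xs c) l"
      by (rule koszul_d_cong) (use xc c True in \<open>auto simp: kdr_def\<close>)
    then show ?thesis using True koszul_d_koszul_d[OF xc c] by (simp add: kdr_def)
  qed (simp add: kdr_def)
qed

text \<open>Modulo \<open>fam (Wf (Suc n) p)\<close> these are the cycles of the graded complex in
  internal degree \<open>n\<close>.\<close>

definition Zf :: "nat \<Rightarrow> bool \<Rightarrow> (bool list \<Rightarrow> 'a) set" where
  "Zf n p = {c \<in> fam (Wf n p). kdr c \<in> fam (Wf (Suc n) (\<not> p))}"

lemma kdr_add:
  assumes "c \<in> fam (Wf n p)" "d \<in> fam (Wf n p)"
  shows "kdr (\<lambda>l. c l \<oplus> d l) = (\<lambda>l. kdr c l \<oplus> kdr d l)"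
  using koszul_d_add[OF xc fam_carrier[OF assms(1)] fam_carrier[OF assms(2)]] by (auto simp: kdr_def)

lemma kdr_smult:
  assumes "s \<in> carrier R" "c \<in> fam (Wf n p)"
  shows "kdr (\<lambda>l. s \<otimes> c l) = (\<lambda>l. s \<otimes> kdr c l)"
  using koszul_d_smult[OF xc fam_carrier[OF assms(2)] assms(1)] assms(1) by (auto simp: kdr_def)

lemma fam_W: "fam (Wf n p) \<in> submods R (fun_mod R)"
  by (rule fam_submod[OF Wf_ideal])

lemma fam_W_Suc: "fam (Wf (Suc n) p) \<subseteq> fam (Wf n p)"
  using Suc_pow_subset by (auto simp: fam_def Wf_def)

lemma Zf_submod: "Zf n p \<in> submods R (fun_mod R)"
proof -
  interpret F: module R "fun_mod R :: ('a, bool list \<Rightarrow> 'a) module" by (rule fun_mod_module)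
  note W = F.submodsD[OF fam_W[of n p]] and V = F.submodsD[OF fam_W[of "Suc n" "\<not> p"]]
  show ?thesis
  proof (rule F.submodsI)
    show "Zf n p \<subseteq> carrier (fun_mod R)" using W(1) unfolding Zf_def by blast
    have "kdr (\<lambda>_. \<zero>) = (\<lambda>_. \<zero>)" using koszul_d_zero[OF xc] by (auto simp: kdr_def)
    then show "\<zero>\<^bsub>fun_mod R\<^esub> \<in> Zf n p" using W(2) V(2) by (simp add: Zf_def)
  next
    fix c d assume "c \<in> Zf n p" "d \<in> Zf n p"
    then show "c \<oplus>\<^bsub>fun_mod R\<^esub> d \<in> Zf n p"
      using W(3)[of c d] V(3)[of "kdr c" "kdr d"] kdr_add[of c n p d] by (simp add: Zf_def)
  next
    fix s c assume "s \<in> carrier R" "c \<in> Zf n p"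
    then show "s \<odot>\<^bsub>fun_mod R\<^esub> c \<in> Zf n p"
      using W(4)[of s c] V(4)[of s "kdr c"] kdr_smult[of s c n p] by (simp add: Zf_def)
  qed
qed

lemma V_subset_Z: "fam (Wf (Suc n) p) \<subseteq> Zf n p"
  using fam_W_Suc kdr_closed by (auto simp: Zf_def)

text \<open>Exactness in all homological degrees of one parity, assembled into one statement: a
  graded cycle is a boundary up to the next step of the filtration.\<close>

lemma cycle_decomp:
  assumes n: "r \<le> n" and y: "y \<in> Zf n (\<not> p)"
  shows "\<exists>a\<in>fam (Wf n p). \<exists>v\<in>fam (Wf (Suc n) (\<not> p)). y = (\<lambda>l. kdr a l \<oplus> v l)"
proof -
  have yW: "y \<in> fam (Wf n (\<not> p))" and ky: "kdr y \<in> fam (Wf (Suc n) p)" using y by (auto simp: Zf_def)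
  have yl: "y l \<in> Wf n (\<not> p) l" for l using yW by (simp add: fam_def)
  have yc: "y l \<in> ideal_pow R M (n - weight ss l)" for l
    using yl[of l] idealD(2)[OF pow_ideal] by (auto simp: Wf_def split: if_splits)
  have cyc: "koszul_d R xs y l \<in> ideal_pow R M (Suc n - weight ss l)" if "length l = length xs" for l
    using ky that idealD(2)[OF pow_ideal] by (auto simp: fam_def kdr_def Wf_def split: if_splits)
  have "\<forall>i. \<exists>b. (\<forall>l. b l \<in> ideal_pow R M (n - weight ss l)) \<and>
    (\<forall>l. length l = length xs \<longrightarrow> cnt l = i \<longrightarrow> y l \<ominus> koszul_d R xs b l \<in> ideal_pow R M (Suc n - weight ss l))"
    using graded_exact_all[OF n yc cyc] by blast
  then obtain B where B: "\<And>i l. B i l \<in> ideal_pow R M (n - weight ss l)"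
    "\<And>i l. length l = length xs \<Longrightarrow> cnt l = i \<Longrightarrow> y l \<ominus> koszul_d R xs (B i) l \<in> ideal_pow R M (Suc n - weight ss l)"
    by metis
  \<comment> \<open>In homological degree i + 1 the chain that bounds the degree i part of
    \<open>y\<close> is used, hence the index \<open>cnt l - 1\<close>. Positions with
    \<open>cnt l = 0\<close> are read by no differential.\<close>
  define a where "a l = (if l \<in> pos p then B (cnt l - 1) l else \<zero>)" for l
  have a: "a \<in> fam (Wf n p)" using B(1) by (simp add: fam_def a_def Wf_def)
  note ac = fam_carrier[OF a]
  define v where "v l = y l \<ominus> kdr a l" for l
  have kac: "kdr a l \<in> carrier R" for l using fam_carrier[OF kdr_closed[OF a]] .
  have "v l \<in> Wf (Suc n) (\<not> p) l" for l
  proof (cases "l \<in> pos (\<not> p)")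
    case True
    then have l: "length l = length xs" "even (cnt l) = (\<not> p)" by (auto simp: pos_def)
    have "koszul_d R xs a l = koszul_d R xs (B (cnt l)) l"
    proof (rule koszul_d_cong[OF ac Pc[OF B(1)] l(1)])
      fix l' :: "bool list" assume "length l' = length xs" "cnt l' = Suc (cnt l)"
      then show "a l' = B (cnt l) l'" using l by (auto simp: a_def pos_def)
    qed
    then show ?thesis using B(2)[OF l(1) refl] True l(1) by (simp add: v_def kdr_def Wf_def)
  next
    case False
    have "kdr a l \<in> Wf n (\<not> p) l" using kdr_closed[OF a] by (simp add: fam_def)
    then have "kdr a l = \<zero>" "y l = \<zero>" using yl[of l] False by (simp_all add: Wf_def)
    then show ?thesis using False by (simp add: v_def Wf_def minus_self)
  qed
  then have v: "v \<in> fam (Wf (Suc n) (\<not> p))" by (simp add: fam_def)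
  have "y = (\<lambda>l. kdr a l \<oplus> v l)"
    unfolding v_def using minus_add_cancel[OF fam_carrier[OF yW] kac] kac fam_carrier[OF yW]
    by (simp add: a_comm)
  then show ?thesis using a v by blast
qed

text \<open>First isomorphism theorem in the graded complex: chains modulo cycles are the
  boundaries, and by exactness these are the cycles of the other parity.\<close>

lemma length_Z_W:
  assumes n: "r \<le> n"
  shows "chain_len (submods R (fun_mod R)) (Zf n p) (fam (Wf n p)) =
    chain_len (submods R (fun_mod R)) (fam (Wf (Suc n) (\<not> p))) (Zf n (\<not> p))"
proof (rule length_linear_iso[where \<phi> = kdr, OF fun_mod_module fun_mod_module])
  fix c assume c: "c \<in> fam (Wf n p)"
  have "kdr (kdr c) \<in> fam (Wf (Suc n) p)"
    unfolding kdr_kdr[OF c] using idealD(2)[OF Wf_ideal] by (simp add: fam_def)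
  then show "kdr c \<in> Zf n (\<not> p)" using kdr_closed[OF c] by (simp add: Zf_def)
next
  show "{a \<in> fam (Wf n p). kdr a \<in> fam (Wf (Suc n) (\<not> p))} = Zf n p" by (simp add: Zf_def)
next
  fix y assume "y \<in> Zf n (\<not> p)"
  from cycle_decomp[OF n this]
  show "\<exists>a\<in>fam (Wf n p). \<exists>x\<in>fam (Wf (Suc n) (\<not> p)). y = kdr a \<oplus>\<^bsub>fun_mod R\<^esub> x" by simp
qed (use Zf_submod fam_W V_subset_Z kdr_add kdr_smult in \<open>simp_all\<close>)

text \<open>Each side is the length of the cycles of one parity plus that of the cycles of the
  other, which is symmetric in the parity. This is the vanishing of the Euler characteristic, stated
  without alternating sums because lengths are in \<open>enat\<close>.\<close>

lemma hilbert_recursion: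
  assumes n: "r \<le> n"
  shows "(\<Sum>l\<in>pos True. ideal_len (ideal_pow R M (Suc n - weight ss l)) (ideal_pow R M (n - weight ss l))) =
    (\<Sum>l\<in>pos False. ideal_len (ideal_pow R M (Suc n - weight ss l)) (ideal_pow R M (n - weight ss l)))"
proof -
  let ?L = "chain_len (submods R (fun_mod R :: ('a, bool list \<Rightarrow> 'a) module))"
  have fin: "finite (pos p)" for p
  proof (rule finite_subset)
    show "pos p \<subseteq> {l. set l \<subseteq> UNIV \<and> length l = length xs}" by (auto simp: pos_def)
  qed (rule finite_lists_length_eq, simp)
  have tot: "?L (fam (Wf (Suc n) p)) (fam (Wf n p)) =
      (\<Sum>l\<in>pos p. ideal_len (ideal_pow R M (Suc n - weight ss l)) (ideal_pow R M (n - weight ss l)))" for p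
  proof -
    have "?L (fam (Wf (Suc n) p)) (fam (Wf n p)) = (\<Sum>l\<in>pos p. ideal_len (Wf (Suc n) p l) (Wf n p l))"
      by (rule length_fam[OF fin Wf_ideal Wf_ideal]) (use Suc_pow_subset in \<open>auto simp: Wf_def\<close>)
    also have "\<dots> = (\<Sum>l\<in>pos p. ideal_len (ideal_pow R M (Suc n - weight ss l)) (ideal_pow R M (n - weight ss l)))"
      by (rule sum.cong) (simp_all add: Wf_def)
    finally show ?thesis .
  qed
  have split: "?L (fam (Wf (Suc n) p)) (fam (Wf n p)) =
      ?L (fam (Wf (Suc n) p)) (Zf n p) + ?L (Zf n p) (fam (Wf n p))" for p
    by (rule module.submods_length_add[OF fun_mod_module fam_W Zf_submod fam_W V_subset_Z]) (auto simp: Zf_def)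
  show ?thesis
    unfolding tot[symmetric] split length_Z_W[OF n] by (simp add: add.commute)
qed

end

section \<open>Difference operators and the Hilbert function\<close>

text \<open>The operator \<open>\<Prod>\<^sub>i (1 - T\<^sup>s\<^sup>i)\<close> for the shift \<open>T\<close>, with \<open>f\<close> extended by \<open>0\<close> to negative arguments.\<close>

fun shift_diff :: "nat list \<Rightarrow> (nat \<Rightarrow> int) \<Rightarrow> nat \<Rightarrow> int" where
  "shift_diff [] f n = f n"
| "shift_diff (s # ss) f n = shift_diff ss f n - (if s \<le> n then shift_diff ss f (n - s) else 0)"

lemma shift_diff_cong: "(\<And>m. m \<le> n \<Longrightarrow> f m = g m) \<Longrightarrow> shift_diff ss f n = shift_diff ss g n"
proof (induction ss arbitrary: n)
  case (Cons s ss)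
  have "shift_diff ss f n = shift_diff ss g n" "s \<le> n \<Longrightarrow> shift_diff ss f (n - s) = shift_diff ss g (n - s)" using Cons by auto
  then show ?case by simp
qed auto

text \<open>All shifts being positive, \<open>shift_diff ss f n\<close> is \<open>f n\<close> plus a
  combination of values at smaller arguments. Vanishing of the operator is therefore a recursion
  that determines \<open>f\<close>.\<close>

lemma shift_diff_diff:
  "(\<And>m. m < n \<Longrightarrow> f m = g m) \<Longrightarrow> (\<And>s. s \<in> set ss \<Longrightarrow> 1 \<le> s) \<Longrightarrow> shift_diff ss f n - shift_diff ss g n = f n - g n"
proof (induction ss)
  case (Cons s ss)
  have "s \<le> n \<Longrightarrow> shift_diff ss f (n - s) = shift_diff ss g (n - s)"
    by (rule shift_diff_cong, rule Cons.prems) (use Cons.prems(2)[of s] in auto)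
  then show ?case using Cons by simp
qed auto

lemma shift_diff_determines:
  assumes "\<And>n. n < N \<Longrightarrow> f n = g n" "\<And>n. N \<le> n \<Longrightarrow> shift_diff ss f n = 0" "\<And>n. N \<le> n \<Longrightarrow> shift_diff ss g n = 0"
    and "\<And>s. s \<in> set ss \<Longrightarrow> 1 \<le> s"
  shows "f n = g n"
proof (induction n rule: less_induct)
  case (less n)
  show ?case
  proof (cases "n < N")
    case False
    then show ?thesis using shift_diff_diff[of n f g ss, OF less assms(4)] assms(2,3)[of n] by simp
  qed (use assms in auto)
qed

lemma finite_bool_lists: "finite {l :: bool list. length l = k}"
  using finite_lists_length_eq[of "UNIV :: bool set" k] by simp

text \<open>Expanding the product of the factors uses the index set of the Koszul complex, with the
  parity of the homological degree as sign and the weight as shift.\<close>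

lemma shift_diff_sum:
  "shift_diff ss f n = (\<Sum>l | length l = length ss. (-1) ^ cnt l * (if weight ss l \<le> n then f (n - weight ss l) else 0))"
proof (induction ss arbitrary: n)
  case (Cons s ss)
  let ?L = "{l :: bool list. length l = length ss}"
  have split: "{l. length l = length (s # ss)} = Cons False ` ?L \<union> Cons True ` ?L"
  proof (intro Set.set_eqI iffI)
    fix l :: "bool list" assume "l \<in> {l. length l = length (s # ss)}"
    then obtain b l' where "l = b # l'" "length l' = length ss" by (cases l) auto
    then show "l \<in> Cons False ` ?L \<union> Cons True ` ?L" by (cases b) auto
  qed auto
  have "(\<Sum>l | length l = length (s # ss). (-1) ^ cnt l * (if weight (s # ss) l \<le> n then f (n - weight (s # ss) l) else 0))
      = (\<Sum>l\<in>?L. (-1) ^ cnt l * (if weight ss l \<le> n then f (n - weight ss l) else 0))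
      + (\<Sum>l\<in>?L. - ((-1) ^ cnt l * (if s + weight ss l \<le> n then f (n - (s + weight ss l)) else 0)))"
    unfolding split by (subst sum.union_disjoint) (auto simp: finite_bool_lists sum.reindex inj_on_def cong: if_cong)
  also have "(\<Sum>l\<in>?L. (-1) ^ cnt l * (if weight ss l \<le> n then f (n - weight ss l) else 0)) = shift_diff ss f n"
    using Cons.IH by simp
  also have "(\<Sum>l\<in>?L. - ((-1) ^ cnt l * (if s + weight ss l \<le> n then f (n - (s + weight ss l)) else 0)))
      = - (if s \<le> n then shift_diff ss f (n - s) else 0)"
  proof (cases "s \<le> n")
    case True
    then show ?thesis using Cons.IH[of "n - s"]
      by (auto simp: sum_negf intro!: sum.cong arg_cong[where f = uminus])
  next
    case False
    then show ?thesis by simp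
  qed
  finally show ?case by simp
qed simp

text \<open>A supremum of natural numbers that reaches a positive \<open>k\<close> needs a member of
  size at least \<open>k\<close>. For \<open>k = 0\<close> there might be no regular sequence at
  all, the supremum of the empty set being 0.\<close>

lemma depth_ge:
  assumes "enat k \<le> depth S Q" "0 < k"
  obtains xs where "regular_seq S Q xs" "k \<le> length xs"
proof (rule ccontr)
  assume "\<not> thesis"
  have "length xs \<le> k - 1" if "regular_seq S Q xs" for xs
    using \<open>\<not> thesis\<close> \<open>\<And>xs. regular_seq S Q xs \<Longrightarrow> k \<le> length xs \<Longrightarrow> thesis\<close>[OF that] by linarith
  then have "depth S Q \<le> enat (k - 1)" unfolding depth_def by (auto intro!: Sup_least)
  then have "enat k \<le> enat (k - 1)" using assms(1) order_trans by blast
  then show False using assms(2) by simp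
qed

context noeth_local
begin

lemma max_ideal_eq: "max_ideal R = M"
  unfolding max_ideal_def by (rule the_equality, rule max, rule uniq)

lemma hilbert_eq: "hilbert_function R n = ideal_len (ideal_pow R M (Suc n)) (ideal_pow R M n)"
  unfolding hilbert_function_def ideal_len_def chain_len_def max_ideal_eq by simp

text \<open>Depth sensitivity with a regular sequence of length k works in homological degrees i
  with \<open>length xs < i + k\<close>. The bound on the depth of R gives all degrees from 1 on,
  the bound for the graded ring all degrees from 2 on.\<close>

lemma depth_koszul_setting:
  assumes len: "length ss = length xs"
    and x: "\<And>i. i < length xs \<Longrightarrow> xs ! i \<in> ideal_pow R M (ss ! i)"
    and red: "\<And>n. r \<le> n \<Longrightarrow> ideal_pow R M n \<subseteq> wsum R (ideal_pow R M) xs ss n"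
    and dep: "enat (length xs) \<le> depth R M"
    and depgr: "enat (length xs - 1) \<le> depth (assoc_graded R M) (gr_hom_max_ideal R M)"
  shows "koszul_setting R M xs ss r"
proof -
  have xc: "set xs \<subseteq> carrier R"
  proof
    fix y assume "y \<in> set xs"
    then obtain j where "j < length xs" "y = xs ! j" by (auto simp: in_set_conv_nth)
    then show "y \<in> carrier R" using idealD(1)[OF pow_ideal x] by simp
  qed
  have idl0: "Idl {} = {\<zero>}"
    using genideal_minimal[OF zeroideal, of "{}"] idealD(2)[OF genideal_ideal[of "{}"]] by fast
  have zIdl: "{\<zero>} <+> Idl (set xs) = Idl (set xs)"
    using sum_absorb(1)[OF zeroideal genideal_ideal[OF xc]] idealD(2)[OF genideal_ideal[OF xc]] by simp
  have cm: "koszul_exact xs {\<zero>} 1"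
  proof (cases "length xs = 0")
    case True
    \<comment> \<open>The depth bound 0 yields no sequence, but without generators the complex is
      concentrated in degree 0.\<close>
    show ?thesis
      by (rule koszul_exact_of_regular[where ys = "[]", OF zeroideal xc]) (use True in auto)
  next
    case False
    then obtain zs where zs: "regular_seq R M zs" "length xs \<le> length zs"
      using depth_ge[OF dep] by blast
    have zM: "set zs \<subseteq> M" using zs(1) by (simp add: regular_seq_def)
    have zc: "set zs \<subseteq> carrier R" using zM ideal_subset[OF M_ideal] by blast
    have "regular_mod {z \<in> carrier R. id z \<in> genideal R {}} zs"
    proof (rule regular_mod_lift[where h = id and S = R])
      show "ring_hom_ring R R id" by (rule ring_hom_ringI2[OF ring_axioms ring_axioms]) (auto simp: ring_hom_def)
      fix i z assume "i < length zs" "z \<in> carrier R"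
        "id (zs ! i) \<otimes> z \<in> Idl ({} \<union> set (take i (map id zs)))"
      then show "z \<in> Idl ({} \<union> set (take i (map id zs)))"
        using zs(1) unfolding regular_seq_def by simp
    qed (use zc cring_axioms in auto)
    then have reg: "regular_mod {\<zero>} zs" using idl0 by (simp add: conj_commute cong: conj_cong)
    show ?thesis
    proof (rule koszul_exact_of_regular[OF zeroideal xc zc reg])
      fix y assume "y \<in> set zs"
      then have y: "y \<in> M" using zM by blast
      have ypow: "y [^] t \<in> ideal_pow R M t" for t :: nat
      proof (induction t)
        case (Suc t)
        have "y \<in> ideal_pow R M (Suc 0)" using y ideal_pow_1[OF M_ideal] by simp
        then have "y [^] t \<otimes> y \<in> ideal_pow R M (t + Suc 0)"
          using ideal_pow_mult_mem[OF M_ideal Suc.IH] by blast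
        then show ?case by simp
      qed simp
      have "y [^] r \<in> wsum R (ideal_pow R M) xs ss r" by (rule subsetD[OF red[OF order_refl] ypow])
      then have "y [^] r \<in> Idl (set xs)"
        by (rule subsetD[OF wsum_subset_Idl[where F = "ideal_pow R M", OF pow_ideal xc len]])
      then show "\<exists>t::nat. y [^] t \<in> {\<zero>} <+> Idl (set xs)" unfolding zIdl by blast
    qed (use zs False in auto)
  qed
  have ex: "cring.koszul_exact (rees M) (map2 (monomial R) xs ss)
      {p \<in> carrier (rees M). \<forall>n. p n \<in> ideal_pow R M (Suc n)} i" if i: "2 \<le> i" for i
  proof (cases "length xs - 1 = 0")
    case True
    interpret S: cring "rees M" by (rule rees_cring[OF M_ideal])
    \<comment> \<open>With at most one generator there are no positions of homological degree 2 or
      more.\<close>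
    have "cnt l \<noteq> i" if "length l = length (map2 (monomial R) xs ss)" for l
      using count_le_length[of l True] that True i by auto
    then show ?thesis unfolding S.koszul_exact_def using S.zero_closed by blast
  next
    case False
    then obtain gs where gs: "regular_seq (assoc_graded R M) (gr_hom_max_ideal R M) gs" "length xs - 1 \<le> length gs"
      using depth_ge[OF depgr] by blast
    show ?thesis by (rule rees_koszul_exact[OF M_ideal len x red gs(1)]) (use gs i in auto)
  qed
  show ?thesis
    by (unfold_locales, rule len, rule x, assumption, rule red, assumption, rule cm)
      (rule graded_exact[OF M_ideal len x ex])
qed

lemma hilbert_finite: "hilbert_function R n < \<infinity>"
proof -
  have "ideal_len (ideal_pow R M (Suc n)) (ideal_pow R M (Suc n) <+> ideal_pow R M n) < \<infinity>"
    by (rule ideal_len_finite[OF pow_ideal pow_ideal]) (simp add: ideal_pow_Suc[OF M_ideal])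
  then show ?thesis
    using sum_absorb(1)[OF pow_ideal pow_ideal ideal_pow_antimono[OF M_ideal, of n "Suc n"]] by (simp add: hilbert_eq)
qed

definition hf :: "nat \<Rightarrow> int" where "hf n = int (the_enat (hilbert_function R n))"

lemma enat_hf: "hilbert_function R n = enat (nat (hf n))"
  using hilbert_finite[of n] by (auto simp: hf_def)

end

lemma (in koszul_setting) hilbert_shift_diff:
  assumes n: "r \<le> n"
  shows "shift_diff ss hf n = 0"
proof -
  let ?g = "\<lambda>l. if weight ss l \<le> n then hf (n - weight ss l) else 0"
  have len_g: "ideal_len (ideal_pow R M (Suc n - weight ss l)) (ideal_pow R M (n - weight ss l)) = enat (nat (?g l))" for l
  proof (cases "weight ss l \<le> n")
    case True
    then show ?thesis using hilbert_eq[of "n - weight ss l"] enat_hf by (simp add: Suc_diff_le)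
  next
    case False
    \<comment> \<open>Both exponents truncate to 0, so this is the length of R over itself; it
      matches the convention that the Hilbert function is 0 at negative arguments.\<close>
    then show ?thesis using ideal_len_same by (simp add: zero_enat_def)
  qed
  have g0: "0 \<le> ?g l" for l by (simp add: hf_def)
  have fin: "finite (pos p)" for p
    by (rule finite_subset[OF _ finite_bool_lists[of "length xs"]]) (auto simp: pos_def)
  have sum_enat: "(\<Sum>l\<in>A. enat (h l)) = enat (\<Sum>l\<in>A. h l)" if "finite A" for A and h :: "bool list \<Rightarrow> nat"
    using that by (induction A rule: finite_induct) (auto simp: zero_enat_def)
  have "(\<Sum>l\<in>pos True. nat (?g l)) = (\<Sum>l\<in>pos False. nat (?g l))"
    using hilbert_recursion[OF n] unfolding len_g sum_enat[OF fin] by simp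
  then have eq: "(\<Sum>l\<in>pos True. ?g l) = (\<Sum>l\<in>pos False. ?g l)"
  proof -
    have iq: "(\<Sum>l\<in>pos p. ?g l) = int (\<Sum>l\<in>pos p. nat (?g l))" for p
      unfolding int_sum by (rule sum.cong) (use g0 in auto)
    show ?thesis unfolding iq \<open>(\<Sum>l\<in>pos True. nat (?g l)) = (\<Sum>l\<in>pos False. nat (?g l))\<close> ..
  qed
  have "{l. length l = length ss} = pos True \<union> pos False" "pos True \<inter> pos False = {}"
    using len by (auto simp: pos_def)
  then have "shift_diff ss hf n = (\<Sum>l\<in>pos True. (-1) ^ cnt l * ?g l) + (\<Sum>l\<in>pos False. (-1) ^ cnt l * ?g l)"
    unfolding shift_diff_sum using fin by (simp add: sum.union_disjoint)
  also have "(\<Sum>l\<in>pos True. (-1) ^ cnt l * ?g l) = (\<Sum>l\<in>pos True. ?g l)"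
    by (rule sum.cong) (auto simp: pos_def)
  also have "(\<Sum>l\<in>pos False. (-1) ^ cnt l * ?g l) = - (\<Sum>l\<in>pos False. ?g l)"
    unfolding sum_negf[symmetric] by (rule sum.cong) (auto simp: pos_def)
  finally show ?thesis using eq by simp
qed

section \<open>The ascending chain condition for the Rees algebra\<close>

locale noeth_cring = cring R + noetherian_ring R for R (structure)

sublocale noeth_local \<subseteq> noeth_cring ..

context cring
begin

text \<open>\<open>L\<close> is a homogeneous submodule of \<open>\<Oplus>\<^sub>n P n\<close> over the graded algebra generated by the set \<open>E\<close> in degree one,
  and \<open>graded_acc\<close> is the ascending chain condition for these submodules.\<close>

definition graded_sub :: "(nat \<Rightarrow> 'a set) \<Rightarrow> 'a set \<Rightarrow> (nat \<Rightarrow> 'a set) \<Rightarrow> bool" where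
  "graded_sub P E L \<longleftrightarrow> (\<forall>n. ideal (L n) R) \<and> (\<forall>n. L n \<subseteq> P n) \<and> (\<forall>e\<in>E. \<forall>n. \<forall>a\<in>L n. e \<otimes> a \<in> L (Suc n))"

definition graded_acc :: "(nat \<Rightarrow> 'a set) \<Rightarrow> 'a set \<Rightarrow> bool" where
  "graded_acc P E \<longleftrightarrow> (\<forall>Ls :: nat \<Rightarrow> nat \<Rightarrow> 'a set. (\<forall>j. graded_sub P E (Ls j)) \<longrightarrow> (\<forall>j n. Ls j n \<subseteq> Ls (Suc j) n) \<longrightarrow>
     (\<exists>j0. \<forall>j\<ge>j0. Ls j = Ls j0))"

lemma graded_subD:
  assumes "graded_sub P E L"
  shows "ideal (L n) R" "a \<in> L n \<Longrightarrow> a \<in> P n" "e \<in> E \<Longrightarrow> a \<in> L n \<Longrightarrow> e \<otimes> a \<in> L (Suc n)"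
  using assms unfolding graded_sub_def by blast+

text \<open>The degree \<open>m\<close> part of the polynomials in \<open>t\<close> of degree less than \<open>i\<close> with coefficients in \<open>P\<close>.\<close>

primrec Qf :: "(nat \<Rightarrow> 'a set) \<Rightarrow> 'a \<Rightarrow> nat \<Rightarrow> nat \<Rightarrow> 'a set" where
  "Qf P t 0 m = {\<zero>}"
| "Qf P t (Suc i) m = Qf P t i m <+> (\<lambda>a. t [^] i \<otimes> a) ` P (m - i)"

end

section \<open>The inductive step of Hilbert's basis theorem in graded form\<close>

locale poly_step = cring R for R (structure) +
  fixes P :: "nat \<Rightarrow> 'a set" and E :: "'a set" and t
  assumes P: "\<And>n. ideal (P n) R" and E: "E \<subseteq> carrier R" and t: "t \<in> carrier R"
    and EP: "\<And>e n a. e \<in> E \<Longrightarrow> a \<in> P n \<Longrightarrow> e \<otimes> a \<in> P (Suc n)"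
begin

abbreviation "Q \<equiv> Qf P t"

text \<open>The sum over i \<le> m of \<open>t [^] i\<close> times \<open>P (m - i)\<close>. The
  bound \<open>Suc m\<close> keeps the subtraction from truncating.\<close>

definition "P' m = Q (Suc m) m"

lemma Q_ideal: "ideal (Q i m) R"
proof (induction i)
  case (Suc i)
  then show ?case using add_ideals[OF Suc image_mult_ideal[OF P]] t by simp
qed (simp add: zeroideal)

lemma Q_cases:
  assumes "a \<in> Q (Suc i) m"
  obtains q p where "q \<in> Q i m" "p \<in> P (m - i)" "a = q \<oplus> t [^] i \<otimes> p"
  using assms by (auto simp: mem_sum_iff)

lemma Q_SucI: "q \<in> Q i m \<Longrightarrow> p \<in> P (m - i) \<Longrightarrow> q \<oplus> t [^] i \<otimes> p \<in> Q (Suc i) m"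
  by (auto simp: mem_sum_iff)

lemma Q_E: "i \<le> Suc m \<Longrightarrow> e \<in> E \<Longrightarrow> a \<in> Q i m \<Longrightarrow> e \<otimes> a \<in> Q i (Suc m)"
proof (induction i arbitrary: a)
  case 0
  then show ?case using E by auto
next
  case (Suc i)
  obtain q p where qp: "q \<in> Q i m" "p \<in> P (m - i)" "a = q \<oplus> t [^] i \<otimes> p" using Q_cases Suc by blast
  have ec: "e \<in> carrier R" using Suc E by blast
  have "e \<otimes> a = e \<otimes> q \<oplus> t [^] i \<otimes> (e \<otimes> p)"
    using ec t idealD(1)[OF Q_ideal qp(1)] idealD(1)[OF P qp(2)] qp(3) by (simp add: r_distr m_lcomm)
  moreover have "e \<otimes> p \<in> P (Suc m - i)" using EP[OF Suc.prems(2) qp(2)] Suc.prems(1) by (simp add: Suc_diff_le)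
  ultimately show ?case using Q_SucI Suc qp by simp
qed

lemma Q_t: "a \<in> Q i m \<Longrightarrow> t \<otimes> a \<in> Q (Suc i) (Suc m)"
proof (induction i arbitrary: a)
  case 0
  then have "t \<otimes> a = \<zero>" using t by simp
  then show ?case using idealD(2)[OF Q_ideal] by presburger
next
  case (Suc i)
  obtain q p where qp: "q \<in> Q i m" "p \<in> P (m - i)" "a = q \<oplus> t [^] i \<otimes> p" using Q_cases Suc by blast
  have "t \<otimes> a = t \<otimes> q \<oplus> t [^] Suc i \<otimes> p"
    using t idealD(1)[OF Q_ideal qp(1)] idealD(1)[OF P qp(2)] qp(3) by (simp add: r_distr m_ac)
  moreover have "p \<in> P (Suc m - Suc i)" using qp by simp
  ultimately show ?case using Q_SucI[OF Suc.IH[OF qp(1)]] by presburger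
qed

lemma P'_ideal: "ideal (P' n) R" unfolding P'_def by (rule Q_ideal)

lemma P'_E: "e \<in> insert t E \<Longrightarrow> a \<in> P' n \<Longrightarrow> e \<otimes> a \<in> P' (Suc n)"
proof -
  assume e: "e \<in> insert t E" and a: "a \<in> P' n"
  have mono: "Q (Suc n) (Suc n) \<subseteq> Q (Suc (Suc n)) (Suc n)"
    unfolding Qf.simps(2)[of P t "Suc n" "Suc n"] by (rule sum_upper(1)[OF Q_ideal image_mult_ideal[OF P]]) (simp add: t)
  show ?thesis
  proof (cases "e = t")
    case True
    then show ?thesis using Q_t a unfolding P'_def by blast
  next
    case False
    then have "e \<otimes> a \<in> Q (Suc n) (Suc n)" using Q_E[of "Suc n" n e a] e a unfolding P'_def by simp
    then show ?thesis using mono unfolding P'_def by blast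
  qed
qed

text \<open>The leading coefficients of the elements of \<open>L\<close> of degree at most \<open>i\<close> in \<open>t\<close>.\<close>

definition lead :: "(nat \<Rightarrow> 'a set) \<Rightarrow> nat \<Rightarrow> nat \<Rightarrow> 'a set" where
  "lead L i n = {a \<in> P n. \<exists>b\<in>L (n + i). t [^] i \<otimes> a \<ominus> b \<in> Q i (n + i)}"

lemma lead_graded_sub:
  assumes L: "graded_sub P' (insert t E) L"
  shows "graded_sub P E (lead L i)"
  unfolding graded_sub_def
proof (intro conjI allI ballI)
  fix n
  have ti: "t [^] i \<in> carrier R" using t by simp
  note Ld = idealD[OF graded_subD(1)[OF L]] and Pd = idealD[OF P] and Qd = idealD[OF Q_ideal]
  show "ideal (lead L i n) R"
  proof (rule idealI')
    show "lead L i n \<subseteq> carrier R" using Pd(1) unfolding lead_def by blast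
    have "t [^] i \<otimes> \<zero> \<ominus> \<zero> = \<zero>" using ti by (simp add: a_minus_def)
    then show "\<zero> \<in> lead L i n" unfolding lead_def using Pd(2) Ld(2) Qd(2) by (auto intro!: bexI[of _ \<zero>])
  next
    fix a a' assume "a \<in> lead L i n" "a' \<in> lead L i n"
    then obtain b b' where b: "a \<in> P n" "a' \<in> P n" "b \<in> L (n + i)" "b' \<in> L (n + i)"
      "t [^] i \<otimes> a \<ominus> b \<in> Q i (n + i)" "t [^] i \<otimes> a' \<ominus> b' \<in> Q i (n + i)" unfolding lead_def by blast
    have c: "a \<in> carrier R" "a' \<in> carrier R" "b \<in> carrier R" "b' \<in> carrier R"
      using Pd(1)[OF b(1)] Pd(1)[OF b(2)] Ld(1)[OF b(3)] Ld(1)[OF b(4)] by auto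
    have "t [^] i \<otimes> (a \<oplus> a') \<ominus> (b \<oplus> b') = (t [^] i \<otimes> a \<ominus> b) \<oplus> (t [^] i \<otimes> a' \<ominus> b')"
      using ti c by (simp add: a_minus_def r_distr minus_add a_ac)
    then have "t [^] i \<otimes> (a \<oplus> a') \<ominus> (b \<oplus> b') \<in> Q i (n + i)" using Qd(3)[OF b(5,6)] by simp
    then show "a \<oplus> a' \<in> lead L i n" unfolding lead_def using Pd(3)[OF b(1,2)] Ld(3)[OF b(3,4)] by blast
  next
    fix r a assume r: "r \<in> carrier R" and "a \<in> lead L i n"
    then obtain b where b: "a \<in> P n" "b \<in> L (n + i)" "t [^] i \<otimes> a \<ominus> b \<in> Q i (n + i)" unfolding lead_def by blast
    have c: "a \<in> carrier R" "b \<in> carrier R" using Pd(1)[OF b(1)] Ld(1)[OF b(2)] by auto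
    have "t [^] i \<otimes> (r \<otimes> a) \<ominus> r \<otimes> b = r \<otimes> (t [^] i \<otimes> a \<ominus> b)"
      using ti c r by (simp add: a_minus_def r_distr r_minus m_lcomm)
    then have "t [^] i \<otimes> (r \<otimes> a) \<ominus> r \<otimes> b \<in> Q i (n + i)" using Qd(6)[OF r b(3)] by simp
    then show "r \<otimes> a \<in> lead L i n" unfolding lead_def using Pd(6)[OF r b(1)] Ld(6)[OF r b(2)] by blast
  qed
  show "lead L i n \<subseteq> P n" unfolding lead_def by blast
  fix e a assume e: "e \<in> E" and "a \<in> lead L i n"
  then obtain b where b: "a \<in> P n" "b \<in> L (n + i)" "t [^] i \<otimes> a \<ominus> b \<in> Q i (n + i)" unfolding lead_def by blast
  have c: "a \<in> carrier R" "b \<in> carrier R" "e \<in> carrier R" using Pd(1)[OF b(1)] Ld(1)[OF b(2)] e E by auto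
  have "t [^] i \<otimes> (e \<otimes> a) \<ominus> e \<otimes> b = e \<otimes> (t [^] i \<otimes> a \<ominus> b)"
    using ti c by (simp add: a_minus_def r_distr r_minus m_lcomm)
  also have "\<dots> \<in> Q i (Suc (n + i))" by (rule Q_E[OF _ e b(3)]) simp
  finally have "t [^] i \<otimes> (e \<otimes> a) \<ominus> e \<otimes> b \<in> Q i (Suc n + i)" by simp
  moreover have "e \<otimes> b \<in> L (Suc n + i)" using graded_subD(3)[OF L _ b(2), of e] e by simp
  ultimately show "e \<otimes> a \<in> lead L i (Suc n)" unfolding lead_def using EP[OF e b(1)] by blast
qed

lemma lead_Suc:
  assumes L: "graded_sub P' (insert t E) L"
  shows "lead L i n \<subseteq> lead L (Suc i) n"
proof
  fix a assume "a \<in> lead L i n"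
  then obtain b where b: "a \<in> P n" "b \<in> L (n + i)" "t [^] i \<otimes> a \<ominus> b \<in> Q i (n + i)" unfolding lead_def by blast
  have c: "a \<in> carrier R" "b \<in> carrier R" using idealD(1)[OF P b(1)] idealD(1)[OF graded_subD(1)[OF L] b(2)] by auto
  have "t [^] Suc i \<otimes> a \<ominus> t \<otimes> b = t \<otimes> (t [^] i \<otimes> a \<ominus> b)"
    using t c by (simp add: a_minus_def r_distr r_minus m_ac)
  also have "\<dots> \<in> Q (Suc i) (Suc (n + i))" by (rule Q_t[OF b(3)])
  finally have "t [^] Suc i \<otimes> a \<ominus> t \<otimes> b \<in> Q (Suc i) (n + Suc i)" by (simp only: add_Suc_right)
  moreover have "t \<otimes> b \<in> L (n + Suc i)" using graded_subD(3)[OF L _ b(2), of t] by simp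
  ultimately show "a \<in> lead L (Suc i) n" unfolding lead_def using b(1) by blast
qed

lemma lead_mono: "(\<And>n. L n \<subseteq> L' n) \<Longrightarrow> lead L i n \<subseteq> lead L' i n"
  unfolding lead_def by blast

text \<open>Descent on the degree in \<open>t\<close>: an element of \<open>L'\<close> shares its
  leading coefficient with an element of \<open>L\<close>, and the difference is an element of
  \<open>L'\<close> of lower degree.\<close>

lemma lead_eq_imp:
  assumes L: "graded_sub P' (insert t E) L" and L': "graded_sub P' (insert t E) L'"
    and sub: "\<And>n. L n \<subseteq> L' n" and eq: "\<And>i n. lead L i n = lead L' i n"
  shows "L = L'"
proof -
  have "i \<le> Suc m \<Longrightarrow> a \<in> L' m \<Longrightarrow> a \<in> Q i m \<Longrightarrow> a \<in> L m" for i m a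
  proof (induction i arbitrary: a)
    case 0
    then show ?case using idealD(2)[OF graded_subD(1)[OF L]] by simp
  next
    case (Suc i)
    obtain q p where qp: "q \<in> Q i m" "p \<in> P (m - i)" "a = q \<oplus> t [^] i \<otimes> p" using Q_cases Suc by blast
    have c: "q \<in> carrier R" "t [^] i \<otimes> p \<in> carrier R" "a \<in> carrier R"
      using idealD(1)[OF Q_ideal qp(1)] idealD(1)[OF P qp(2)] t qp(3) by auto
    have mi: "m - i + i = m" using Suc.prems by simp
    have "t [^] i \<otimes> p \<ominus> a = \<ominus> q"
      using c qp(3) by (simp add: a_minus_def minus_add a_comm[of q] a_assoc[symmetric] r_neg1 r_neg2 r_neg)
    then have "t [^] i \<otimes> p \<ominus> a \<in> Q i (m - i + i)" using idealD(4)[OF Q_ideal qp(1)] mi by simp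
    then have "p \<in> lead L' i (m - i)" unfolding lead_def using qp(2) Suc.prems(2) mi by auto
    then have "p \<in> lead L i (m - i)" using eq by simp
    then obtain b where b: "b \<in> L m" "t [^] i \<otimes> p \<ominus> b \<in> Q i m"
      unfolding lead_def mi by blast
    have bc: "b \<in> carrier R" using idealD(1)[OF graded_subD(1)[OF L] b(1)] .
    have "a \<ominus> b = q \<oplus> (t [^] i \<otimes> p \<ominus> b)" using c bc qp(3) by (simp add: a_minus_def a_assoc)
    then have "a \<ominus> b \<in> Q i m" using idealD(3)[OF Q_ideal qp(1) b(2)] by simp
    moreover have "a \<ominus> b \<in> L' m" using idealD(5)[OF graded_subD(1)[OF L'] Suc.prems(2)] b(1) sub by blast
    ultimately have "a \<ominus> b \<in> L m" using Suc.IH Suc.prems(1) by simp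
    then have "(a \<ominus> b) \<oplus> b \<in> L m" using idealD(3)[OF graded_subD(1)[OF L]] b(1) by blast
    then show ?case using minus_add_cancel c bc by simp
  qed
  then have "L' m \<subseteq> L m" for m using graded_subD(2)[OF L'] unfolding P'_def by blast
  then show ?thesis using sub by (intro ext) blast
qed

text \<open>The leading coefficients form a family that increases in both indices. Its diagonal
  stabilises at some \<open>j0\<close>, which settles all degrees from \<open>j0\<close> on; the
  finitely many smaller degrees stabilise one by one.\<close>

lemma graded_acc_step:
  assumes acc: "graded_acc P E"
  shows "graded_acc P' (insert t E)"
  unfolding graded_acc_def
proof (intro allI impI)
  fix Ls :: "nat \<Rightarrow> nat \<Rightarrow> 'a set"
  assume L': "\<forall>j. graded_sub P' (insert t E) (Ls j)" and inc: "\<forall>j n. Ls j n \<subseteq> Ls (Suc j) n"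
  have L: "\<And>j. graded_sub P' (insert t E) (Ls j)" using L' by blast
  define K where "K j i = lead (Ls j) i" for j i
  have Kg: "graded_sub P E (K j i)" for j i unfolding K_def by (rule lead_graded_sub[OF L])
  have Lmono: "Ls j n \<subseteq> Ls k n" if "j \<le> k" for j k n
    by (rule lift_Suc_mono_le[of "\<lambda>j. Ls j n", OF _ that]) (use inc in blast)
  have Kj: "K j i n \<subseteq> K k i n" if "j \<le> k" for j k i n
    unfolding K_def by (rule lead_mono, rule Lmono[OF that])
  have Ki: "K j i n \<subseteq> K j k n" if "i \<le> k" for j i k n
    unfolding K_def by (rule lift_Suc_mono_le[of "\<lambda>i. lead (Ls j) i n", OF _ that]) (rule lead_Suc[OF L])
  have stab: "\<exists>j0. \<forall>j\<ge>j0. H j = H j0"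
    if "\<And>j. graded_sub P E (H j)" "\<And>j n. H j n \<subseteq> H (Suc j) n" for H :: "nat \<Rightarrow> nat \<Rightarrow> 'a set"
    using acc that unfolding graded_acc_def by blast
  have "\<exists>j0. \<forall>j\<ge>j0. K j j = K j0 j0"
  proof (rule stab[OF Kg])
    fix j n
    show "K j j n \<subseteq> K (Suc j) (Suc j) n" using Kj[of j "Suc j" j n] Ki[of j "Suc j" "Suc j" n] by simp
  qed
  then obtain j0 where j0: "\<And>j. j0 \<le> j \<Longrightarrow> K j j = K j0 j0" by blast
  have big: "K j i = K j0 j0" if "j0 \<le> j" "j0 \<le> i" for j i
  proof (rule ext)
    fix n
    have "K j i n \<subseteq> K (max i j) (max i j) n" using Kj[of j "max i j" i n] Ki[of i "max i j" "max i j" n] by simp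
    also have "\<dots> = K j0 j0 n" using j0[of "max i j"] that by simp
    finally have "K j i n \<subseteq> K j0 j0 n" .
    moreover have "K j0 j0 n \<subseteq> K j i n" using Kj[OF that(1), of j0 n] Ki[OF that(2), of j n] by simp
    ultimately show "K j i n = K j0 j0 n" by simp
  qed
  have "\<forall>i. \<exists>k. \<forall>j\<ge>k. K j i = K k i"
  proof
    fix i
    show "\<exists>k. \<forall>j\<ge>k. K j i = K k i" by (rule stab[OF Kg]) (rule Kj, simp)
  qed
  then obtain k where k: "\<And>i j. k i \<le> j \<Longrightarrow> K j i = K (k i) i" by metis
  define N where "N = Max (insert j0 (k ` {..<j0}))"
  have N: "j0 \<le> N" "\<And>i. i < j0 \<Longrightarrow> k i \<le> N" unfolding N_def by auto
  have "Ls j = Ls N" if "N \<le> j" for j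
  proof (rule sym, rule lead_eq_imp[OF L L])
    show "Ls N n \<subseteq> Ls j n" for n by (rule Lmono[OF that])
    fix i n
    have "K N i = K j i"
    proof (cases "i < j0")
      case True
      have "K j i = K (k i) i" by (rule k) (use N(2)[OF True] that in simp)
      moreover have "K N i = K (k i) i" by (rule k, rule N(2)[OF True])
      ultimately show ?thesis by simp
    next
      case False
      then show ?thesis using big[of N i] big[of j i] N that by simp
    qed
    then show "lead (Ls N) i n = lead (Ls j) i n" by (simp add: K_def)
  qed
  then show "\<exists>j0. \<forall>j\<ge>j0. Ls j = Ls j0" by blast
qed

end

context noeth_cring
begin

text \<open>For empty \<open>E\<close>, R placed in degree 0 works, with the chain condition of R
  itself. The elements of \<open>E\<close> are then adjoined one at a time. All components are
  ideals of R, so no polynomial ring in several variables appears.\<close>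

lemma graded_acc_exists:
  assumes "finite E" "E \<subseteq> carrier R"
  shows "\<exists>P. graded_acc P E \<and> (\<forall>n. ideal (P n) R) \<and> P 0 = carrier R \<and> (\<forall>e\<in>E. \<forall>n. \<forall>a\<in>P n. e \<otimes> a \<in> P (Suc n))"
  using assms
proof (induction E rule: finite_induct)
  case empty
  define P where "P n = (if n = 0 then carrier R else {\<zero>})" for n :: nat
  have "graded_acc P {}"
    unfolding graded_acc_def
  proof (intro allI impI)
    fix Ls :: "nat \<Rightarrow> nat \<Rightarrow> 'a set"
    assume L: "\<forall>j. graded_sub P {} (Ls j)" and inc: "\<forall>j n. Ls j n \<subseteq> Ls (Suc j) n"
    have Li: "ideal (Ls j n) R" for j n using L graded_subD(1) by blast
    have "\<exists>k. \<forall>j\<ge>k. Ls j 0 = Ls k 0" by (rule ideal_seq_stable[of "\<lambda>j. Ls j 0"]) (use Li inc in auto)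
    then obtain k where k: "\<And>j. k \<le> j \<Longrightarrow> Ls j 0 = Ls k 0" by blast
    have z: "Ls j n = {\<zero>}" if "n \<noteq> 0" for j n
    proof -
      have "Ls j n \<subseteq> P n" using L graded_subD(2) by blast
      then show ?thesis using idealD(2)[OF Li[of j n]] that by (auto simp: P_def)
    qed
    have "Ls j = Ls k" if "k \<le> j" for j
    proof (rule ext)
      show "Ls j n = Ls k n" for n using k[OF that] z[of n j] z[of n k] by (cases "n = 0") auto
    qed
    then show "\<exists>j0. \<forall>j\<ge>j0. Ls j = Ls j0" by blast
  qed
  moreover have "ideal (P n) R" for n using oneideal zeroideal by (simp add: P_def)
  moreover have "P 0 = carrier R" by (simp add: P_def)
  ultimately show ?case by blast
next
  case (insert t E)
  then obtain P where P: "graded_acc P E" "\<And>n. ideal (P n) R" "P 0 = carrier R"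
    "\<And>e n a. e \<in> E \<Longrightarrow> a \<in> P n \<Longrightarrow> e \<otimes> a \<in> P (Suc n)" by auto
  have tE: "t \<in> carrier R" "E \<subseteq> carrier R" using insert.prems by auto
  interpret S: poly_step R P E t 
    by (intro poly_step.intro poly_step_axioms.intro cring_axioms P(2) tE) (rule P(4))
  have "S.P' 0 = carrier R"
  proof
    show "S.P' 0 \<subseteq> carrier R" using ideal_subset[OF S.P'_ideal] .
    show "carrier R \<subseteq> S.P' 0"
    proof
      fix a assume a: "a \<in> carrier R"
      then have "a = \<zero> \<oplus> t [^] (0::nat) \<otimes> a" by simp
      moreover have "\<zero> \<oplus> t [^] (0::nat) \<otimes> a \<in> Qf P t (Suc 0) 0" by (rule S.Q_SucI) (use a P(3) in simp_all)
      ultimately show "a \<in> S.P' 0" unfolding S.P'_def by simp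
    qed
  qed
  moreover have "\<forall>e\<in>insert t E. \<forall>n. \<forall>a\<in>S.P' n. e \<otimes> a \<in> S.P' (Suc n)" using S.P'_E by blast
  ultimately show ?case using S.graded_acc_step[OF P(1)] S.P'_ideal by (intro exI[of _ "S.P'"]) simp
qed

text \<open>If \<open>E\<close> generates \<open>M\<close>, the components built from
  \<open>E\<close> contain all powers of \<open>M\<close>, so a graded submodule of the Rees algebra
  is also one of \<open>P\<close>.\<close>

lemma rees_acc:
  assumes M: "ideal M R"
  shows "graded_acc (ideal_pow R M) M"
proof -
  obtain E where E: "E \<subseteq> carrier R" "finite E" "M = Idl E" using finetely_gen[OF M] by auto
  obtain P where P: "graded_acc P E" "\<And>n. ideal (P n) R" "P 0 = carrier R"
    "\<And>e n a. e \<in> E \<Longrightarrow> a \<in> P n \<Longrightarrow> e \<otimes> a \<in> P (Suc n)" using graded_acc_exists[OF E(2,1)] by blast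
  have "ideal_pow R M n \<subseteq> P n" for n
  proof (induction n)
    case (Suc n)
    have T: "ideal {m \<in> carrier R. \<forall>a\<in>P n. m \<otimes> a \<in> P (Suc n)} R"
    proof (rule idealI')
      note d = idealD[OF P(2)[of "Suc n"]] and c = idealD(1)[OF P(2)[of n]]
      show "\<zero> \<in> {m \<in> carrier R. \<forall>a\<in>P n. m \<otimes> a \<in> P (Suc n)}" using d(2) c by simp
      show "a \<oplus> b \<in> {m \<in> carrier R. \<forall>a\<in>P n. m \<otimes> a \<in> P (Suc n)}"
        if "a \<in> {m \<in> carrier R. \<forall>a\<in>P n. m \<otimes> a \<in> P (Suc n)}" "b \<in> {m \<in> carrier R. \<forall>a\<in>P n. m \<otimes> a \<in> P (Suc n)}" for a b
        using that d(3) c by (simp add: l_distr)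
      show "r \<otimes> a \<in> {m \<in> carrier R. \<forall>a\<in>P n. m \<otimes> a \<in> P (Suc n)}"
        if "r \<in> carrier R" "a \<in> {m \<in> carrier R. \<forall>a\<in>P n. m \<otimes> a \<in> P (Suc n)}" for r a
        using that d(6) c by (simp add: m_assoc)
    qed auto
    have "E \<subseteq> {m \<in> carrier R. \<forall>a\<in>P n. m \<otimes> a \<in> P (Suc n)}" using E(1) P(4) by blast
    then have MT: "M \<subseteq> {m \<in> carrier R. \<forall>a\<in>P n. m \<otimes> a \<in> P (Suc n)}"
      unfolding E(3) by (rule genideal_minimal[OF T])
    have "\<forall>h\<in>M. \<forall>k\<in>ideal_pow R M n. h \<otimes> k \<in> P (Suc n)" using MT Suc by blast
    then show ?case unfolding ideal_pow_Suc[OF M] using prod_subset_iff[OF M ideal_pow_ideal[OF M] P(2)] by simp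
  qed (simp add: P)
  then have "graded_sub (ideal_pow R M) M L \<Longrightarrow> graded_sub P E L" for L
    using genideal_self[OF E(1)] E(3) unfolding graded_sub_def by blast
  then show ?thesis using P(1) unfolding graded_acc_def by blast
qed

text \<open>The submodules \<open>K j\<close> generated by the components of \<open>L\<close> up to
  degree j increase towards \<open>L\<close>. They stabilise, so \<open>L\<close> is generated in
  bounded degrees; this is the Artin-Rees property.\<close>

lemma rees_stable:
  assumes M: "ideal M R" and L: "graded_sub (ideal_pow R M) M L"
  shows "\<exists>k. \<forall>n\<ge>k. L n = ideal_pow R M (n - k) \<cdot> L k"
proof -
  have Li: "\<And>n. ideal (L n) R" by (rule graded_subD(1)[OF L])
  have I: "\<And>n. ideal (ideal_pow R M n) R" using ideal_pow_ideal[OF M] .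
  define K where "K j n = (if n \<le> j then L n else ideal_pow R M (n - j) \<cdot> L j)" for j n :: nat
  have Ki: "ideal (K j n) R" for j n unfolding K_def using Li ideal_prod_is_ideal[OF I Li] by simp
  have mulL: "M \<cdot> L n \<subseteq> L (Suc n)" for n
    using prod_subset_iff[OF M Li Li] graded_subD(3)[OF L] by blast
  have powL: "ideal_pow R M i \<cdot> L j \<subseteq> L (i + j)" for i j
  proof (induction i)
    case 0
    have "carrier R \<cdot> L j = L j" using ideal_prod_commute[OF oneideal Li] ideal_prod_one[OF Li] by simp
    then show ?case by simp
  next
    case (Suc i)
    have "ideal_pow R M (Suc i) \<cdot> L j = M \<cdot> (ideal_pow R M i \<cdot> L j)"
      unfolding ideal_pow_Suc[OF M] by (rule ideal_prod_assoc[OF M I Li])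
    also have "\<dots> \<subseteq> M \<cdot> L (i + j)" by (rule prod_mono[OF M ideal_prod_is_ideal[OF I Li] M Li order_refl Suc])
    also have "\<dots> \<subseteq> L (Suc i + j)" using mulL by simp
    finally show ?case .
  qed
  have KL: "K j n \<subseteq> L n" for j n unfolding K_def using powL[of "n - j" j] by auto
  have Kstep: "e \<otimes> a \<in> K j (Suc n)" if "e \<in> M" "a \<in> K j n" for e a j n
  proof (cases "n < j")
    case True
    then show ?thesis using graded_subD(3)[OF L that(1)] that(2) by (simp add: K_def)
  next
    case False
    have "ideal_pow R M (n - j) \<cdot> L j = L j" if "n = j"
      using that ideal_prod_commute[OF oneideal Li] ideal_prod_one[OF Li] by simp
    then have "a \<in> ideal_pow R M (n - j) \<cdot> L j" using that(2) False by (cases "n = j") (auto simp: K_def)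
    then have "e \<otimes> a \<in> M \<cdot> (ideal_pow R M (n - j) \<cdot> L j)" using that(1) by (rule ideal_prod.prod[rotated])
    also have "\<dots> = ideal_pow R M (Suc n - j) \<cdot> L j"
      using False ideal_prod_assoc[OF M I Li] ideal_pow_Suc[OF M, of "n - j"] by (simp add: Suc_diff_le)
    finally show ?thesis using False by (simp add: K_def)
  qed
  have Kg: "graded_sub (ideal_pow R M) M (K j)" for j
    unfolding graded_sub_def using Ki KL graded_subD(2)[OF L] Kstep by blast
  have "K j n \<subseteq> K (Suc j) n" for j n
  proof (cases "n \<le> Suc j")
    case True
    then have "K (Suc j) n = L n" by (simp add: K_def)
    then show ?thesis using KL by simp
  next
    case False
    then have eq: "n - j = Suc (n - Suc j)" by simp
    have "ideal_pow R M (n - j) = ideal_pow R M (n - Suc j) \<cdot> M"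
      using ideal_pow_add[OF M, of "n - Suc j" "Suc 0"] ideal_pow_1[OF M] eq by simp
    then have "ideal_pow R M (n - j) \<cdot> L j = ideal_pow R M (n - Suc j) \<cdot> (M \<cdot> L j)"
      using ideal_prod_assoc[OF I M Li] by simp
    also have "\<dots> \<subseteq> ideal_pow R M (n - Suc j) \<cdot> L (Suc j)"
      by (rule prod_mono[OF I ideal_prod_is_ideal[OF M Li] I Li order_refl mulL])
    finally show ?thesis using False by (simp add: K_def)
  qed
  then obtain k where k: "\<And>j. k \<le> j \<Longrightarrow> K j = K k"
    using rees_acc[OF M] Kg unfolding graded_acc_def by blast
  have "L n = ideal_pow R M (n - k) \<cdot> L k" if "k \<le> n" for n
  proof -
    have "L n = K n n" by (simp add: K_def)
    also have "\<dots> = K k n" using k[OF that] by simp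
    also have "\<dots> = ideal_pow R M (n - k) \<cdot> L k"
      using that ideal_prod_commute[OF oneideal Li] ideal_prod_one[OF Li] by (cases "n = k") (auto simp: K_def)
    finally show ?thesis .
  qed
  then show ?thesis by blast
qed

end

section \<open>Homogeneous prime avoidance and superficial elements\<close>

locale rel_local = noeth_local R M for R (structure) and M +
  fixes I
  assumes I: "ideal I R"
begin

text \<open>The preimage in R of the n-th power of the maximal ideal of R/I. Working with preimages
  lets \<open>I\<close> be enlarged without iterated quotients.\<close>

definition F :: "nat \<Rightarrow> 'a set" where "F n = ideal_pow R M n <+> I"

lemma F_ideal: "ideal (F n) R" unfolding F_def by (rule add_ideals[OF pow_ideal I])

lemma I_F: "I \<subseteq> F n" and pow_F: "ideal_pow R M n \<subseteq> F n"
  unfolding F_def using sum_upper[OF pow_ideal I] by auto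

lemma F_carrier: "a \<in> F n \<Longrightarrow> a \<in> carrier R"
  by (rule idealD(1)[OF F_ideal])

lemma F_cases:
  assumes "a \<in> F n"
  obtains b i where "b \<in> ideal_pow R M n" "i \<in> I" "a = b \<oplus> i"
  using assms unfolding F_def mem_sum_iff by blast

lemma FI: "b \<in> ideal_pow R M n \<Longrightarrow> i \<in> I \<Longrightarrow> b \<oplus> i \<in> F n"
  unfolding F_def mem_sum_iff by blast

lemma F_antimono: "m \<le> n \<Longrightarrow> F n \<subseteq> F m"
  unfolding F_def by (rule sum_mono[OF ideal_pow_antimono[OF M_ideal] order_refl])

lemma F_0: "F 0 = carrier R"
  using pow_F[of 0] ideal_subset[OF F_ideal] by auto

lemma F_mult:
  assumes a: "a \<in> F p" and b: "b \<in> F q"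
  shows "a \<otimes> b \<in> F (p + q)"
proof -
  obtain a' i where a': "a' \<in> ideal_pow R M p" "i \<in> I" "a = a' \<oplus> i" using F_cases[OF a] .
  obtain b' j where b': "b' \<in> ideal_pow R M q" "j \<in> I" "b = b' \<oplus> j" using F_cases[OF b] .
  have c: "a' \<in> carrier R" "b' \<in> carrier R" "i \<in> carrier R" "j \<in> carrier R" "b \<in> carrier R"
    using idealD(1)[OF pow_ideal a'(1)] idealD(1)[OF pow_ideal b'(1)] idealD(1)[OF I a'(2)] idealD(1)[OF I b'(2)] F_carrier[OF b]
    by auto
  have "a \<otimes> b = a' \<otimes> b' \<oplus> (a' \<otimes> j \<oplus> i \<otimes> b)"
    using c a'(3) b'(3) by (simp add: l_distr r_distr a_ac)
  moreover have "a' \<otimes> b' \<in> ideal_pow R M (p + q)" by (rule ideal_pow_mult_mem[OF M_ideal a'(1) b'(1)])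
  moreover have "a' \<otimes> j \<oplus> i \<otimes> b \<in> I" using idealD(3,6,7)[OF I] a' b' c by simp
  ultimately show ?thesis using FI by simp
qed

text \<open>\<open>L\<close> represents a homogeneous ideal of the Rees algebra \<open>\<Oplus>\<^sub>n F n\<close> that contains \<open>I\<close> in every degree;
  \<open>colon\<close> and \<open>adjoin\<close> below are \<open>L : u\<close> and \<open>L + (u)\<close> for \<open>u\<close> homogeneous of degree \<open>k\<close>.\<close>

definition graded_rel :: "(nat \<Rightarrow> 'a set) \<Rightarrow> bool" where
  "graded_rel L \<longleftrightarrow> (\<forall>n. ideal (L n) R \<and> I \<subseteq> L n \<and> L n \<subseteq> F n \<and> (\<forall>m\<in>M. \<forall>a\<in>L n. m \<otimes> a \<in> L (Suc n)))"

lemma graded_relD: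
  assumes "graded_rel L"
  shows "ideal (L n) R" "I \<subseteq> L n" "L n \<subseteq> F n" "m \<in> M \<Longrightarrow> a \<in> L n \<Longrightarrow> m \<otimes> a \<in> L (Suc n)"
  using assms unfolding graded_rel_def by blast+

lemma graded_rel_pow:
  assumes L: "graded_rel L"
  shows "b \<in> ideal_pow R M s \<Longrightarrow> a \<in> L n \<Longrightarrow> b \<otimes> a \<in> L (s + n)"
proof -
  assume b: "b \<in> ideal_pow R M s" and a: "a \<in> L n"
  have "ideal_pow R M s \<cdot> L n \<subseteq> L (s + n)" for s
  proof (induction s)
    case 0
    have "carrier R \<cdot> L n = L n"
      using ideal_prod_commute[OF oneideal graded_relD(1)[OF L]] ideal_prod_one[OF graded_relD(1)[OF L]] by simp
    then show ?case by simp
  next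
    case (Suc s)
    have "ideal_pow R M (Suc s) \<cdot> L n = M \<cdot> (ideal_pow R M s \<cdot> L n)"
      unfolding ideal_pow_Suc[OF M_ideal] by (rule ideal_prod_assoc[OF M_ideal pow_ideal graded_relD(1)[OF L]])
    also have "\<dots> \<subseteq> M \<cdot> L (s + n)"
      by (rule prod_mono[OF M_ideal ideal_prod_is_ideal[OF pow_ideal graded_relD(1)[OF L]] M_ideal graded_relD(1)[OF L] order_refl Suc])
    also have "\<dots> \<subseteq> L (Suc s + n)"
      using prod_subset_iff[OF M_ideal graded_relD(1)[OF L] graded_relD(1)[OF L], of "s + n" "Suc s + n"] graded_relD(4)[OF L] by simp
    finally show ?case .
  qed
  moreover have "b \<otimes> a \<in> ideal_pow R M s \<cdot> L n" using b a by (rule ideal_prod.prod)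
  ultimately show ?thesis by blast
qed

lemma graded_rel_F:
  assumes L: "graded_rel L" and z: "z \<in> F s" and a: "a \<in> L n"
  shows "z \<otimes> a \<in> L (s + n)"
proof -
  obtain b i where b: "b \<in> ideal_pow R M s" "i \<in> I" "z = b \<oplus> i" using F_cases[OF z] .
  have c: "b \<in> carrier R" "i \<in> carrier R" "a \<in> carrier R"
    using idealD(1)[OF pow_ideal b(1)] idealD(1)[OF I b(2)] idealD(1)[OF graded_relD(1)[OF L] a] by auto
  have "z \<otimes> a = b \<otimes> a \<oplus> i \<otimes> a" using c b(3) by (simp add: l_distr)
  moreover have "i \<otimes> a \<in> L (s + n)" using idealD(7)[OF I c(3) b(2)] graded_relD(2)[OF L] by blast
  ultimately show ?thesis using idealD(3)[OF graded_relD(1)[OF L] graded_rel_pow[OF L b(1) a]] by simp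
qed

text \<open>Modular law. Each component is recovered from its trace on the power of
  \<open>M\<close>, which reduces the chain condition over R/I to the Rees algebra of R.\<close>

lemma graded_rel_decomp:
  assumes L: "graded_rel L"
  shows "L n = (L n \<inter> ideal_pow R M n) <+> I"
proof
  show "L n \<subseteq> (L n \<inter> ideal_pow R M n) <+> I"
  proof
    fix a assume a: "a \<in> L n"
    then have "a \<in> F n" using graded_relD(3)[OF L] by blast
    then obtain b i where b: "b \<in> ideal_pow R M n" "i \<in> I" "a = b \<oplus> i" by (rule F_cases)
    have c: "b \<in> carrier R" "i \<in> carrier R" using idealD(1)[OF pow_ideal b(1)] idealD(1)[OF I b(2)] by auto
    have "i \<oplus> b \<in> L n" using a b(3) c by (simp add: a_comm)
    then have "b \<in> L n" using ideal_add_cancel[OF graded_relD(1)[OF L]] b(2) c graded_relD(2)[OF L] by blast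
    then show "a \<in> (L n \<inter> ideal_pow R M n) <+> I" unfolding mem_sum_iff using b by blast
  qed
  show "(L n \<inter> ideal_pow R M n) <+> I \<subseteq> L n"
    using sum_subset_iff[OF i_intersect[OF graded_relD(1)[OF L] pow_ideal] I graded_relD(1)[OF L]] graded_relD(2)[OF L] by simp
qed

lemma graded_rel_graded_sub:
  assumes L: "graded_rel L"
  shows "graded_sub (ideal_pow R M) M (\<lambda>n. L n \<inter> ideal_pow R M n)"
proof -
  have "m \<otimes> a \<in> ideal_pow R M (Suc n)" if "m \<in> M" "a \<in> ideal_pow R M n" for m a n
    unfolding ideal_pow_Suc[OF M_ideal] using that by (rule ideal_prod.prod)
  then show ?thesis
    unfolding graded_sub_def using i_intersect[OF graded_relD(1)[OF L] pow_ideal] graded_relD(4)[OF L] by blast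
qed

lemma graded_rel_acc:
  assumes L: "\<And>j::nat. graded_rel (Ls j)" and inc: "\<And>j. Ls j \<le> Ls (Suc j)"
  shows "\<exists>k. \<forall>j\<ge>k. Ls j = Ls k"
proof -
  have "\<exists>k. \<forall>j\<ge>k. (\<lambda>n. Ls j n \<inter> ideal_pow R M n) = (\<lambda>n. Ls k n \<inter> ideal_pow R M n)"
    using rees_acc[OF M_ideal, unfolded graded_acc_def, rule_format, of "\<lambda>j n. Ls j n \<inter> ideal_pow R M n"]
      graded_rel_graded_sub[OF L] inc by (auto simp: le_fun_def)
  then obtain k where k: "\<And>j. k \<le> j \<Longrightarrow> (\<lambda>n. Ls j n \<inter> ideal_pow R M n) = (\<lambda>n. Ls k n \<inter> ideal_pow R M n)" by blast
  have "Ls j = Ls k" if "k \<le> j" for j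
  proof (rule ext)
    fix n
    show "Ls j n = Ls k n"
      using graded_rel_decomp[OF L, of j n] graded_rel_decomp[OF L, of k n] fun_cong[OF k[OF that], of n] by simp
  qed
  then show ?thesis by blast
qed

text \<open>Oriented for noetherian induction: the larger ideal is the smaller element of the
  relation.\<close>

lemma graded_rel_wf: "wf {(L', L). graded_rel L \<and> graded_rel L' \<and> L < L'}"
  unfolding wf_iff_no_infinite_down_chain
proof
  assume "\<exists>f. \<forall>i. (f (Suc i), f i) \<in> {(L', L). graded_rel L \<and> graded_rel L' \<and> L < L'}"
  then obtain f where f: "\<And>i. graded_rel (f i) \<and> f i < f (Suc i)" by auto
  have "\<exists>k. \<forall>j\<ge>k. f j = f k" by (rule graded_rel_acc) (use f less_imp_le in blast)+
  then obtain k where k: "\<And>j. k \<le> j \<Longrightarrow> f j = f k" by blast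
  have "f (Suc k) = f k" by (rule k) simp
  then show False using f[of k] by simp
qed

definition colon :: "(nat \<Rightarrow> 'a set) \<Rightarrow> 'a \<Rightarrow> nat \<Rightarrow> nat \<Rightarrow> 'a set" where
  "colon L u k n = {g \<in> F n. g \<otimes> u \<in> L (n + k)}"

lemma colon_graded_rel:
  assumes L: "graded_rel L" and u: "u \<in> F k"
  shows "graded_rel (colon L u k)"
  unfolding graded_rel_def
proof (intro allI conjI ballI)
  fix n
  have uc: "u \<in> carrier R" using F_carrier[OF u] .
  note Fd = idealD[OF F_ideal] and Ld = idealD[OF graded_relD(1)[OF L]]
  show "ideal (colon L u k n) R"
  proof (rule idealI')
    show "colon L u k n \<subseteq> carrier R" unfolding colon_def using Fd(1) by blast
    show "\<zero> \<in> colon L u k n" unfolding colon_def using Fd(2) Ld(2) uc by simp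
    show "a \<oplus> b \<in> colon L u k n" if "a \<in> colon L u k n" "b \<in> colon L u k n" for a b
    proof -
      have ab: "a \<in> F n" "b \<in> F n" "a \<otimes> u \<in> L (n + k)" "b \<otimes> u \<in> L (n + k)" using that by (auto simp: colon_def)
      have "(a \<oplus> b) \<otimes> u = a \<otimes> u \<oplus> b \<otimes> u" using F_carrier[OF ab(1)] F_carrier[OF ab(2)] uc by (simp add: l_distr)
      then show ?thesis unfolding colon_def using Fd(3)[OF ab(1,2)] Ld(3)[OF ab(3,4)] by simp
    qed
    show "r \<otimes> a \<in> colon L u k n" if "r \<in> carrier R" "a \<in> colon L u k n" for r a
    proof -
      have ab: "a \<in> F n" "a \<otimes> u \<in> L (n + k)" using that by (auto simp: colon_def)
      have "(r \<otimes> a) \<otimes> u = r \<otimes> (a \<otimes> u)" using F_carrier[OF ab(1)] that(1) uc by (simp add: m_assoc)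
      then show ?thesis unfolding colon_def using Fd(6)[OF that(1) ab(1)] Ld(6)[OF that(1) ab(2)] by simp
    qed
  qed
  show "I \<subseteq> colon L u k n"
  proof
    fix i assume i: "i \<in> I"
    have "i \<otimes> u \<in> I" by (rule idealD(7)[OF I uc i])
    then show "i \<in> colon L u k n" unfolding colon_def using i I_F graded_relD(2)[OF L] by blast
  qed
  show "colon L u k n \<subseteq> F n" unfolding colon_def by blast
  fix m a assume m: "m \<in> M" and "a \<in> colon L u k n"
  then have a: "a \<in> F n" "a \<otimes> u \<in> L (n + k)" by (auto simp: colon_def)
  have mc: "m \<in> carrier R" using idealD(1)[OF M_ideal m] .
  have "(m \<otimes> a) \<otimes> u = m \<otimes> (a \<otimes> u)" using mc F_carrier[OF a(1)] uc by (simp add: m_assoc)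
  moreover have "m \<otimes> (a \<otimes> u) \<in> L (Suc n + k)" using graded_relD(4)[OF L m a(2)] by simp
  moreover have "m \<in> F (Suc 0)" using m pow_F[of "Suc 0"] ideal_pow_1[OF M_ideal] by blast
  then have "m \<otimes> a \<in> F (Suc n)" using F_mult[OF _ a(1)] by fastforce
  ultimately show "m \<otimes> a \<in> colon L u k (Suc n)" unfolding colon_def by simp
qed

text \<open>A homogeneous prime of the Rees algebra of R/I that does not contain the irrelevant
  ideal, expressed by degree 1, where that ideal is generated. Only such primes can be avoided in
  positive degree.\<close>

definition graded_prime :: "(nat \<Rightarrow> 'a set) \<Rightarrow> bool" where
  "graded_prime P \<longleftrightarrow> graded_rel P \<and> P 1 \<noteq> F 1 \<and>
    (\<forall>p q. \<forall>a\<in>F p. \<forall>b\<in>F q. a \<otimes> b \<in> P (p + q) \<longrightarrow> a \<in> P p \<or> b \<in> P q)"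

text \<open>Modulo \<open>I\<close> the Rees algebra is generated in degree 1. A colon ideal that is
  full in degree 1 therefore imposes no condition on elements of positive degree.\<close>

lemma full_from_1:
  assumes P: "graded_rel P" and 1: "P 1 = F 1" and n: "1 \<le> n"
  shows "P n = F n"
  using n
proof (induction n rule: nat_induct_at_least)
  case base
  show ?case by (rule 1)
next
  case (Suc n)
  have "\<forall>h\<in>M. \<forall>k\<in>ideal_pow R M n. h \<otimes> k \<in> P (Suc n)"
    using graded_relD(4)[OF P] pow_F[of n] Suc.IH by blast
  then have "ideal_pow R M (Suc n) \<subseteq> P (Suc n)"
    unfolding ideal_pow_Suc[OF M_ideal] using prod_subset_iff[OF M_ideal pow_ideal graded_relD(1)[OF P]] by simp
  then have "F (Suc n) \<subseteq> P (Suc n)"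
    unfolding F_def using sum_subset_iff[OF pow_ideal I graded_relD(1)[OF P]] graded_relD(2)[OF P] by simp
  then show ?case using graded_relD(3)[OF P, of "Suc n"] by blast
qed

definition adjoin :: "(nat \<Rightarrow> 'a set) \<Rightarrow> 'a \<Rightarrow> nat \<Rightarrow> nat \<Rightarrow> 'a set" where
  "adjoin L u k n = (if k \<le> n then L n <+> (\<lambda>g. u \<otimes> g) ` F (n - k) else L n)"

lemma adjoin_graded_rel:
  assumes L: "graded_rel L" and u: "u \<in> F k"
  shows "graded_rel (adjoin L u k)" "L \<le> adjoin L u k" "u \<in> adjoin L u k k"
proof -
  have uc: "u \<in> carrier R" using F_carrier[OF u] .
  have Ui: "ideal ((\<lambda>g. u \<otimes> g) ` F j) R" for j by (rule image_mult_ideal[OF F_ideal uc])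
  have Li: "ideal (L n) R" for n by (rule graded_relD(1)[OF L])
  have up: "L n \<subseteq> adjoin L u k n" for n unfolding adjoin_def using sum_upper(1)[OF Li Ui] by simp
  then show "L \<le> adjoin L u k" by (simp add: le_fun_def)
  have "u = \<zero> \<oplus> u \<otimes> \<one>" using uc by simp
  moreover have "\<one> \<in> F (k - k)" using F_0 by simp
  ultimately have "u \<in> L k <+> (\<lambda>g. u \<otimes> g) ` F (k - k)"
    unfolding mem_sum_iff using idealD(2)[OF Li[of k]] by blast
  then show "u \<in> adjoin L u k k" unfolding adjoin_def by simp
  show "graded_rel (adjoin L u k)"
    unfolding graded_rel_def
  proof (intro allI conjI ballI)
    fix n
    show "ideal (adjoin L u k n) R" unfolding adjoin_def using Li add_ideals[OF Li Ui] by simp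
    show "I \<subseteq> adjoin L u k n" using up graded_relD(2)[OF L] by blast
    show "adjoin L u k n \<subseteq> F n"
    proof (cases "k \<le> n")
      case True
      have "(\<lambda>g. u \<otimes> g) ` F (n - k) \<subseteq> F n"
      proof
        fix y assume "y \<in> (\<lambda>g. u \<otimes> g) ` F (n - k)"
        then obtain g where "g \<in> F (n - k)" "y = u \<otimes> g" by blast
        then show "y \<in> F n" using F_mult[OF u, of g "n - k"] True by simp
      qed
      then show ?thesis unfolding adjoin_def using True sum_subset_iff[OF Li Ui F_ideal] graded_relD(3)[OF L] by simp
    next
      case False
      then show ?thesis unfolding adjoin_def using graded_relD(3)[OF L] by simp
    qed
    fix m a assume m: "m \<in> M" and a: "a \<in> adjoin L u k n"
    have mc: "m \<in> carrier R" using idealD(1)[OF M_ideal m] .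
    show "m \<otimes> a \<in> adjoin L u k (Suc n)"
    proof (cases "k \<le> n")
      case True
      then obtain l g where lg: "l \<in> L n" "g \<in> F (n - k)" "a = l \<oplus> u \<otimes> g" using a by (auto simp: adjoin_def mem_sum_iff)
      have "m \<otimes> a = m \<otimes> l \<oplus> u \<otimes> (m \<otimes> g)"
        using mc uc idealD(1)[OF Li lg(1)] F_carrier[OF lg(2)] lg(3) by (simp add: r_distr m_lcomm)
      moreover have "m \<in> F (Suc 0)" using m pow_F[of "Suc 0"] ideal_pow_1[OF M_ideal] by blast
      then have "m \<otimes> g \<in> F (Suc n - k)" using F_mult[OF _ lg(2), of m "Suc 0"] True by (simp add: Suc_diff_le)
      ultimately have "m \<otimes> a \<in> L (Suc n) <+> (\<lambda>g. u \<otimes> g) ` F (Suc n - k)"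
        unfolding mem_sum_iff using graded_relD(4)[OF L m lg(1)] by blast
      then show ?thesis using True by (simp add: adjoin_def)
    next
      case False
      then have "m \<otimes> a \<in> L (Suc n)" using a graded_relD(4)[OF L m] by (simp add: adjoin_def)
      then show ?thesis using up by blast
    qed
  qed
qed

lemma max_colon:
  assumes L: "graded_rel L" and ne: "L \<noteq> F"
  shows "\<exists>u k. u \<in> F k \<and> u \<notin> L k \<and> (\<forall>v j. v \<in> F j \<longrightarrow> v \<notin> L j \<longrightarrow> colon L u k \<le> colon L v j \<longrightarrow> colon L v j = colon L u k)"
proof -
  let ?C = "{colon L u k |u k. u \<in> F k \<and> u \<notin> L k}"
  obtain n where "L n \<noteq> F n" using ne by blast
  then obtain u where "u \<in> F n" "u \<notin> L n" using graded_relD(3)[OF L, of n] by blast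
  then have "colon L u n \<in> ?C" by blast
  then obtain P where P: "P \<in> ?C" "\<And>y. (y, P) \<in> {(L', L). graded_rel L \<and> graded_rel L' \<and> L < L'} \<Longrightarrow> y \<notin> ?C"
    using wfE_min[OF graded_rel_wf, of "colon L u n" ?C] by blast
  then obtain u k where uk: "P = colon L u k" "u \<in> F k" "u \<notin> L k" by blast
  have "colon L v j = P" if "v \<in> F j" "v \<notin> L j" "P \<le> colon L v j" for v j
  proof (rule ccontr)
    assume "colon L v j \<noteq> P"
    then have "P < colon L v j" using that(3) by (simp add: order.strict_iff_order)
    then have "(colon L v j, P) \<in> {(L', L). graded_rel L \<and> graded_rel L' \<and> L < L'}"
      using colon_graded_rel[OF L] uk that by simp
    then have "colon L v j \<notin> ?C" by (rule P(2))
    then show False using that by blast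
  qed
  then show ?thesis using uk by blast
qed

text \<open>An annihilator that is maximal among those of nonzero classes is prime: if b u is
  nonzero modulo \<open>L\<close>, its annihilator contains that of u, hence equals it, and a
  annihilates b u.\<close>

lemma colon_prime:
  assumes L: "graded_rel L" and u: "u \<in> F k" "u \<notin> L k"
    and max: "\<And>v j. v \<in> F j \<Longrightarrow> v \<notin> L j \<Longrightarrow> colon L u k \<le> colon L v j \<Longrightarrow> colon L v j = colon L u k"
    and a: "a \<in> F p" and b: "b \<in> F q" and ab: "a \<otimes> b \<in> colon L u k (p + q)"
  shows "a \<in> colon L u k p \<or> b \<in> colon L u k q"
proof (rule disjCI)
  assume nb: "b \<notin> colon L u k q"
  have c: "a \<in> carrier R" "b \<in> carrier R" "u \<in> carrier R" using F_carrier a b u(1) by auto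
  have v: "b \<otimes> u \<in> F (q + k)" "b \<otimes> u \<notin> L (q + k)" using F_mult[OF b u(1)] nb b by (auto simp: colon_def)
  have "colon L u k \<le> colon L (b \<otimes> u) (q + k)"
  proof (rule le_funI, rule subsetI)
    fix n g assume "g \<in> colon L u k n"
    then have g: "g \<in> F n" "g \<otimes> u \<in> L (n + k)" by (auto simp: colon_def)
    have "b \<otimes> (g \<otimes> u) \<in> L (q + (n + k))" by (rule graded_rel_F[OF L b g(2)])
    moreover have "b \<otimes> (g \<otimes> u) = g \<otimes> (b \<otimes> u)" using c F_carrier[OF g(1)] by (simp add: m_lcomm)
    ultimately show "g \<in> colon L (b \<otimes> u) (q + k) n" using g(1) by (simp add: colon_def add.left_commute)
  qed
  then have eq: "colon L (b \<otimes> u) (q + k) = colon L u k" by (rule max[OF v])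
  have "a \<otimes> (b \<otimes> u) \<in> L (p + (q + k))" using ab c by (simp add: colon_def m_assoc add.assoc)
  then have "a \<in> colon L (b \<otimes> u) (q + k) p" using a by (simp add: colon_def)
  then show "a \<in> colon L u k p" using eq by simp
qed

text \<open>Only finitely many graded primes have to be avoided in order to be a nonzerodivisor modulo \<open>L\<close> in
  large degrees; they are found along a prime filtration, by noetherian induction on \<open>L\<close>.\<close>

lemma finitely_many_primes:
  assumes "graded_rel L"
  shows "\<exists>PP. finite PP \<and> (\<forall>P\<in>PP. graded_prime P) \<and>
    (\<forall>s z. 1 \<le> s \<longrightarrow> z \<in> F s \<longrightarrow> (\<forall>P\<in>PP. z \<notin> P s) \<longrightarrow>
      (\<exists>n0. \<forall>n\<ge>n0. \<forall>a\<in>F n. z \<otimes> a \<in> L (n + s) \<longrightarrow> a \<in> L n))"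
  using assms
proof (induction L rule: wf_induct_rule[OF graded_rel_wf])
  case (1 L)
  note L = 1(2)
  show ?case
  proof (cases "L = F")
    case True
    then show ?thesis by (intro exI[of _ "{}"]) auto
  next
    case False
    obtain u k where u: "u \<in> F k" "u \<notin> L k"
      and mx: "\<And>v j. v \<in> F j \<Longrightarrow> v \<notin> L j \<Longrightarrow> colon L u k \<le> colon L v j \<Longrightarrow> colon L v j = colon L u k"
      using max_colon[OF L False] by blast
    define P where "P = colon L u k"
    have Pg: "graded_rel P" unfolding P_def by (rule colon_graded_rel[OF L u(1)])
    have Pp: "a \<in> P p \<or> b \<in> P q" if "a \<in> F p" "b \<in> F q" "a \<otimes> b \<in> P (p + q)" for a b p q
      using colon_prime[OF L u mx] that unfolding P_def by blast
    have uc: "u \<in> carrier R" using F_carrier[OF u(1)] .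
    note A = adjoin_graded_rel[OF L u(1)]
    have "L < adjoin L u k" using A(2,3) u(2) by (metis order.strict_iff_order)
    then obtain PP where PP: "finite PP" "\<And>P. P \<in> PP \<Longrightarrow> graded_prime P"
      "\<And>s z. 1 \<le> s \<Longrightarrow> z \<in> F s \<Longrightarrow> (\<forall>P\<in>PP. z \<notin> P s) \<Longrightarrow>
        (\<exists>n0. \<forall>n\<ge>n0. \<forall>a\<in>F n. z \<otimes> a \<in> adjoin L u k (n + s) \<longrightarrow> a \<in> adjoin L u k n)"
      using 1(1)[of "adjoin L u k"] L A(1) by blast
    \<comment> \<open>If the colon ideal is full in degree 1, it contains all positive degrees and
      cannot be avoided there; it is left out.\<close>
    define QQ where "QQ = (if P 1 = F 1 then PP else insert P PP)"
    have main: "\<exists>n0. \<forall>n\<ge>n0. \<forall>a\<in>F n. z \<otimes> a \<in> L (n + s) \<longrightarrow> a \<in> L n"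
      if s: "1 \<le> s" and z: "z \<in> F s" and av: "\<forall>P\<in>QQ. z \<notin> P s" for s z
    proof -
      have "\<forall>P\<in>PP. z \<notin> P s" using av by (auto simp: QQ_def split: if_splits)
      then obtain n0 where n0: "\<And>n a. n0 \<le> n \<Longrightarrow> a \<in> F n \<Longrightarrow> z \<otimes> a \<in> adjoin L u k (n + s) \<Longrightarrow> a \<in> adjoin L u k n"
        using PP(3)[OF s z] by blast
      \<comment> \<open>From \<open>Suc k\<close> on, the coefficient \<open>g\<close> of
        \<open>u\<close> has the positive degree n - k, where a full colon ideal contains it.
        Otherwise \<open>z\<close> is outside the prime \<open>P\<close>, and z g in
        \<open>P\<close> forces \<open>g\<close> into \<open>P\<close>.\<close>
      have "a \<in> L n" if n: "max n0 (Suc k) \<le> n" and a: "a \<in> F n" and za: "z \<otimes> a \<in> L (n + s)" for n a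
      proof -
        have "z \<otimes> a \<in> adjoin L u k (n + s)" using za A(2) unfolding le_fun_def by blast
        then have "a \<in> adjoin L u k n" using n0[of n a] n a by simp
        then obtain l g where lg: "l \<in> L n" "g \<in> F (n - k)" "a = l \<oplus> u \<otimes> g"
          using n by (auto simp: adjoin_def mem_sum_iff)
        have zc: "z \<in> carrier R" using F_carrier[OF z] .
        have c: "l \<in> carrier R" "g \<in> carrier R" using idealD(1)[OF graded_relD(1)[OF L] lg(1)] F_carrier[OF lg(2)] by auto
        have "z \<otimes> l \<in> L (s + n)" by (rule graded_rel_F[OF L z lg(1)])
        moreover have "z \<otimes> l \<oplus> (z \<otimes> g) \<otimes> u = z \<otimes> a" using zc c uc lg(3) by (simp add: r_distr m_ac)
        ultimately have zgu: "(z \<otimes> g) \<otimes> u \<in> L (n + s)"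
          using ideal_add_cancel[OF graded_relD(1)[OF L], of "z \<otimes> l" "n + s" "(z \<otimes> g) \<otimes> u"] za zc c uc by (simp add: add.commute)
        have "n + s = s + (n - k) + k" using n by simp
        then have "(z \<otimes> g) \<otimes> u \<in> L (s + (n - k) + k)" using zgu by metis
        then have zg: "z \<otimes> g \<in> P (s + (n - k))" unfolding P_def colon_def using F_mult[OF z lg(2)] by blast
        have "g \<in> P (n - k)"
        proof (cases "P 1 = F 1")
          case True
          have "1 \<le> n - k" using n by linarith
          then have "P (n - k) = F (n - k)" by (rule full_from_1[OF Pg True])
          then show ?thesis using lg(2) by simp
        next
          case False
          then have "z \<notin> P s" using av by (simp add: QQ_def)
          then show ?thesis using Pp[OF z lg(2) zg] by blast
        qed
        then have "g \<otimes> u \<in> L n" using n unfolding P_def colon_def by simp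
        then show ?thesis using idealD(3)[OF graded_relD(1)[OF L] lg(1)] lg(3) m_comm[OF c(2) uc] by simp
      qed
      then show ?thesis by blast
    qed
    have "finite QQ" using PP(1) by (simp add: QQ_def)
    moreover have "\<forall>P\<in>QQ. graded_prime P"
      using PP(2) Pg Pp unfolding QQ_def by (auto simp: graded_prime_def)
    ultimately show ?thesis using main by blast
  qed
qed

lemma graded_primeD:
  assumes "graded_prime P"
  shows "graded_rel P" "P 1 \<noteq> F 1" "a \<in> F p \<Longrightarrow> b \<in> F q \<Longrightarrow> a \<otimes> b \<in> P (p + q) \<Longrightarrow> a \<in> P p \<or> b \<in> P q"
  using assms unfolding graded_prime_def by blast+

lemma one_notin_graded_prime:
  assumes "graded_prime P"
  shows "\<one> \<notin> P 0"
proof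
  assume "\<one> \<in> P 0"
  note P = graded_primeD(1)[OF assms]
  have "\<forall>a\<in>F 1. a \<in> P 1"
  proof
    fix a assume a: "a \<in> F 1"
    have "a \<otimes> \<one> \<in> P (1 + 0)" by (rule graded_rel_F[OF P a \<open>\<one> \<in> P 0\<close>])
    then show "a \<in> P 1" using F_carrier[OF a] by simp
  qed
  then show False using graded_primeD(2)[OF assms] graded_relD(3)[OF P, of 1] by blast
qed

lemma F_pow: "a \<in> F s \<Longrightarrow> a [^] (t::nat) \<in> F (s * t)"
proof (induction t)
  case 0
  show ?case using F_0 by simp
next
  case (Suc t)
  then show ?case using F_mult[of "a [^] t" "s * t" a s] by (simp add: add.commute)
qed

lemma graded_prime_pow_notin:
  assumes P: "graded_prime P" and a: "a \<in> F s" "a \<notin> P s"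
  shows "a [^] (t::nat) \<notin> P (s * t)"
proof (induction t)
  case 0
  show ?case using one_notin_graded_prime[OF P] by simp
next
  case (Suc t)
  then show ?case using graded_primeD(3)[OF P F_pow[OF a(1), of t] a(1)] a(2) by (auto simp: add.commute)
qed

lemma graded_rel_pow_in:
  assumes P: "graded_rel P" and a: "a \<in> F s" "a \<in> P s" and t: "1 \<le> (t::nat)"
  shows "a [^] t \<in> P (s * t)"
proof -
  obtain u where u: "t = Suc u" using t by (cases t) auto
  have "a [^] u \<otimes> a \<in> P (s * u + s)" by (rule graded_rel_F[OF P F_pow[OF a(1)] a(2)])
  then show ?thesis using u by (simp add: add.commute)
qed

text \<open>Take one element in each \<open>Q\<close> but outside \<open>P0\<close> and multiply;
  primeness keeps the product outside \<open>P0\<close>. The degree \<open>t\<close> is positive as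
  soon as there is a factor, and it serves as an exponent in prime avoidance.\<close>

lemma prime_product:
  assumes P0: "graded_prime P0" and QQ: "finite QQ" "\<And>Q. Q \<in> QQ \<Longrightarrow> graded_rel Q"
    and z: "\<And>Q. Q \<in> QQ \<Longrightarrow> \<exists>s z. 1 \<le> s \<and> z \<in> F s \<and> z \<in> Q s \<and> z \<notin> P0 s"
  shows "\<exists>t b. b \<in> F t \<and> b \<notin> P0 t \<and> (\<forall>Q\<in>QQ. b \<in> Q t) \<and> (QQ \<noteq> {} \<longrightarrow> 1 \<le> t)"
  using QQ z
proof (induction QQ rule: finite_induct)
  case empty
  show ?case using F_0 one_notin_graded_prime[OF P0] by (intro exI[of _ 0] exI[of _ \<one>]) simp
next
  case (insert Q QQ)
  obtain t b where b: "b \<in> F t" "b \<notin> P0 t" "\<And>Q. Q \<in> QQ \<Longrightarrow> b \<in> Q t" using insert by blast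
  obtain s z where z: "1 \<le> s" "z \<in> F s" "z \<in> Q s" "z \<notin> P0 s" using insert.prems(2)[of Q] by blast
  have "b \<otimes> z \<in> F (t + s)" by (rule F_mult[OF b(1) z(2)])
  moreover have "b \<otimes> z \<notin> P0 (t + s)" using graded_primeD(3)[OF P0 b(1) z(2)] b(2) z(4) by blast
  moreover have gQ: "graded_rel Q'" if "Q' \<in> insert Q QQ" for Q' using insert.prems(1) that by blast
  moreover have "b \<otimes> z \<in> Q (t + s)" using graded_rel_F[OF gQ[of Q] b(1), of z s] z(3) by simp
  moreover have "b \<otimes> z \<in> Q' (t + s)" if "Q' \<in> QQ" for Q'
  proof -
    have "z \<otimes> b \<in> Q' (s + t)" using graded_rel_F[OF gQ[of Q'] z(2), of b t] b(3) that by simp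
    then show ?thesis using m_comm F_carrier[OF b(1)] F_carrier[OF z(2)] by (simp add: add.commute)
  qed
  ultimately show ?case using z(1) by (intro exI[of _ "t + s"] exI[of _ "b \<otimes> z"]) auto
qed

text \<open>Homogeneous prime avoidance: powers are taken so that the two summands have the same degree.\<close>

lemma prime_avoidance:
  assumes "finite PP" "\<And>P. P \<in> PP \<Longrightarrow> graded_prime P"
  shows "\<exists>s z. 1 \<le> s \<and> z \<in> F s \<and> (\<forall>P\<in>PP. z \<notin> P s)"
  using assms
proof (induction PP rule: finite_psubset_induct)
  case (psubset PP)
  show ?case
  proof (cases "PP = {}")
    case True
    then show ?thesis using idealD(2)[OF F_ideal] by (intro exI[of _ 1] exI[of _ \<zero>]) simp
  next
    case False
    then obtain P0 where P0: "P0 \<in> PP" by blast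
    note gP0 = psubset.prems[OF P0]
    show ?thesis
    proof (cases "PP = {P0}")
      case True
      have "\<exists>z. z \<in> F 1 \<and> z \<notin> P0 1" using graded_primeD(2)[OF gP0] graded_relD(3)[OF graded_primeD(1)[OF gP0], of 1] by blast
      then show ?thesis using True by blast
    next
      case False
      have IH: "\<exists>s z. 1 \<le> s \<and> z \<in> F s \<and> (\<forall>Q\<in>PP - {P}. z \<notin> Q s)" if "P \<in> PP" for P
        by (rule psubset.IH) (use that psubset.prems in auto)
      show ?thesis
      proof (rule ccontr)
        assume no: "\<not> ?thesis"
        \<comment> \<open>By assumption no element of positive degree avoids all primes, so one that
          avoids all but \<open>P\<close> lies in \<open>P\<close>.\<close>
        have ins: "z \<in> P s" if "P \<in> PP" "1 \<le> s" "z \<in> F s" "\<forall>Q\<in>PP - {P}. z \<notin> Q s" for P s z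
          using no that by blast
        obtain s a where a: "1 \<le> s" "a \<in> F s" "\<forall>Q\<in>PP - {P0}. a \<notin> Q s" using IH[OF P0] by blast
        have aP: "a \<in> P0 s" by (rule ins[OF P0 a])
        have "\<exists>t b. b \<in> F t \<and> b \<notin> P0 t \<and> (\<forall>Q\<in>PP - {P0}. b \<in> Q t) \<and> (PP - {P0} \<noteq> {} \<longrightarrow> 1 \<le> t)"
        proof (rule prime_product[OF gP0])
          show "finite (PP - {P0})" using psubset.hyps by simp
          fix Q assume Q: "Q \<in> PP - {P0}"
          then show "graded_rel Q" using graded_primeD(1)[OF psubset.prems] by blast
          obtain s z where z: "1 \<le> s" "z \<in> F s" "\<forall>Q'\<in>PP - {Q}. z \<notin> Q' s" using IH[of Q] Q by blast
          then have "z \<in> Q s" using ins[of Q s z] Q by blast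
          moreover have "z \<notin> P0 s" using z(3) P0 Q by blast
          ultimately show "\<exists>s z. 1 \<le> s \<and> z \<in> F s \<and> z \<in> Q s \<and> z \<notin> P0 s" using z by blast
        qed
        then obtain t b where b: "b \<in> F t" "b \<notin> P0 t" "\<And>Q. Q \<in> PP - {P0} \<Longrightarrow> b \<in> Q t" "1 \<le> t"
          using False P0 by blast
        \<comment> \<open>\<open>a\<close> lies in \<open>P0\<close> and in no other prime,
          \<open>b\<close> in every prime but \<open>P0\<close>, so each prime contains exactly one
          summand.\<close>
        let ?z = "a [^] t \<oplus> b [^] s"
        have at: "a [^] t \<in> F (s * t)" and bs: "b [^] s \<in> F (s * t)"
          using F_pow[OF a(2), of t] F_pow[OF b(1), of s] by (simp_all add: mult.commute)
        have c: "a [^] t \<in> carrier R" "b [^] s \<in> carrier R" using F_carrier[OF at] F_carrier[OF bs] .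
        have "?z \<notin> P (s * t)" if P: "P \<in> PP" for P
        proof
          assume z: "?z \<in> P (s * t)"
          note gP = psubset.prems[OF P]
          note Pi = graded_relD(1)[OF graded_primeD(1)[OF gP]]
          show False
          proof (cases "P = P0")
            case True
            have "a [^] t \<in> P (s * t)" using graded_rel_pow_in[OF graded_primeD(1)[OF gP0] a(2) aP b(4)] True by simp
            then have "b [^] s \<in> P (s * t)" using ideal_add_cancel[OF Pi _ c(2) z] by simp
            then show False using graded_prime_pow_notin[OF gP0 b(1,2), of s] True by (simp add: mult.commute)
          next
            case False
            then have "b [^] s \<in> P (s * t)"
              using graded_rel_pow_in[OF graded_primeD(1)[OF gP] b(1), of s] b(3)[of P] P a(1) by (simp add: mult.commute)
            moreover have "b [^] s \<oplus> a [^] t \<in> P (s * t)" using z c by (simp add: a_comm)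
            ultimately have "a [^] t \<in> P (s * t)" using ideal_add_cancel[OF Pi _ c(1)] by blast
            then show False using graded_prime_pow_notin[OF gP a(2), of t] a(3) P False by simp
          qed
        qed
        moreover have "1 \<le> s * t" using a(1) b(4) by simp
        moreover have "?z \<in> F (s * t)" by (rule idealD(3)[OF F_ideal at bs])
        ultimately show False using no by blast
      qed
    qed
  qed
qed

text \<open>The ideal with components \<open>F (Suc n)\<close> has the graded ring of R/I as
  quotient of the Rees algebra. An element avoiding the relevant primes is a nonzerodivisor on it in
  large degrees, and its part in \<open>I\<close> is dropped to obtain \<open>x\<close> in the power
  of \<open>M\<close>.\<close>

lemma superficial_exists:
  obtains s x c where "1 \<le> s" "x \<in> ideal_pow R M s"
    "\<And>n a. c \<le> n \<Longrightarrow> a \<in> F n \<Longrightarrow> x \<otimes> a \<in> F (Suc (n + s)) \<Longrightarrow> a \<in> F (Suc n)"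
proof -
  have "graded_rel (\<lambda>n. F (Suc n))"
    unfolding graded_rel_def
  proof (intro allI conjI ballI)
    fix n m a assume m: "m \<in> M" and a: "a \<in> F (Suc n)"
    have "m \<in> F (Suc 0)" using m pow_F[of "Suc 0"] ideal_pow_1[OF M_ideal] by blast
    then show "m \<otimes> a \<in> F (Suc (Suc n))" using F_mult[OF _ a, of m "Suc 0"] by simp
  qed (simp_all add: F_ideal I_F F_antimono)
  then obtain PP where PP: "finite PP" "\<And>P. P \<in> PP \<Longrightarrow> graded_prime P"
    "\<And>s z. 1 \<le> s \<Longrightarrow> z \<in> F s \<Longrightarrow> (\<forall>P\<in>PP. z \<notin> P s) \<Longrightarrow>
      (\<exists>n0. \<forall>n\<ge>n0. \<forall>a\<in>F n. z \<otimes> a \<in> F (Suc (n + s)) \<longrightarrow> a \<in> F (Suc n))"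
    using finitely_many_primes[of "\<lambda>n. F (Suc n)"] by blast
  obtain s z where z: "1 \<le> s" "z \<in> F s" "\<forall>P\<in>PP. z \<notin> P s" using prime_avoidance[OF PP(1,2)] by blast
  obtain c where c: "\<And>n a. c \<le> n \<Longrightarrow> a \<in> F n \<Longrightarrow> z \<otimes> a \<in> F (Suc (n + s)) \<Longrightarrow> a \<in> F (Suc n)"
    using PP(3)[OF z] by blast
  obtain x i where x: "x \<in> ideal_pow R M s" "i \<in> I" "z = x \<oplus> i" using F_cases[OF z(2)] .
  show ?thesis
  proof (rule that[OF z(1) x(1)])
    fix n a assume n: "c \<le> n" and a: "a \<in> F n" and xa: "x \<otimes> a \<in> F (Suc (n + s))"
    have cc: "x \<in> carrier R" "i \<in> carrier R" "a \<in> carrier R"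
      using idealD(1)[OF pow_ideal x(1)] idealD(1)[OF I x(2)] F_carrier[OF a] .
    have "i \<otimes> a \<in> F (Suc (n + s))" using idealD(7)[OF I cc(3) x(2)] I_F by blast
    then have "x \<otimes> a \<oplus> i \<otimes> a \<in> F (Suc (n + s))" by (rule idealD(3)[OF F_ideal xa])
    then have "z \<otimes> a \<in> F (Suc (n + s))" using cc x(3) by (simp add: l_distr)
    then show "a \<in> F (Suc n)" by (rule c[OF n a])
  qed
qed

section \<open>The Artin-Rees lemma and Krull's intersection theorem\<close>

lemma artin_rees:
  assumes K: "ideal K R"
  obtains k where "\<And>n. k \<le> n \<Longrightarrow> K \<inter> ideal_pow R M n \<subseteq> ideal_pow R M (n - k) \<cdot> K"
proof -
  have "graded_sub (ideal_pow R M) M (\<lambda>n. K \<inter> ideal_pow R M n)"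
    unfolding graded_sub_def
  proof (intro conjI allI ballI)
    fix n e a assume e: "e \<in> M" and a: "a \<in> K \<inter> ideal_pow R M n"
    have "e \<otimes> a \<in> ideal_pow R M (Suc n)"
      unfolding ideal_pow_Suc[OF M_ideal] by (rule ideal_prod.prod[OF e]) (use a in blast)
    then show "e \<otimes> a \<in> K \<inter> ideal_pow R M (Suc n)"
      using idealD(6)[OF K] idealD(1)[OF M_ideal e] a by blast
  qed (auto intro: i_intersect[OF K pow_ideal])
  then obtain k where k: "\<And>n. k \<le> n \<Longrightarrow> K \<inter> ideal_pow R M n = ideal_pow R M (n - k) \<cdot> (K \<inter> ideal_pow R M k)"
    using rees_stable[OF M_ideal] by blast
  have "ideal_pow R M (n - k) \<cdot> (K \<inter> ideal_pow R M k) \<subseteq> ideal_pow R M (n - k) \<cdot> K" for n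
    by (rule prod_mono[OF pow_ideal i_intersect[OF K pow_ideal] pow_ideal K]) auto
  then show ?thesis using that k by blast
qed

text \<open>By Artin-Rees the intersection \<open>N\<close> of all \<open>F n\<close> meets a high
  power of \<open>M\<close> inside M N. As \<open>N\<close> lies in \<open>F (Suc k)\<close>, it is
  contained in I + M N, and Nakayama's lemma applies.\<close>

lemma krull_intersection:
  assumes "\<And>n. a \<in> F n"
  shows "a \<in> I"
proof -
  define N where "N = (\<Inter>n. F n)"
  have N: "ideal N R"
    unfolding N_def by (rule i_Intersect) (use F_ideal in auto)
  obtain k where k: "\<And>n. k \<le> n \<Longrightarrow> N \<inter> ideal_pow R M n \<subseteq> ideal_pow R M (n - k) \<cdot> N" using artin_rees[OF N] by blast
  have "N \<inter> ideal_pow R M (Suc k) \<subseteq> M \<cdot> N" using k[of "Suc k"] ideal_pow_1[OF M_ideal] by (simp add: Suc_diff_le)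
  moreover have "N \<subseteq> (N \<inter> ideal_pow R M (Suc k)) <+> I"
  proof
    fix y assume y: "y \<in> N"
    then have "y \<in> F (Suc k)" by (auto simp: N_def)
    then obtain b i where b: "b \<in> ideal_pow R M (Suc k)" "i \<in> I" "y = b \<oplus> i" by (rule F_cases)
    have c: "b \<in> carrier R" "i \<in> carrier R" using idealD(1)[OF pow_ideal b(1)] idealD(1)[OF I b(2)] .
    have "i \<in> N" using b(2) I_F unfolding N_def by blast
    moreover have "i \<oplus> b \<in> N" using y b(3) c by (simp add: a_comm)
    ultimately have "b \<in> N" using ideal_add_cancel[OF N] c by blast
    then show "y \<in> (N \<inter> ideal_pow R M (Suc k)) <+> I" unfolding mem_sum_iff using b by blast
  qed
  ultimately have "N \<subseteq> M \<cdot> N <+> I" using sum_mono[OF _ order_refl, of "N \<inter> ideal_pow R M (Suc k)" "M \<cdot> N" I] by blast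
  then have "N \<subseteq> I <+> M \<cdot> N" using sum_comm[OF ideal_prod_is_ideal[OF M_ideal N] I] by simp
  then have "N \<subseteq> I" by (rule nakayama[OF N I])
  then show ?thesis using assms unfolding N_def by blast
qed

end

section \<open>Parameters adapted to the filtration\<close>

text \<open>Chains of primes of R/I, written with primes of R that contain I, so that chains over
  different ideals can be prolonged and compared.\<close>

definition prime_chain :: "('a, 'b) ring_scheme \<Rightarrow> 'a set \<Rightarrow> nat \<Rightarrow> bool" where
  "prime_chain R I k \<longleftrightarrow> (\<exists>P. (\<forall>i\<le>k. primeideal (P i) R \<and> I \<subseteq> P i) \<and> (\<forall>i<k. P i \<subset> P (Suc i)))"

text \<open>From \<open>s + sum_list ss\<close> on no subtraction truncates, and the operator
  commutes with the shift by \<open>s\<close>.\<close>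

lemma shift_diff_shift:
  "s + sum_list ss \<le> n \<Longrightarrow> shift_diff ss (\<lambda>m. f m - f (m - s)) n = shift_diff ss f n - shift_diff ss f (n - s)"
proof (induction ss arbitrary: n)
  case (Cons t ss)
  have "shift_diff ss (\<lambda>m. f m - f (m - s)) n = shift_diff ss f n - shift_diff ss f (n - s)"
    "shift_diff ss (\<lambda>m. f m - f (m - s)) (n - t) = shift_diff ss f (n - t) - shift_diff ss f (n - t - s)"
    using Cons by simp_all
  moreover have "n - t - s = n - s - t" "t \<le> n" "t \<le> n - s" using Cons.prems by auto
  ultimately show ?case by simp
qed simp

lemma shift_diff_cong_tail:
  "sum_list ss \<le> n \<Longrightarrow> (\<And>m. n - sum_list ss \<le> m \<Longrightarrow> f m = g m) \<Longrightarrow> shift_diff ss f n = shift_diff ss g n"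
proof (induction ss arbitrary: n)
  case (Cons t ss)
  have "shift_diff ss f n = shift_diff ss g n" by (rule Cons.IH) (use Cons.prems in auto)
  moreover have "shift_diff ss f (n - t) = shift_diff ss g (n - t)"
    by (rule Cons.IH) (use Cons.prems in \<open>auto simp: add.commute\<close>)
  ultimately show ?case by simp
qed simp

text \<open>An ideal maximal among those that contain \<open>I\<close> and miss the multiplicative
  set \<open>S\<close> is prime: adjoining an element outside it makes it meet \<open>S\<close>, and
  the product of two such meetings would again be in \<open>S\<close>.\<close>

lemma (in noeth_cring) prime_avoiding:
  assumes I: "ideal I R" and S: "\<one> \<in> S" "\<And>a b. a \<in> S \<Longrightarrow> b \<in> S \<Longrightarrow> a \<otimes> b \<in> S" "S \<subseteq> carrier R"
    and dis: "I \<inter> S = {}"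
  obtains P where "primeideal P R" "I \<subseteq> P" "P \<inter> S = {}"
proof -
  obtain P where P: "ideal P R \<and> I \<subseteq> P \<and> P \<inter> S = {}"
    and mx: "\<And>Y. ideal Y R \<and> I \<subseteq> Y \<and> Y \<inter> S = {} \<Longrightarrow> P \<subseteq> Y \<Longrightarrow> Y = P"
    by (rule ideal_max_exists[of "\<lambda>P. ideal P R \<and> I \<subseteq> P \<and> P \<inter> S = {}" I]) (use I dis in simp_all)
  have hit: "\<exists>p\<in>P. \<exists>r\<in>carrier R. p \<oplus> r \<otimes> a \<in> S" if a: "a \<in> carrier R" "a \<notin> P" for a
  proof (rule ccontr)
    assume no: "\<not> ?thesis"
    let ?Y = "P <+> PIdl a"
    have Y: "ideal ?Y R" using P cgenideal_ideal[OF a(1)] add_ideals by blast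
    have up: "P \<subseteq> ?Y" "PIdl a \<subseteq> ?Y" using sum_upper[of P "PIdl a"] P cgenideal_ideal[OF a(1)] by blast+
    have "?Y \<inter> S = {}" using no unfolding mem_sum_PIdl disjoint_iff by blast
    then have "?Y = P" using mx[of ?Y] Y up P by blast
    then show False using up cgenideal_self[OF a(1)] a(2) by blast
  qed
  have "primeideal P R"
  proof (rule primeidealI)
    show "ideal P R" using P by blast
    show "cring R" by (rule cring_axioms)
    show "carrier R \<noteq> P" using P S(1,3) by blast
    fix a b assume ab: "a \<in> carrier R" "b \<in> carrier R" "a \<otimes> b \<in> P"
    show "a \<in> P \<or> b \<in> P"
    proof (rule ccontr)
      assume "\<not> (a \<in> P \<or> b \<in> P)"
      then obtain p r q s where pr: "p \<in> P" "r \<in> carrier R" "p \<oplus> r \<otimes> a \<in> S" "q \<in> P" "s \<in> carrier R" "q \<oplus> s \<otimes> b \<in> S"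
        using hit ab by metis
      have Pi: "ideal P R" using P by blast
      have c: "p \<in> carrier R" "q \<in> carrier R" using idealD(1)[OF Pi pr(1)] idealD(1)[OF Pi pr(4)] .
      have "(p \<oplus> r \<otimes> a) \<otimes> (q \<oplus> s \<otimes> b) = p \<otimes> (q \<oplus> s \<otimes> b) \<oplus> ((r \<otimes> a) \<otimes> q \<oplus> (r \<otimes> s) \<otimes> (a \<otimes> b))"
        using c pr ab by (simp add: l_distr r_distr m_ac a_ac)
      moreover have "p \<otimes> (q \<oplus> s \<otimes> b) \<in> P" by (rule idealD(7)[OF Pi _ pr(1)]) (use c pr ab in simp)
      moreover have "(r \<otimes> a) \<otimes> q \<in> P" by (rule idealD(6)[OF Pi _ pr(4)]) (use pr ab in simp)
      moreover have "(r \<otimes> s) \<otimes> (a \<otimes> b) \<in> P" by (rule idealD(6)[OF Pi _ ab(3)]) (use pr in simp)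
      ultimately have "(p \<oplus> r \<otimes> a) \<otimes> (q \<oplus> s \<otimes> b) \<in> P" using idealD(3)[OF Pi] by metis
      then show False using S(2)[OF pr(3,6)] P by blast
    qed
  qed
  then show ?thesis using that P by blast
qed

context noeth_local
begin

lemma wsum_pow:
  assumes "length ss = length xs" "\<And>i. i < length xs \<Longrightarrow> xs ! i \<in> ideal_pow R M (ss ! i)"
  shows "wsum R (ideal_pow R M) xs ss n \<subseteq> ideal_pow R M n"
  using assms
proof (induction xs arbitrary: ss)
  case Nil
  then show ?case using idealD(2)[OF pow_ideal] by simp
next
  case (Cons x xs)
  obtain s ss' where ss: "ss = s # ss'" using Cons.prems by (cases ss) auto
  have x: "x \<in> ideal_pow R M s" using Cons.prems(2)[of 0] ss by simp
  have IH: "wsum R (ideal_pow R M) xs ss' n \<subseteq> ideal_pow R M n"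
  proof (rule Cons.IH)
    show "xs ! i \<in> ideal_pow R M (ss' ! i)" if "i < length xs" for i
      using Cons.prems(2)[of "Suc i"] that ss by simp
  qed (use Cons.prems ss in simp)
  show ?case
  proof
    fix z assume "z \<in> wsum R (ideal_pow R M) (x # xs) ss n"
    then obtain a v where av: "a \<in> ideal_pow R M (n - s)" "v \<in> wsum R (ideal_pow R M) xs ss' n" "z = x \<otimes> a \<oplus> v"
      unfolding ss by (auto simp: mem_sum_iff)
    have "x \<otimes> a \<in> ideal_pow R M n"
      by (rule subsetD[OF ideal_pow_antimono[OF M_ideal] ideal_pow_mult_mem[OF M_ideal x av(1)]]) simp
    then show "z \<in> ideal_pow R M n" using av IH idealD(3)[OF pow_ideal] by blast
  qed
qed

lemma M_prime: "primeideal M R"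
  using maximalideal_prime max by blast

text \<open>Let J be maximal among the ideals that contain \<open>I\<close> but no power of
  \<open>M\<close>. It is prime: for a and b outside J, powers of \<open>M\<close> lie in J + (a)
  and J + (b), so a b in J would put their product into J. As J differs from \<open>M\<close>, the
  two form a chain of length 1.\<close>

lemma power_in_ideal_of_dim_0:
  assumes I: "ideal I R" and dim: "\<not> prime_chain R I 1"
  shows "\<exists>r. ideal_pow R M r \<subseteq> I"
proof (rule ccontr)
  assume no: "\<nexists>r. ideal_pow R M r \<subseteq> I"
  let ?Q = "\<lambda>J. ideal J R \<and> I \<subseteq> J \<and> (\<forall>r. \<not> ideal_pow R M r \<subseteq> J)"
  obtain J where J: "?Q J" and mx: "\<And>Y. ?Q Y \<Longrightarrow> J \<subseteq> Y \<Longrightarrow> Y = J"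
    by (rule ideal_max_exists[of ?Q I]) (use I no in simp_all)
  have Ji: "ideal J R" using J by blast
  have neJ: "J \<noteq> carrier R"
  proof
    assume "J = carrier R"
    then have "ideal_pow R M 0 \<subseteq> J" by simp
    then show False using J by blast
  qed
  have pw: "\<exists>r. ideal_pow R M r \<subseteq> J <+> PIdl a" if a: "a \<in> carrier R" "a \<notin> J" for a
  proof (rule ccontr)
    assume no: "\<not> ?thesis"
    let ?Y = "J <+> PIdl a"
    have Y: "ideal ?Y R" using add_ideals[OF Ji cgenideal_ideal[OF a(1)]] .
    have up: "J \<subseteq> ?Y" "PIdl a \<subseteq> ?Y" using sum_upper[OF Ji cgenideal_ideal[OF a(1)]] .
    have "?Y = J" using mx[of ?Y] Y up J no by blast
    then show False using up cgenideal_self[OF a(1)] a(2) by blast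
  qed
  have Jp: "primeideal J R"
  proof (rule primeidealI)
    show "ideal J R" by (rule Ji)
    show "cring R" by (rule cring_axioms)
    show "carrier R \<noteq> J" using neJ by blast
    fix a b assume ab: "a \<in> carrier R" "b \<in> carrier R" "a \<otimes> b \<in> J"
    show "a \<in> J \<or> b \<in> J"
    proof (rule ccontr)
      assume "\<not> (a \<in> J \<or> b \<in> J)"
      then obtain r s where rs: "ideal_pow R M r \<subseteq> J <+> PIdl a" "ideal_pow R M s \<subseteq> J <+> PIdl b"
        using pw ab by metis
      have "\<forall>h\<in>ideal_pow R M r. \<forall>k\<in>ideal_pow R M s. h \<otimes> k \<in> J"
      proof (intro ballI)
        fix h k assume "h \<in> ideal_pow R M r" "k \<in> ideal_pow R M s"
        then have "h \<in> J <+> PIdl a" "k \<in> J <+> PIdl b" using rs by auto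
        then obtain p u q v where pq: "p \<in> J" "u \<in> carrier R" "h = p \<oplus> u \<otimes> a" "q \<in> J" "v \<in> carrier R" "k = q \<oplus> v \<otimes> b"
          unfolding mem_sum_PIdl by blast
        have c: "p \<in> carrier R" "q \<in> carrier R" using idealD(1)[OF Ji pq(1)] idealD(1)[OF Ji pq(4)] .
        have "h \<otimes> k = p \<otimes> k \<oplus> ((u \<otimes> a) \<otimes> q \<oplus> (u \<otimes> v) \<otimes> (a \<otimes> b))"
          using c pq ab by (simp add: l_distr r_distr m_ac a_ac)
        moreover have "p \<otimes> k \<in> J" by (rule idealD(7)[OF Ji _ pq(1)]) (use c pq ab in simp)
        moreover have "(u \<otimes> a) \<otimes> q \<in> J" by (rule idealD(6)[OF Ji _ pq(4)]) (use pq ab in simp)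
        moreover have "(u \<otimes> v) \<otimes> (a \<otimes> b) \<in> J" by (rule idealD(6)[OF Ji _ ab(3)]) (use pq in simp)
        ultimately show "h \<otimes> k \<in> J" using idealD(3)[OF Ji] by metis
      qed
      then have "ideal_pow R M (r + s) \<subseteq> J"
        unfolding ideal_pow_add[OF M_ideal] using prod_subset_iff[OF pow_ideal pow_ideal Ji] by simp
      then show False using J by blast
    qed
  qed
  have "J \<subseteq> M" by (rule proper_subset_M[OF Ji neJ])
  moreover have "J \<noteq> M"
  proof
    assume "J = M"
    then have "ideal_pow R M (Suc 0) \<subseteq> J" using ideal_pow_1[OF M_ideal] by simp
    then show False using J by blast
  qed
  ultimately have "prime_chain R I 1"
    unfolding prime_chain_def using Jp M_prime J
    by (intro exI[of _ "\<lambda>i. if i = 0 then J else M"]) auto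
  then show False using dim by blast
qed

end

context rel_local
begin

text \<open>The Hilbert function of R/I, with integer values so that differences make sense.\<close>

definition H :: "nat \<Rightarrow> int" where "H n = int (the_enat (ideal_len (F (Suc n)) (F n)))"

lemma ideal_len_F_finite: "ideal_len (F (Suc n)) (F n) < \<infinity>"
proof -
  have "F (Suc n) <+> ideal_pow R M n = F n"
  proof
    show "F (Suc n) <+> ideal_pow R M n \<subseteq> F n"
      using sum_subset_iff[OF F_ideal pow_ideal F_ideal] F_antimono[of n "Suc n"] pow_F by simp
    have i: "ideal (F (Suc n) <+> ideal_pow R M n) R" by (rule add_ideals[OF F_ideal pow_ideal])
    have "ideal_pow R M n \<subseteq> F (Suc n) <+> ideal_pow R M n" "I \<subseteq> F (Suc n) <+> ideal_pow R M n"
      using sum_upper[OF F_ideal pow_ideal] I_F by blast+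
    then show "F n \<subseteq> F (Suc n) <+> ideal_pow R M n"
      unfolding F_def[of n] using sum_subset_iff[OF pow_ideal I i] by simp
  qed
  moreover have "M \<cdot> ideal_pow R M n \<subseteq> F (Suc n)" using pow_F[of "Suc n"] ideal_pow_Suc[OF M_ideal] by simp
  ultimately show ?thesis using ideal_len_finite[OF pow_ideal F_ideal, of n "Suc n"] by simp
qed

lemma ideal_len_H: "ideal_len (F (Suc n)) (F n) = enat (nat (H n))"
  using ideal_len_F_finite[of n] by (auto simp: H_def)

end

text \<open>\<open>star\<close> says that multiplication by \<open>x\<close>, as a map of degree
  \<open>s\<close> on the graded ring of R/I, is injective in degrees from \<open>c\<close>
  on.\<close>

locale superficial = rel_local R M I for R (structure) and M and I +
  fixes s c x
  assumes s: "1 \<le> s" and x: "x \<in> ideal_pow R M s"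
    and star: "\<And>n a. c \<le> n \<Longrightarrow> a \<in> F n \<Longrightarrow> x \<otimes> a \<in> F (Suc (n + s)) \<Longrightarrow> a \<in> F (Suc n)"
begin

lemma xc: "x \<in> carrier R" using idealD(1)[OF pow_ideal x] .

definition I' where "I' = I <+> PIdl x"

lemma I'_ideal: "ideal I' R" unfolding I'_def by (rule add_ideals[OF I cgenideal_ideal[OF xc]])

lemma I_I': "I \<subseteq> I'" and x_I': "PIdl x \<subseteq> I'"
  unfolding I'_def using sum_upper[OF I cgenideal_ideal[OF xc]] by auto

lemma x_I'': "x \<in> I'" using x_I' cgenideal_self[OF xc] by blast

lemma x_M: "x \<in> M"
  using x ideal_pow_antimono[OF M_ideal s] ideal_pow_1[OF M_ideal] by auto

lemma I'_M: "I \<subseteq> M \<Longrightarrow> I' \<subseteq> M"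
  unfolding I'_def using sum_subset_iff[OF I cgenideal_ideal[OF xc] M_ideal] cgenideal_minimal[OF M_ideal x_M] by simp

text \<open>Iterating \<open>star\<close> pushes \<open>a\<close> into every \<open>F n\<close>, and
  Krull's intersection theorem then puts it into \<open>I\<close>.\<close>

lemma mult_x_I: "a \<in> F c \<Longrightarrow> x \<otimes> a \<in> I \<Longrightarrow> a \<in> I"
proof (rule krull_intersection)
  fix n assume a: "a \<in> F c" and xa: "x \<otimes> a \<in> I"
  have "a \<in> F (c + n)"
  proof (induction n)
    case (Suc n)
    have "x \<otimes> a \<in> F (Suc (c + n + s))" using xa I_F by blast
    then show ?case using star[of "c + n" a] Suc by simp
  qed (simp add: a)
  then show "a \<in> F n" using F_antimono[of n "c + n"] by auto
qed

text \<open>Multiplying by an element of M^c outside \<open>P\<close> moves a given element into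
  \<open>F c\<close>, where \<open>x\<close> cancels modulo \<open>I\<close>. Hence y x^j in
  \<open>I\<close> forces y into \<open>P\<close>, so the multiplicative set of all y x^j with y
  outside \<open>P\<close> misses \<open>I\<close>. A prime over \<open>I\<close> that avoids this
  set lies inside \<open>P\<close> and does not contain \<open>x\<close>.\<close>

lemma prime_below:
  assumes P: "primeideal P R" "I' \<subseteq> P" "P \<noteq> M"
  obtains P' where "primeideal P' R" "I \<subseteq> P'" "P' \<subset> P"
proof -
  interpret P: primeideal P R by fact
  have Pi: "ideal P R" by (rule P.is_ideal)
  have PM: "P \<subseteq> M" by (rule proper_subset_M[OF Pi]) (use P.I_notcarr in blast)
  then obtain m where m: "m \<in> M" "m \<notin> P" using P(3) by blast
  have mc: "m \<in> carrier R" using idealD(1)[OF M_ideal m(1)] .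
  have mpow: "m [^] t \<in> ideal_pow R M t \<and> m [^] t \<notin> P" for t :: nat
  proof (induction t)
    case 0
    have "\<one> \<notin> P" using P.one_imp_carrier P.I_notcarr by blast
    then show ?case by simp
  next
    case (Suc t)
    have "m \<in> ideal_pow R M (Suc 0)" using m ideal_pow_1[OF M_ideal] by simp
    then have "m [^] t \<otimes> m \<in> ideal_pow R M (t + Suc 0)" using ideal_pow_mult_mem[OF M_ideal] Suc by blast
    moreover have "m [^] t \<otimes> m \<notin> P" using P.I_prime[of "m [^] t" m] Suc m(2) mc by auto
    ultimately show ?case by simp
  qed
  have key: "y \<in> carrier R \<Longrightarrow> y \<otimes> x [^] j \<in> I \<Longrightarrow> y \<in> P" for y and j :: nat
  proof (induction j arbitrary: y)
    case 0
    then show ?case using I_I' P(2) by auto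
  next
    case (Suc j)
    let ?m = "m [^] c"
    let ?a = "(?m \<otimes> y) \<otimes> x [^] j"
    have mcc: "?m \<in> carrier R" using mc by simp
    have "?m \<in> F c" using mpow[of c] pow_F by blast
    moreover have "?a = (y \<otimes> x [^] j) \<otimes> ?m" using mcc Suc.prems xc by (simp add: m_ac)
    ultimately have "?a \<in> F c" using idealD(6)[OF F_ideal, of "y \<otimes> x [^] j" ?m c] Suc.prems xc by simp
    moreover have "x \<otimes> ?a = ?m \<otimes> (y \<otimes> x [^] Suc j)" using mcc Suc.prems xc by (simp add: m_ac)
    then have "x \<otimes> ?a \<in> I" using idealD(6)[OF I mcc Suc.prems(2)] by simp
    ultimately have "?a \<in> I" by (rule mult_x_I)
    then have "?m \<otimes> y \<in> P" using Suc.IH[of "?m \<otimes> y"] mcc Suc.prems by simp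
    then show ?case using P.I_prime[OF mcc Suc.prems(1)] mpow[of c] by blast
  qed
  define S where "S = {y \<otimes> x [^] j | y j. y \<in> carrier R \<and> y \<notin> P \<and> (j::nat) \<in> UNIV}"
  obtain P' where P': "primeideal P' R" "I \<subseteq> P'" "P' \<inter> S = {}"
  proof (rule prime_avoiding[OF I])
    have "\<one> = \<one> \<otimes> x [^] (0::nat)" by simp
    moreover have "\<one> \<notin> P" using P.one_imp_carrier P.I_notcarr by blast
    ultimately show "\<one> \<in> S" unfolding S_def by blast
    show "S \<subseteq> carrier R" unfolding S_def using xc by auto
    show "I \<inter> S = {}" unfolding S_def using key by blast
    fix a b assume "a \<in> S" "b \<in> S"
    then obtain y z and i j :: nat where yz: "a = y \<otimes> x [^] i" "b = z \<otimes> x [^] j" "y \<in> carrier R" "z \<in> carrier R" "y \<notin> P" "z \<notin> P"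
      unfolding S_def by blast
    have "a \<otimes> b = (y \<otimes> z) \<otimes> x [^] (i + j)" using yz xc by (simp add: nat_pow_mult[symmetric] m_ac)
    moreover have "y \<otimes> z \<notin> P" using P.I_prime yz by blast
    ultimately show "a \<otimes> b \<in> S" unfolding S_def using yz by blast
  qed
  have one: "\<one> \<notin> P" using P.one_imp_carrier P.I_notcarr by blast
  have "x = \<one> \<otimes> x [^] (Suc 0)" using xc by simp
  then have "x \<in> S" unfolding S_def using one by blast
  then have "x \<notin> P'" "x \<in> P" using P'(3) x_I'' P(2) by blast+
  moreover have "P' \<subseteq> P"
  proof
    fix y assume y: "y \<in> P'"
    have yc: "y \<in> carrier R" using idealD(1)[OF primeideal.axioms(1)[OF P'(1)] y] .
    show "y \<in> P"
    proof (rule ccontr)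
      assume "y \<notin> P"
      moreover have "y = y \<otimes> x [^] (0::nat)" using yc by simp
      ultimately have "y \<in> S" unfolding S_def using yc by blast
      then show False using y P'(3) by blast
    qed
  qed
  ultimately show ?thesis using that[OF P'(1,2)] by blast
qed

text \<open>A chain over \<open>I'\<close> is prolonged at the bottom by a smaller prime over
  \<open>I\<close>. This needs a bottom prime other than \<open>M\<close>, but a chain that starts
  at \<open>M\<close> has length 0.\<close>

lemma dim_drop:
  assumes dim: "\<And>k. prime_chain R I k \<Longrightarrow> k \<le> Suc d" and chain: "prime_chain R I' k"
  shows "k \<le> d"
proof -
  obtain P where P: "\<And>i. i \<le> k \<Longrightarrow> primeideal (P i) R" "\<And>i. i \<le> k \<Longrightarrow> I' \<subseteq> P i" "\<And>i. i < k \<Longrightarrow> P i \<subset> P (Suc i)"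
    using chain unfolding prime_chain_def by blast
  show ?thesis
  proof (cases "P 0 = M")
    case True
    have "k = 0"
    proof (rule ccontr)
      assume "k \<noteq> 0"
      then have 1: "P 0 \<subset> P 1" "primeideal (P 1) R" using P(3)[of 0] P(1)[of 1] by auto
      have "P 1 \<subseteq> M"
        using proper_subset_M[of "P 1"] 1(2) primeideal.I_notcarr[OF 1(2)] by (auto simp: primeideal_def)
      then show False using 1(1) True by blast
    qed
    then show ?thesis by simp
  next
    case False
    obtain P' where P': "primeideal P' R" "I \<subseteq> P'" "P' \<subset> P 0"
      using prime_below[of "P 0"] P(1,2)[of 0] False by blast
    have "prime_chain R I (Suc k)"
      unfolding prime_chain_def
    proof (intro exI[of _ "\<lambda>i. case i of 0 \<Rightarrow> P' | Suc j \<Rightarrow> P j"] conjI allI impI)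
      fix i assume i: "i \<le> Suc k"
      show "primeideal (case i of 0 \<Rightarrow> P' | Suc j \<Rightarrow> P j) R" using i P(1) P' by (cases i) auto
      show "I \<subseteq> (case i of 0 \<Rightarrow> P' | Suc j \<Rightarrow> P j)" using i P(2) P' I_I' by (cases i) auto
    next
      fix i assume i: "i < Suc k"
      show "(case i of 0 \<Rightarrow> P' | Suc j \<Rightarrow> P j) \<subset> (case Suc i of 0 \<Rightarrow> P' | Suc j \<Rightarrow> P j)"
        using i P(3)[of "i - 1"] P' by (cases i) auto
    qed
    then show ?thesis using dim by fastforce
  qed
qed

text \<open>Artin-Rees writes an element of \<open>I'\<close> in \<open>F n\<close>, modulo
  \<open>I\<close>, as x a with a of order n - k for a constant k. Then \<open>star\<close> raises
  the order of a one by one up to n - s; the bound \<open>k + c\<close> on \<open>n\<close> ensures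
  that the orders passed are at least \<open>c\<close>.\<close>

lemma I'_inter:
  obtains n0 where "\<And>n b. n0 \<le> n \<Longrightarrow> b \<in> I' \<Longrightarrow> b \<in> F n \<Longrightarrow> \<exists>a\<in>ideal_pow R M (n - s). \<exists>i\<in>I. b = x \<otimes> a \<oplus> i"
proof -
  obtain k where k: "\<And>n. k \<le> n \<Longrightarrow> I' \<inter> ideal_pow R M n \<subseteq> ideal_pow R M (n - k) \<cdot> I'"
    using artin_rees[OF I'_ideal] by blast
  have "\<exists>a\<in>ideal_pow R M (n - s). \<exists>i\<in>I. b = x \<otimes> a \<oplus> i"
    if n: "k + c \<le> n" and b: "b \<in> I'" "b \<in> F n" for n b
  proof -
    obtain b' i where b': "b' \<in> ideal_pow R M n" "i \<in> I" "b = b' \<oplus> i" using F_cases[OF b(2)] .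
    have c1: "b' \<in> carrier R" "i \<in> carrier R" using idealD(1)[OF pow_ideal b'(1)] idealD(1)[OF I b'(2)] .
    have "i \<oplus> b' \<in> I'" using b(1) b'(3) c1 by (simp add: a_comm)
    then have "b' \<in> I'" using ideal_add_cancel[OF I'_ideal] I_I' b'(2) c1 by blast
    then have "b' \<in> ideal_pow R M (n - k) \<cdot> I'" using k[of n] n b'(1) by auto
    moreover have "ideal_pow R M (n - k) \<cdot> I' \<subseteq> (\<lambda>a. x \<otimes> a) ` ideal_pow R M (n - k) <+> I"
    proof -
      have X: "ideal ((\<lambda>a. x \<otimes> a) ` ideal_pow R M (n - k)) R" by (rule image_mult_ideal[OF pow_ideal xc])
      have "h \<otimes> y \<in> (\<lambda>a. x \<otimes> a) ` ideal_pow R M (n - k) <+> I" if h: "h \<in> ideal_pow R M (n - k)" and y: "y \<in> I'" for h y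
      proof -
        obtain j r where jr: "j \<in> I" "r \<in> carrier R" "y = j \<oplus> r \<otimes> x" using y unfolding I'_def mem_sum_PIdl by blast
        have hc: "h \<in> carrier R" "j \<in> carrier R" using idealD(1)[OF pow_ideal h] idealD(1)[OF I jr(1)] .
        have "h \<otimes> y = x \<otimes> (r \<otimes> h) \<oplus> h \<otimes> j" using hc jr xc by (simp add: r_distr m_ac a_comm)
        moreover have "r \<otimes> h \<in> ideal_pow R M (n - k)" by (rule idealD(6)[OF pow_ideal jr(2) h])
        moreover have "h \<otimes> j \<in> I" by (rule idealD(6)[OF I hc(1) jr(1)])
        ultimately show ?thesis unfolding mem_sum_iff by blast
      qed
      then show ?thesis using prod_subset_iff[OF pow_ideal I'_ideal add_ideals[OF X I]] by blast
    qed
    ultimately have "b' \<in> (\<lambda>a. x \<otimes> a) ` ideal_pow R M (n - k) <+> I" by blast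
    then obtain a j where a: "a \<in> ideal_pow R M (n - k)" "j \<in> I" "b' = x \<otimes> a \<oplus> j" by (auto simp: mem_sum_iff)
    have c2: "a \<in> carrier R" "j \<in> carrier R" using idealD(1)[OF pow_ideal a(1)] idealD(1)[OF I a(2)] .
    have ji: "j \<oplus> i \<in> I" by (rule idealD(3)[OF I a(2) b'(2)])
    have beq: "b = x \<otimes> a \<oplus> (j \<oplus> i)" using b'(3) a(3) c1 c2 xc by (simp add: a_assoc)
    have "(j \<oplus> i) \<oplus> x \<otimes> a \<in> F n" using b(2) beq c1 c2 xc by (simp add: a_comm)
    then have xaF: "x \<otimes> a \<in> F n" using ideal_add_cancel[OF F_ideal] ji I_F c2 xc by blast
    have "a \<in> F (n - s)"
    proof (cases "n - s \<le> n - k")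
      case True
      then show ?thesis using a(1) pow_F F_antimono by blast
    next
      case False
      have "n - k + t \<le> n - s \<Longrightarrow> a \<in> F (n - k + t)" for t
      proof (induction t)
        case 0
        show ?case using a(1) pow_F by auto
      next
        case (Suc t)
        have "Suc (n - k + t + s) \<le> n" using Suc.prems False by simp
        then have "x \<otimes> a \<in> F (Suc (n - k + t + s))" using xaF F_antimono by blast
        then show ?case using star[of "n - k + t" a] Suc n by simp
      qed
      from this[of "n - s - (n - k)"] show ?thesis using False by simp
    qed
    then obtain a' j' where a': "a' \<in> ideal_pow R M (n - s)" "j' \<in> I" "a = a' \<oplus> j'" by (rule F_cases)
    have c3: "a' \<in> carrier R" "j' \<in> carrier R" using idealD(1)[OF pow_ideal a'(1)] idealD(1)[OF I a'(2)] .
    have "b = x \<otimes> a' \<oplus> (x \<otimes> j' \<oplus> (j \<oplus> i))" using beq a'(3) c1 c2 c3 xc by (simp add: r_distr a_assoc)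
    moreover have "x \<otimes> j' \<oplus> (j \<oplus> i) \<in> I" using idealD(3)[OF I idealD(6)[OF I xc a'(2)] ji] .
    ultimately show ?thesis using a'(1) by blast
  qed
  then show ?thesis by (rule that)
qed

text \<open>For large n, multiplication by \<open>x\<close> embeds degree n - s of the graded ring
  of R/I into degree n, and the cokernel is degree n of the graded ring of R/I'.\<close>

lemma hilbert_diff:
  "\<exists>n0. \<forall>n\<ge>n0. s \<le> n \<and> rel_local.H R M I' n = H n - H (n - s)"
proof -
  interpret J: rel_local R M I'
    by (intro rel_local.intro rel_local_axioms.intro noeth_local_axioms I'_ideal)
  obtain n0 where n0: "\<And>n b. n0 \<le> n \<Longrightarrow> b \<in> I' \<Longrightarrow> b \<in> F n \<Longrightarrow> \<exists>a\<in>ideal_pow R M (n - s). \<exists>i\<in>I. b = x \<otimes> a \<oplus> i"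
    by (rule I'_inter) blast
  have "J.H n = H n - H (n - s)" if n: "max n0 (c + s) \<le> n" for n
  proof -
    have sn: "s \<le> n" "c \<le> n - s" using n by auto
    have FJ: "F k \<subseteq> J.F k" for k unfolding F_def J.F_def by (rule sum_mono[OF order_refl I_I'])
    \<comment> \<open>The ideal that corresponds to the image of \<open>x\<close> in degree
      \<open>n\<close>: the quotient above it is the graded piece of R/I', the one below it the
      graded piece of R/I in degree n - s.\<close>
    define Y where "Y = F n \<inter> J.F (Suc n)"
    have Y: "ideal Y R" unfolding Y_def by (rule i_intersect[OF F_ideal J.F_ideal])
    have FY: "F (Suc n) \<subseteq> Y" unfolding Y_def using F_antimono[of n "Suc n"] FJ by auto
    have "ideal_len (F (Suc n)) (F n) = ideal_len (F (Suc n)) Y + ideal_len Y (F n)"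
      by (rule ideal_len_add[OF F_ideal Y F_ideal FY]) (simp add: Y_def)
    also have "ideal_len Y (F n) = ideal_len (J.F (Suc n)) (J.F n)"
      unfolding ideal_len_def submods_self[symmetric]
    proof (rule length_linear_iso[where \<phi> = "\<lambda>a. a", OF self_mod_module self_mod_module])
      fix y assume "y \<in> J.F n"
      then obtain b i where b: "b \<in> ideal_pow R M n" "i \<in> I'" "y = b \<oplus> i" by (rule J.F_cases)
      then show "\<exists>a\<in>F n. \<exists>v\<in>J.F (Suc n). y = a \<oplus>\<^bsub>self_mod R\<^esub> v" using pow_F J.I_F by (simp add: subset_iff) blast
    qed (use Y F_ideal J.F_ideal J.F_antimono[of n "Suc n"] FJ[of n] in \<open>auto simp: submods_self Y_def\<close>)
    also have "ideal_len (F (Suc n)) Y = ideal_len (F (Suc (n - s))) (F (n - s))"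
      unfolding ideal_len_def submods_self[symmetric]
    proof (rule sym, rule length_linear_iso[where \<phi> = "\<lambda>a. x \<otimes> a", OF self_mod_module self_mod_module])
      fix a assume a: "a \<in> F (n - s)"
      have "x \<in> F s" using x pow_F by blast
      then have "x \<otimes> a \<in> F n" using F_mult[OF _ a, of x s] sn by simp
      moreover have "x \<otimes> a \<in> I'" using idealD(7)[OF I'_ideal F_carrier[OF a] x_I''] .
      ultimately show "x \<otimes> a \<in> Y" unfolding Y_def using J.I_F by blast
    next
      show "{a \<in> F (n - s). x \<otimes> a \<in> F (Suc n)} = F (Suc (n - s))"
      proof (intro equalityI subsetI)
        fix a assume "a \<in> {a \<in> F (n - s). x \<otimes> a \<in> F (Suc n)}"
        then show "a \<in> F (Suc (n - s))" using star[of "n - s" a] sn by simp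
      next
        fix a assume a: "a \<in> F (Suc (n - s))"
        have "x \<in> F s" using x pow_F by blast
        then have "x \<otimes> a \<in> F (Suc n)" using F_mult[OF _ a, of x s] sn by simp
        then show "a \<in> {a \<in> F (n - s). x \<otimes> a \<in> F (Suc n)}" using a F_antimono[of "n - s" "Suc (n - s)"] by auto
      qed
    next
      fix y assume "y \<in> Y"
      then have y: "y \<in> F n" "y \<in> J.F (Suc n)" by (auto simp: Y_def)
      obtain g i where g: "g \<in> ideal_pow R M (Suc n)" "i \<in> I'" "y = g \<oplus> i" using J.F_cases[OF y(2)] .
      have gF: "g \<in> F (Suc n)" "g \<in> F n" using g(1) pow_F F_antimono[of n "Suc n"] by auto
      have gc: "g \<in> carrier R" "i \<in> carrier R" using F_carrier[OF gF(1)] idealD(1)[OF I'_ideal g(2)] .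
      have "i \<in> F n" using ideal_add_cancel[OF F_ideal gF(2) gc(2)] y(1) g(3) by simp
      then obtain a j where a: "a \<in> ideal_pow R M (n - s)" "j \<in> I" "i = x \<otimes> a \<oplus> j" using n0[of n i] n g(2) by auto
      have c2: "a \<in> carrier R" "j \<in> carrier R" using idealD(1)[OF pow_ideal a(1)] idealD(1)[OF I a(2)] .
      have "y = x \<otimes> a \<oplus> (g \<oplus> j)" using g(3) a(3) gc c2 xc by (simp add: a_ac)
      moreover have "g \<oplus> j \<in> F (Suc n)" using idealD(3)[OF F_ideal gF(1)] a(2) I_F by blast
      ultimately show "\<exists>a\<in>F (n - s). \<exists>v\<in>F (Suc n). y = x \<otimes> a \<oplus>\<^bsub>self_mod R\<^esub> v" using a(1) pow_F by auto
    qed (use Y F_ideal FY F_carrier xc in \<open>auto simp: submods_self r_distr m_lcomm\<close>)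
    finally have "enat (nat (H n)) = enat (nat (H (n - s))) + enat (nat (J.H n))"
      unfolding ideal_len_H J.ideal_len_H .
    then show ?thesis by (simp add: H_def J.H_def)
  qed
  then show ?thesis by (intro exI[of _ "max n0 (c + s)"]) auto
qed

end

context noeth_local
begin

text \<open>Induction on a bound d for the dimension, replacing I by I + (x) for a superficial x.
  Since d is only a bound, the list gets the prescribed length in any case.\<close>

lemma parameters_exist:
  assumes "ideal I R" "I \<subseteq> M" "\<And>k. prime_chain R I k \<Longrightarrow> k \<le> d"
  shows "\<exists>xs ss r. length xs = d \<and> length ss = d \<and> (\<forall>i<d. xs ! i \<in> ideal_pow R M (ss ! i)) \<and>
    (\<forall>s\<in>set ss. 1 \<le> s) \<and>
    (\<forall>n\<ge>r. ideal_pow R M n \<subseteq> wsum R (ideal_pow R M) xs ss n <+> I \<and> shift_diff ss (rel_local.H R M I) n = 0)"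
  using assms
proof (induction d arbitrary: I)
  case 0
  interpret rel_local R M I
    by (intro rel_local.intro rel_local_axioms.intro noeth_local_axioms 0)
  have "\<not> prime_chain R I 1" using 0(3) by fastforce
  then obtain r where r: "ideal_pow R M r \<subseteq> I" using power_in_ideal_of_dim_0[OF I] by blast
  have Fn: "F n = I" if "r \<le> n" for n
    unfolding F_def using sum_absorb(1)[OF pow_ideal I] ideal_pow_antimono[OF M_ideal that] r by blast
  have "H n = 0" if "r \<le> n" for n
    using Fn[OF that] Fn[of "Suc n"] that ideal_len_same by (simp add: H_def zero_enat_def)
  moreover have "ideal_pow R M n \<subseteq> {\<zero>} <+> I" if "r \<le> n" for n
    using sum_absorb(1)[OF zeroideal I] idealD(2)[OF I] ideal_pow_antimono[OF M_ideal that] r by auto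
  ultimately show ?case by (intro exI[of _ "[]"] exI[of _ r]) simp
next
  case (Suc d)
  interpret rel_local R M I
    by (intro rel_local.intro rel_local_axioms.intro noeth_local_axioms Suc.prems(1))
  obtain s x c where sx: "1 \<le> s" "x \<in> ideal_pow R M s"
    "\<And>n a. c \<le> n \<Longrightarrow> a \<in> F n \<Longrightarrow> x \<otimes> a \<in> F (Suc (n + s)) \<Longrightarrow> a \<in> F (Suc n)"
    using superficial_exists by blast
  interpret S: superficial R M I s c x
    by (rule superficial.intro[OF rel_local_axioms superficial_axioms.intro[OF sx(1,2)]]) (rule sx(3))
  interpret J: rel_local R M S.I'
    by (intro rel_local.intro rel_local_axioms.intro noeth_local_axioms S.I'_ideal)
  have "\<exists>xs ss r. length xs = d \<and> length ss = d \<and> (\<forall>i<d. xs ! i \<in> ideal_pow R M (ss ! i)) \<and>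
    (\<forall>s\<in>set ss. 1 \<le> s) \<and>
    (\<forall>n\<ge>r. ideal_pow R M n \<subseteq> wsum R (ideal_pow R M) xs ss n <+> S.I' \<and> shift_diff ss J.H n = 0)"
    by (rule Suc.IH[OF S.I'_ideal S.I'_M[OF Suc.prems(2)]]) (rule S.dim_drop[OF Suc.prems(3)])
  then obtain xs ss r where IH0: "length xs = d" "length ss = d" "\<forall>i<d. xs ! i \<in> ideal_pow R M (ss ! i)"
    "\<forall>s\<in>set ss. 1 \<le> s"
    "\<forall>n\<ge>r. ideal_pow R M n \<subseteq> wsum R (ideal_pow R M) xs ss n <+> S.I' \<and> shift_diff ss J.H n = 0" by (elim exE conjE)
  have IH: "length xs = d" "length ss = d" "\<And>i. i < d \<Longrightarrow> xs ! i \<in> ideal_pow R M (ss ! i)"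
    "\<And>s. s \<in> set ss \<Longrightarrow> 1 \<le> s" "\<And>n. r \<le> n \<Longrightarrow> ideal_pow R M n \<subseteq> wsum R (ideal_pow R M) xs ss n <+> S.I'"
    "\<And>n. r \<le> n \<Longrightarrow> shift_diff ss J.H n = 0"
    using IH0 by simp_all
  obtain n0 where n0: "\<And>n b. n0 \<le> n \<Longrightarrow> b \<in> S.I' \<Longrightarrow> b \<in> F n \<Longrightarrow> \<exists>a\<in>ideal_pow R M (n - s). \<exists>i\<in>I. b = x \<otimes> a \<oplus> i"
    by (rule S.I'_inter) blast
  obtain n1 where "\<forall>n\<ge>n1. s \<le> n \<and> J.H n = H n - H (n - s)" using S.hilbert_diff by (elim exE)
  then have n1: "\<And>n. n1 \<le> n \<Longrightarrow> s \<le> n \<and> J.H n = H n - H (n - s)" by simp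
  \<comment> \<open>Large enough for the inclusion (\<open>r\<close>, \<open>n0\<close>), for the
    difference formula (\<open>n1\<close>) after all shifts in \<open>ss\<close>, and for no
    subtraction to truncate.\<close>
  define r' where "r' = r + n0 + n1 + s + sum_list ss"
  have xc: "set xs \<subseteq> carrier R"
  proof
    fix y assume "y \<in> set xs"
    then obtain j where "j < length xs" "y = xs ! j" by (auto simp: in_set_conv_nth)
    then show "y \<in> carrier R" using idealD(1)[OF pow_ideal IH(3)] IH(1) by simp
  qed
  have W: "ideal (wsum R (ideal_pow R M) xs ss n) R" for n
    by (rule wsum_ideal[OF pow_ideal xc]) (simp add: IH)
  have Wp: "wsum R (ideal_pow R M) xs ss n \<subseteq> ideal_pow R M n" for n
    by (rule wsum_pow) (use IH in simp_all)
  have red: "ideal_pow R M n \<subseteq> wsum R (ideal_pow R M) (x # xs) (s # ss) n <+> I" if n: "r' \<le> n" for n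
  proof
    fix b assume b: "b \<in> ideal_pow R M n"
    then have "b \<in> wsum R (ideal_pow R M) xs ss n <+> S.I'" using IH(5)[of n] n by (auto simp: r'_def)
    then obtain w i where w: "w \<in> wsum R (ideal_pow R M) xs ss n" "i \<in> S.I'" "b = w \<oplus> i"
      unfolding mem_sum_iff by blast
    have wF: "w \<in> F n" using w(1) Wp pow_F by blast
    have c1: "w \<in> carrier R" "i \<in> carrier R" using F_carrier[OF wF] idealD(1)[OF S.I'_ideal w(2)] .
    have "i \<in> F n" using ideal_add_cancel[OF F_ideal wF c1(2)] b w(3) pow_F by blast
    then obtain a j where a: "a \<in> ideal_pow R M (n - s)" "j \<in> I" "i = x \<otimes> a \<oplus> j"
      using n0[of n i] w(2) n by (auto simp: r'_def)
    have c2: "a \<in> carrier R" "j \<in> carrier R" using idealD(1)[OF pow_ideal a(1)] idealD(1)[OF I a(2)] .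
    have "b = (x \<otimes> a \<oplus> w) \<oplus> j" using w(3) a(3) c1 c2 S.xc by (simp add: a_ac)
    moreover have "x \<otimes> a \<oplus> w \<in> wsum R (ideal_pow R M) (x # xs) (s # ss) n"
      using a(1) w(1) by (auto simp: mem_sum_iff)
    ultimately show "b \<in> wsum R (ideal_pow R M) (x # xs) (s # ss) n <+> I" unfolding mem_sum_iff using a(2) by blast
  qed
  have dl: "shift_diff (s # ss) H n = 0" if n: "r' \<le> n" for n
  proof -
    have "shift_diff (s # ss) H n = shift_diff ss H n - shift_diff ss H (n - s)" using n by (simp add: r'_def)
    also have "\<dots> = shift_diff ss (\<lambda>m. H m - H (m - s)) n" using shift_diff_shift[of s ss n H] n by (simp add: r'_def)
    also have "\<dots> = shift_diff ss J.H n"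
      by (rule shift_diff_cong_tail) (use n n1 in \<open>auto simp: r'_def\<close>)
    also have "\<dots> = 0" using IH(6)[of n] n by (simp add: r'_def)
    finally show ?thesis .
  qed
  have "(x # xs) ! i \<in> ideal_pow R M ((s # ss) ! i)" if "i < Suc d" for i
    using IH(3)[of "i - 1"] sx(2) that by (cases i) auto
  then show ?case
    using IH sx(1) red dl by (intro exI[of _ "x # xs"] exI[of _ "s # ss"] exI[of _ r']) auto
qed

end

section \<open>Passage to a nearby ideal\<close>

context cring
begin

text \<open>The union of a set of cosets is its preimage in R. Union and image under the projection
  realise the correspondence of ideals.\<close>

lemma Union_proj:
  assumes "ideal J R" "ideal K R" "J \<subseteq> K"
  shows "\<Union> ((+>) J ` K) = K"
  using ideal_incl_iff[OF assms(1,2)] assms(3) by simp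

lemma proj_Union:
  assumes J: "ideal J R" and X: "ideal X (R Quot J)"
  shows "(+>) J ` (\<Union> X) = X"
proof -
  have Xc: "X \<subseteq> carrier (R Quot J)" using X by (meson additive_subgroup.a_subset ideal.axioms(1))
  show ?thesis
  proof (intro equalityI subsetI)
    fix y assume "y \<in> (+>) J ` (\<Union> X)"
    then obtain a where a: "a \<in> \<Union> X" "y = J +> a" by blast
    have "a \<in> carrier R" using canonical_proj_vimage_in_carrier[OF J Xc] a(1) by blast
    then show "y \<in> X" using canonical_proj_vimage_mem_iff[OF J Xc] a by simp
  next
    fix y assume y: "y \<in> X"
    then obtain a where a: "a \<in> carrier R" "y = J +> a"
      using Xc unfolding FactRing_def using A_RCOSETS_def'[of R J] by auto
    then have "a \<in> \<Union> X" using canonical_proj_vimage_mem_iff[OF J Xc] y by simp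
    then show "y \<in> (+>) J ` (\<Union> X)" using a by blast
  qed
qed

lemma Quot_carrier: "carrier (R Quot J) = (+>) J ` carrier R"
  unfolding FactRing_def using A_RCOSETS_def'[of R J] by auto

lemma quot_cring: "ideal J R \<Longrightarrow> cring (R Quot J)"
  by (rule ideal.quotient_is_cring[OF _ cring_axioms])

lemma ideal_mult_quot:
  assumes J: "ideal J R" and HK: "ideal H R" "ideal K R"
  shows "ideal_mult (R Quot J) ((+>) J ` H) ((+>) J ` K) = (+>) J ` (H \<cdot> K)"
proof -
  interpret Q: cring "R Quot J" by (rule quot_cring[OF J])
  interpret h: ring_hom_ring R "R Quot J" "(+>) J" by (rule ideal.rcos_ring_hom_ring[OF J])
  let ?S = "{i \<otimes>\<^bsub>R Quot J\<^esub> j |i j. i \<in> (+>) J ` H \<and> j \<in> (+>) J ` K}"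
  have Hc: "H \<subseteq> carrier R" "K \<subseteq> carrier R" using ideal_subset HK by auto
  have Sc: "?S \<subseteq> carrier (R Quot J)" using Hc h.hom_closed by blast
  have S1: "?S \<subseteq> (+>) J ` (H \<cdot> K)"
  proof
    fix y assume "y \<in> ?S"
    then obtain a b where ab: "a \<in> H" "b \<in> K" "y = (J +> a) \<otimes>\<^bsub>R Quot J\<^esub> (J +> b)" by blast
    have "a \<in> carrier R" "b \<in> carrier R" using subsetD[OF Hc(1) ab(1)] subsetD[OF Hc(2) ab(2)] .
    then have "y = J +> (a \<otimes> b)" unfolding ab(3) by (rule h.hom_mult[symmetric])
    then show "y \<in> (+>) J ` (H \<cdot> K)" using ideal_prod.prod[OF ab(1,2), of R] by (rule image_eqI)
  qed
  have I: "ideal ((+>) J ` (H \<cdot> K)) (R Quot J)"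
    by (rule ring_ideal_imp_quot_ideal[OF J ideal_prod_is_ideal[OF HK]])
  have G: "ideal (genideal (R Quot J) ?S) (R Quot J)" by (rule Q.genideal_ideal[OF Sc])
  have "(J +> x) \<in> genideal (R Quot J) ?S" if "x \<in> H \<cdot> K" for x
    using that
  proof (induction rule: ideal_prod.induct)
    case (prod i j)
    have "J +> (i \<otimes> j) = (J +> i) \<otimes>\<^bsub>R Quot J\<^esub> (J +> j)" 
      by (rule h.hom_mult[OF subsetD[OF Hc(1) prod(1)] subsetD[OF Hc(2) prod(2)]])
    then have "J +> (i \<otimes> j) \<in> ?S" using prod by blast
    then show ?case by (rule subsetD[OF Q.genideal_self[OF Sc]])
  next
    case (sum s1 s2)
    have "s1 \<in> carrier R" "s2 \<in> carrier R" using sum ideal_prod_in_carrier[OF HK] by auto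
    then show ?case using Q.idealD(3)[OF G sum(3,4)] by simp
  qed
  then show ?thesis
    unfolding ideal_mult_def using Q.genideal_minimal[OF I S1] by blast
qed

lemma ideal_pow_quot:
  assumes J: "ideal J R" and M: "ideal M R"
  shows "ideal_pow (R Quot J) ((+>) J ` M) n = (+>) J ` ideal_pow R M n"
proof (induction n)
  case 0
  show ?case by (simp add: Quot_carrier)
next
  case (Suc n)
  show ?case
    using ideal_mult_quot[OF J M ideal_pow_ideal[OF M], of n] Suc
    by (simp add: ideal_pow_Suc[OF M] ideal_pow.simps(2)[of "R Quot J"])
qed

lemma proj_absorb:
  assumes J: "ideal J R" and K: "ideal K R"
  shows "(+>) J ` (K <+> J) = (+>) J ` K"
proof (intro equalityI subsetI)
  fix y assume "y \<in> (+>) J ` (K <+> J)"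
  then obtain k j where kj: "k \<in> K" "j \<in> J" "y = J +> (k \<oplus> j)" by (auto simp: mem_sum_iff)
  have c: "k \<in> carrier R" "j \<in> carrier R" using idealD(1)[OF K kj(1)] idealD(1)[OF J kj(2)] .
  have "(k \<oplus> j) \<ominus> k \<in> J" using add_minus_cancel[OF c] kj(2) by simp
  then have "y = J +> k" using coset_eq_iff[OF J] c kj(3) by simp
  then show "y \<in> (+>) J ` K" using kj(1) by blast
next
  fix y assume "y \<in> (+>) J ` K"
  then show "y \<in> (+>) J ` (K <+> J)" using sum_upper(1)[OF K J] by blast
qed

lemma proj_prime:
  assumes J: "ideal J R" and P: "primeideal P R" "J \<subseteq> P"
  shows "primeideal ((+>) J ` P) (R Quot J)"
proof -
  interpret P: primeideal P R by (rule P(1))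
  interpret h: ring_hom_ring R "R Quot J" "(+>) J" by (rule ideal.rcos_ring_hom_ring[OF J])
  have U: "\<Union> ((+>) J ` P) = P" by (rule Union_proj[OF J P.is_ideal P(2)])
  have i: "ideal ((+>) J ` P) (R Quot J)" by (rule ring_ideal_imp_quot_ideal[OF J P.is_ideal])
  have sub: "(+>) J ` P \<subseteq> carrier (R Quot J)" using i by (meson additive_subgroup.a_subset ideal.axioms(1))
  have mem: "J +> a \<in> (+>) J ` P \<longleftrightarrow> a \<in> P" if "a \<in> carrier R" for a
    using canonical_proj_vimage_mem_iff[OF J sub that] U by simp
  show ?thesis
  proof (rule primeidealI[OF i quot_cring[OF J]])
    have "\<one> \<notin> P" using P.one_imp_carrier P.I_notcarr by blast
    then have "J +> \<one> \<notin> (+>) J ` P" using mem[OF one_closed] by blast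
    moreover have "J +> \<one> \<in> carrier (R Quot J)" by (rule h.hom_closed[OF one_closed])
    ultimately show "carrier (R Quot J) \<noteq> (+>) J ` P" by metis
    fix a b assume "a \<in> carrier (R Quot J)" "b \<in> carrier (R Quot J)" and ab: "a \<otimes>\<^bsub>R Quot J\<^esub> b \<in> (+>) J ` P"
    then obtain r s where rs: "r \<in> carrier R" "s \<in> carrier R" "a = J +> r" "b = J +> s" unfolding Quot_carrier by blast
    have "J +> (r \<otimes> s) \<in> (+>) J ` P" 
      using ab unfolding rs(3,4) h.hom_mult[OF rs(1,2)] .
    then have "r \<otimes> s \<in> P" using mem[OF m_closed[OF rs(1,2)]] by blast
    then have "r \<in> P \<or> s \<in> P" by (rule P.I_prime[OF rs(1,2)])
    then show "a \<in> (+>) J ` P \<or> b \<in> (+>) J ` P" unfolding rs(3,4) by blast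
  qed
qed

text \<open>Distinct primes over \<open>J\<close> have distinct images, because the union of the
  cosets recovers the prime.\<close>

lemma krull_dim_quot_bound:
  assumes J: "ideal J R" and d: "krull_dim (R Quot J) = enat d" and chain: "prime_chain R J k"
  shows "k \<le> d"
proof -
  obtain P where P: "\<And>i. i \<le> k \<Longrightarrow> primeideal (P i) R" "\<And>i. i \<le> k \<Longrightarrow> J \<subseteq> P i" "\<And>i. i < k \<Longrightarrow> P i \<subset> P (Suc i)"
    using chain unfolding prime_chain_def by blast
  have U: "\<Union> ((+>) J ` P i) = P i" if "i \<le> k" for i
    by (rule Union_proj[OF J primeideal.axioms(1)[OF P(1)[OF that]] P(2)[OF that]])
  have "(+>) J ` P i \<subset> (+>) J ` P (Suc i)" if i: "i < k" for i
  proof -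
    have "(+>) J ` P i \<subseteq> (+>) J ` P (Suc i)" using P(3)[OF i] by blast
    moreover have "(+>) J ` P i \<noteq> (+>) J ` P (Suc i)"
    proof
      assume "(+>) J ` P i = (+>) J ` P (Suc i)"
      then have "P i = P (Suc i)" using U[OF less_imp_le[OF i]] U[OF Suc_leI[OF i]] by metis
      then show False using P(3)[OF i] by blast
    qed
    ultimately show ?thesis by blast
  qed
  then have "\<exists>Q :: nat \<Rightarrow> 'a set set. (\<forall>i\<le>k. primeideal (Q i) (R Quot J)) \<and> (\<forall>i<k. Q i \<subset> Q (Suc i))"
    using proj_prime[OF J P(1,2)] by (intro exI[of _ "\<lambda>i. (+>) J ` P i"]) simp
  then have "enat k \<le> krull_dim (R Quot J)" unfolding krull_dim_def by (intro Sup_upper) blast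
  then show ?thesis using d by simp
qed

lemma wsum_proj:
  assumes J: "ideal J R" and F: "\<And>n. ideal (F n) R" and xs: "set xs \<subseteq> carrier R" and len: "length ss = length xs"
  shows "(+>) J ` wsum R F xs ss n \<subseteq> wsum (R Quot J) (\<lambda>n. (+>) J ` F n) (map ((+>) J) xs) ss n"
  using xs len
proof (induction xs arbitrary: ss)
  case Nil
  interpret h: ring_hom_ring R "R Quot J" "(+>) J" by (rule ideal.rcos_ring_hom_ring[OF J])
  show ?case using h.hom_zero by simp
next
  case (Cons x xs)
  interpret Q: cring "R Quot J" by (rule quot_cring[OF J])
  interpret h: ring_hom_ring R "R Quot J" "(+>) J" by (rule ideal.rcos_ring_hom_ring[OF J])
  obtain s ss' where ss: "ss = s # ss'" using Cons.prems by (cases ss) auto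
  have x: "x \<in> carrier R" and xs: "set xs \<subseteq> carrier R" using Cons.prems by auto
  show ?case
  proof
    fix y assume "y \<in> (+>) J ` wsum R F (x # xs) ss n"
    then obtain a v where av: "a \<in> F (n - s)" "v \<in> wsum R F xs ss' n" "y = J +> (x \<otimes> a \<oplus> v)"
      unfolding ss by (auto simp: mem_sum_iff)
    have W: "ideal (wsum R F xs ss' n) R" by (rule wsum_ideal[OF F xs]) (use Cons.prems ss in simp)
    have c: "a \<in> carrier R" "v \<in> carrier R" using idealD(1)[OF F av(1)] idealD(1)[OF W av(2)] .
    have "y = (J +> x) \<otimes>\<^bsub>R Quot J\<^esub> (J +> a) \<oplus>\<^bsub>R Quot J\<^esub> (J +> v)" using av(3) c x by simp
    moreover have "J +> v \<in> wsum (R Quot J) (\<lambda>n. (+>) J ` F n) (map ((+>) J) xs) ss' n"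
      using Cons.IH[OF xs, of ss'] Cons.prems ss av(2) by auto
    ultimately show "y \<in> wsum (R Quot J) (\<lambda>n. (+>) J ` F n) (map ((+>) J) (x # xs)) ss n"
      unfolding ss using av(1) by (auto simp: Q.mem_sum_iff)
  qed
qed

end

context noeth_local
begin

lemma quot_maximal:
  assumes J: "ideal J R" "J \<subseteq> M"
  shows "maximalideal ((+>) J ` M) (R Quot J)" "\<And>P. maximalideal P (R Quot J) \<Longrightarrow> P = (+>) J ` M"
proof -
  interpret Q: cring "R Quot J" by (rule quot_cring[OF J(1)])
  have UM: "\<Union> ((+>) J ` M) = M" by (rule Union_proj[OF J(1) M_ideal J(2)])
  have UC: "\<Union> (carrier (R Quot J)) = carrier R"
    unfolding Quot_carrier by (rule Union_proj[OF J(1) oneideal ideal_subset[OF J(1)]])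
  have Mi: "ideal ((+>) J ` M) (R Quot J)" by (rule ring_ideal_imp_quot_ideal[OF J(1) M_ideal])
  have Mne: "carrier (R Quot J) \<noteq> (+>) J ` M" using UM UC M_proper by metis
  have sub: "X \<subseteq> (+>) J ` M" if X: "ideal X (R Quot J)" "X \<noteq> carrier (R Quot J)" for X
  proof -
    have "\<Union> X \<noteq> carrier R" using proj_Union[OF J(1) X(1)] X(2) Quot_carrier by metis
    then have "\<Union> X \<subseteq> M" using proper_subset_M[OF quot_ideal_imp_ring_ideal[OF J(1) X(1)]] by blast
    then have "(+>) J ` \<Union> X \<subseteq> (+>) J ` M" by (rule image_mono)
    then show ?thesis unfolding proj_Union[OF J(1) X(1)] .
  qed
  show "maximalideal ((+>) J ` M) (R Quot J)"
  proof (rule maximalidealI[OF Mi Mne])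
    fix X assume X: "ideal X (R Quot J)" "(+>) J ` M \<subseteq> X"
    show "X = (+>) J ` M \<or> X = carrier (R Quot J)"
    proof (cases "X = carrier (R Quot J)")
      case False
      show ?thesis by (rule disjI1, rule equalityI[OF sub[OF X(1) False] X(2)])
    qed simp
  qed
  fix P assume P: "maximalideal P (R Quot J)"
  have Pi: "ideal P (R Quot J)" and Pne: "P \<noteq> carrier (R Quot J)"
    using P maximalideal.I_notcarr[OF P] by (auto simp: maximalideal_def)
  have "(+>) J ` M = P \<or> (+>) J ` M = carrier (R Quot J)"
    by (rule maximalideal.I_maximal[OF P Mi sub[OF Pi Pne] Q.ideal_subset[OF Mi]])
  then show "P = (+>) J ` M" using Mne by (elim disjE) simp_all
qed

lemma max_ideal_quot:
  assumes J: "ideal J R" "J \<subseteq> M"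
  shows "max_ideal (R Quot J) = (+>) J ` M"
  unfolding max_ideal_def by (rule the_equality, rule quot_maximal(1)[OF J], rule quot_maximal(2)[OF J])

text \<open>Ideals of the quotient between two consecutive powers of its maximal ideal correspond to
  ideals of R between the preimages of these powers.\<close>

lemma hilbert_function_quot:
  assumes J: "ideal J R" "J \<subseteq> M"
  shows "hilbert_function (R Quot J) n = ideal_len (rel_local.F R M J (Suc n)) (rel_local.F R M J n)"
proof -
  interpret J: rel_local R M J by (intro rel_local.intro rel_local_axioms.intro noeth_local_axioms J(1))
  have img: "ideal_pow (R Quot J) (max_ideal (R Quot J)) k = (+>) J ` J.F k" for k
    unfolding max_ideal_quot[OF J] ideal_pow_quot[OF J(1) M_ideal] J.F_def proj_absorb[OF J(1) pow_ideal] ..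
  have U: "\<Union> ((+>) J ` J.F k) = J.F k" for k by (rule Union_proj[OF J(1) J.F_ideal J.I_F])
  have "hilbert_function (R Quot J) n =
      chain_len {I. ideal I (R Quot J)} ((+>) J ` J.F (Suc n)) ((+>) J ` J.F n)"
    unfolding hilbert_function_def chain_len_def img by simp
  also have "\<dots> = ideal_len (J.F (Suc n)) (J.F n)"
    unfolding ideal_len_def
  proof (rule chain_len_cong_iso[where f = Union and g = "\<lambda>K. (+>) J ` K"])
    fix Z assume Z: "Z \<in> {I. ideal I (R Quot J)}" "(+>) J ` J.F (Suc n) \<subseteq> Z" "Z \<subseteq> (+>) J ` J.F n"
    then show "\<Union> Z \<in> {I. ideal I R} \<and> J.F (Suc n) \<subseteq> \<Union> Z \<and> \<Union> Z \<subseteq> J.F n \<and> (+>) J ` \<Union> Z = Z"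
      using quot_ideal_imp_ring_ideal[OF J(1)] proj_Union[OF J(1)] Union_mono[OF Z(2)] Union_mono[OF Z(3)]
      unfolding U by simp
  next
    fix Z assume Z: "Z \<in> {I. ideal I R}" "J.F (Suc n) \<subseteq> Z" "Z \<subseteq> J.F n"
    have "J \<subseteq> Z" using J.I_F Z(2) by blast
    then show "(+>) J ` Z \<in> {I. ideal I (R Quot J)} \<and> (+>) J ` J.F (Suc n) \<subseteq> (+>) J ` Z \<and>
        (+>) J ` Z \<subseteq> (+>) J ` J.F n \<and> \<Union> ((+>) J ` Z) = Z"
      using ring_ideal_imp_quot_ideal[OF J(1)] Union_proj[OF J(1)] Z by (simp add: image_mono)
  next
    show "(+>) J ` J.F (Suc n) \<subseteq> (+>) J ` J.F n" using J.F_antimono[of n "Suc n"] by (simp add: image_mono)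
  qed (use J.F_ideal ring_ideal_imp_quot_ideal[OF J(1)] J.F_antimono[of n "Suc n"] in \<open>auto intro: image_mono\<close>)
  finally show ?thesis .
qed

lemma wsum_shift:
  assumes "set xs \<subseteq> carrier R" "length ss = length xs" "m \<in> ideal_pow R M t" "w \<in> wsum R (ideal_pow R M) xs ss n"
  shows "m \<otimes> w \<in> wsum R (ideal_pow R M) xs ss (t + n)"
  using assms(1,2,4)
proof (induction xs arbitrary: ss w)
  case Nil
  then show ?case using idealD(1)[OF pow_ideal assms(3)] by simp
next
  case (Cons x xs)
  have mc: "m \<in> carrier R" using idealD(1)[OF pow_ideal assms(3)] .
  obtain s ss' where ss: "ss = s # ss'" using Cons.prems by (cases ss) auto
  have x: "x \<in> carrier R" and xs: "set xs \<subseteq> carrier R" using Cons.prems by auto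
  obtain a v where av: "a \<in> ideal_pow R M (n - s)" "v \<in> wsum R (ideal_pow R M) xs ss' n" "w = x \<otimes> a \<oplus> v"
    using Cons.prems(3) unfolding ss by (auto simp: mem_sum_iff)
  have W: "ideal (wsum R (ideal_pow R M) xs ss' n) R" by (rule wsum_ideal[OF pow_ideal xs]) (use Cons.prems ss in simp)
  have c: "a \<in> carrier R" "v \<in> carrier R" using idealD(1)[OF pow_ideal av(1)] idealD(1)[OF W av(2)] .
  have "m \<otimes> w = x \<otimes> (m \<otimes> a) \<oplus> m \<otimes> v" using mc c x av(3) by (simp add: r_distr m_lcomm)
  moreover have "m \<otimes> a \<in> ideal_pow R M (t + n - s)"
    by (rule subsetD[OF ideal_pow_antimono[OF M_ideal] ideal_pow_mult_mem[OF M_ideal assms(3) av(1)]]) simp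
  moreover have "m \<otimes> v \<in> wsum R (ideal_pow R M) xs ss' (t + n)" by (rule Cons.IH[OF xs _ av(2)]) (use Cons.prems ss in simp)
  ultimately show ?case unfolding ss by (auto simp: mem_sum_iff)
qed

text \<open>Nakayama's lemma is used in degree \<open>r\<close> only: the error M^(r+1) is M times
  M^r, which is why agreement modulo M^(r+1) suffices. Higher degrees follow on multiplying by
  powers of \<open>M\<close>.\<close>

lemma reduction_transfer:
  assumes I: "ideal I R" and J: "ideal J R" and xs: "set xs \<subseteq> carrier R" "length ss = length xs"
    and red: "ideal_pow R M r \<subseteq> wsum R (ideal_pow R M) xs ss r <+> I"
    and eq: "I <+> ideal_pow R M (Suc r) = J <+> ideal_pow R M (Suc r)"
    and n: "r \<le> n"
  shows "ideal_pow R M n \<subseteq> wsum R (ideal_pow R M) xs ss n <+> J"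
proof -
  have W: "ideal (wsum R (ideal_pow R M) xs ss k) R" for k by (rule wsum_ideal[OF pow_ideal xs])
  have WJ: "ideal (wsum R (ideal_pow R M) xs ss k <+> J) R" for k by (rule add_ideals[OF W J])
  have "I \<subseteq> J <+> ideal_pow R M (Suc r)" using sum_upper(1)[OF I pow_ideal] eq by blast
  then have "ideal_pow R M r \<subseteq> wsum R (ideal_pow R M) xs ss r <+> (J <+> ideal_pow R M (Suc r))"
    using red sum_mono[OF order_refl, of I "J <+> ideal_pow R M (Suc r)"] by blast
  then have "ideal_pow R M r \<subseteq> (wsum R (ideal_pow R M) xs ss r <+> J) <+> M \<cdot> ideal_pow R M r"
    unfolding sum_assoc[OF W J pow_ideal[of "Suc r"], of r] ideal_pow_Suc[OF M_ideal, of r, symmetric] .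
  then have r: "ideal_pow R M r \<subseteq> wsum R (ideal_pow R M) xs ss r <+> J"
    by (rule nakayama[OF pow_ideal WJ])
  have "\<forall>h\<in>ideal_pow R M (n - r). \<forall>k\<in>ideal_pow R M r. h \<otimes> k \<in> wsum R (ideal_pow R M) xs ss n <+> J"
  proof (intro ballI)
    fix h k assume h: "h \<in> ideal_pow R M (n - r)" and "k \<in> ideal_pow R M r"
    then have "k \<in> wsum R (ideal_pow R M) xs ss r <+> J" using r by blast
    then obtain w j where wj: "w \<in> wsum R (ideal_pow R M) xs ss r" "j \<in> J" "k = w \<oplus> j" unfolding mem_sum_iff by blast
    have c: "h \<in> carrier R" "w \<in> carrier R" "j \<in> carrier R"
      using idealD(1)[OF pow_ideal h] idealD(1)[OF W wj(1)] idealD(1)[OF J wj(2)] .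
    have "h \<otimes> w \<in> wsum R (ideal_pow R M) xs ss n" using wsum_shift[OF xs h wj(1)] n by simp
    moreover have "h \<otimes> j \<in> J" by (rule idealD(6)[OF J c(1) wj(2)])
    moreover have "h \<otimes> k = h \<otimes> w \<oplus> h \<otimes> j" using c wj(3) by (simp add: r_distr)
    ultimately show "h \<otimes> k \<in> wsum R (ideal_pow R M) xs ss n <+> J" unfolding mem_sum_iff by blast
  qed
  then have "ideal_pow R M (n - r) \<cdot> ideal_pow R M r \<subseteq> wsum R (ideal_pow R M) xs ss n <+> J"
    using prod_subset_iff[OF pow_ideal pow_ideal WJ] by simp
  then show ?thesis using ideal_pow_add[OF M_ideal, of "n - r" r] n by simp
qed

lemma same_F:
  assumes I: "ideal I R" and J: "ideal J R" and eq: "I <+> ideal_pow R M N = J <+> ideal_pow R M N" and k: "k \<le> N"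
  shows "ideal_pow R M k <+> I = ideal_pow R M k <+> J"
proof -
  have "ideal_pow R M k <+> A \<subseteq> ideal_pow R M k <+> B"
    if A: "ideal A R" and B: "ideal B R" and e: "A <+> ideal_pow R M N = B <+> ideal_pow R M N" for A B
  proof -
    have "A \<subseteq> B <+> ideal_pow R M N" using sum_upper(1)[OF A pow_ideal] e by blast
    also have "\<dots> \<subseteq> B <+> ideal_pow R M k" by (rule sum_mono[OF order_refl ideal_pow_antimono[OF M_ideal k]])
    also have "\<dots> = ideal_pow R M k <+> B" by (rule sum_comm[OF B pow_ideal])
    finally show ?thesis
      using sum_subset_iff[OF pow_ideal A add_ideals[OF pow_ideal B]] sum_upper(1)[OF pow_ideal B] by simp
  qed
  then show ?thesis using I J eq by blast
qed

text \<open>The Koszul setting is entered at R/J with the images of the \<open>xs\<close>. Their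
  number is the dimension, so the Cohen-Macaulay property provides the depth that exactness in
  degree 1 requires.\<close>

lemma cm_quotient_recursion:
  assumes J: "ideal J R" "J \<subseteq> M" and cm: "cohen_macaulay (R Quot J)"
    and dim: "krull_dim (R Quot J) = enat (length xs)" and gr: "depth_gr (R Quot J) \<ge> enat (length xs - 1)"
    and len: "length ss = length xs" and x: "\<And>i. i < length xs \<Longrightarrow> xs ! i \<in> ideal_pow R M (ss ! i)"
    and red: "\<And>n. r \<le> n \<Longrightarrow> ideal_pow R M n \<subseteq> wsum R (ideal_pow R M) xs ss n <+> J"
    and n: "r \<le> n"
  shows "shift_diff ss (rel_local.H R M J) n = 0"
proof -
  interpret J: rel_local R M J by (intro rel_local.intro rel_local_axioms.intro noeth_local_axioms J(1))
  let ?B = "R Quot J" and ?m = "(+>) J ` M"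
  have xc: "set xs \<subseteq> carrier R"
  proof
    fix y assume "y \<in> set xs"
    then obtain j where "j < length xs" "y = xs ! j" by (auto simp: in_set_conv_nth)
    then show "y \<in> carrier R" using idealD(1)[OF pow_ideal x] by simp
  qed
  interpret B: noeth_local ?B ?m
  proof (intro noeth_local.intro noeth_local_axioms.intro)
    show "cring ?B" by (rule quot_cring[OF J(1)])
    show "noetherian_ring ?B" using cm by (simp add: cohen_macaulay_def noetherian_local_ring_def)
  qed (rule quot_maximal[OF J], rule quot_maximal(2)[OF J])
  have pow: "ideal_pow ?B ?m k = (+>) J ` ideal_pow R M k" for k by (rule ideal_pow_quot[OF J(1) M_ideal])
  have "koszul_setting ?B ?m (map ((+>) J) xs) ss r"
  proof (rule B.depth_koszul_setting)
    show "length ss = length (map ((+>) J) xs)" using len by simp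
    show "map ((+>) J) xs ! i \<in> ideal_pow ?B ?m (ss ! i)" if "i < length (map ((+>) J) xs)" for i
      using x[of i] that unfolding pow by simp
    show "enat (length (map ((+>) J) xs)) \<le> depth ?B ?m"
      using cm dim by (simp add: cohen_macaulay_def max_ideal_quot[OF J])
    show "enat (length (map ((+>) J) xs) - 1) \<le> depth (assoc_graded ?B ?m) (gr_hom_max_ideal ?B ?m)"
      using gr by (simp add: depth_gr_def max_ideal_quot[OF J])
    fix k assume k: "r \<le> k"
    have W: "ideal (wsum R (ideal_pow R M) xs ss k) R" by (rule wsum_ideal[OF pow_ideal xc len])
    have "(+>) J ` ideal_pow R M k \<subseteq> (+>) J ` (wsum R (ideal_pow R M) xs ss k <+> J)" by (rule image_mono[OF red[OF k]])
    also have "\<dots> = (+>) J ` wsum R (ideal_pow R M) xs ss k" by (rule proj_absorb[OF J(1) W])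
    also have "\<dots> \<subseteq> wsum ?B (\<lambda>n. (+>) J ` ideal_pow R M n) (map ((+>) J) xs) ss k"
      by (rule wsum_proj[OF J(1) pow_ideal xc len])
    also have "(\<lambda>n. (+>) J ` ideal_pow R M n) = ideal_pow ?B ?m" using pow by auto
    finally show "ideal_pow ?B ?m k \<subseteq> wsum ?B (ideal_pow ?B ?m) (map ((+>) J) xs) ss k" unfolding pow[of k] .
  qed
  then have "shift_diff ss B.hf n = 0" using koszul_setting.hilbert_shift_diff n by blast
  moreover have "B.hf = J.H"
    by (rule ext) (simp add: B.hf_def J.H_def hilbert_function_quot[OF J])
  ultimately show ?thesis by simp
qed

text \<open>\<open>cohen_macaulay\<close> includes the existence of a maximal ideal, and the zero
  ring has none.\<close>

lemma cm_quot_proper: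
  assumes J: "ideal J R" and cm: "cohen_macaulay (R Quot J)"
  shows "J \<subseteq> M"
proof (rule proper_subset_M[OF J], rule notI)
  assume JR: "J = carrier R"
  have "\<exists>P. maximalideal P (R Quot J)"
    using cm by (auto simp: cohen_macaulay_def noetherian_local_ring_def local_ring_def)
  then obtain P where P: "maximalideal P (R Quot J)" by blast
  then have Pi: "ideal P (R Quot J)" by (simp add: maximalideal_def)
  have "J \<in> P" using cring.idealD(2)[OF quot_cring[OF J] Pi] by (simp add: FactRing_def)
  then have "J \<subseteq> \<Union> P" by blast
  then have "\<Union> P = carrier R" using JR ideal_subset[OF quot_ideal_imp_ring_ideal[OF J Pi]] by blast
  then have "P = carrier (R Quot J)" using proj_Union[OF J Pi] Quot_carrier by metis
  then show False using maximalideal.I_notcarr[OF P] by blast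
qed

lemma hilbert_function_stable:
  assumes I: "ideal I R"
  shows "\<exists>N::nat. N > 0 \<and>
    (\<forall>J (d::nat). ideal J R \<longrightarrow> I <+> ideal_pow R M N = J <+> ideal_pow R M N \<longrightarrow>
       krull_dim (R Quot J) = enat d \<longrightarrow> krull_dim (R Quot I) = enat d \<longrightarrow> cohen_macaulay (R Quot J) \<longrightarrow>
       depth_gr (R Quot J) \<ge> enat (d - 1) \<longrightarrow> hilbert_function (R Quot I) = hilbert_function (R Quot J))"
proof -
  consider (full) "I = carrier R" | (inf) "I \<noteq> carrier R" "\<nexists>d. krull_dim (R Quot I) = enat d"
    | (fin) d0 where "I \<noteq> carrier R" "krull_dim (R Quot I) = enat d0" by blast
  then show ?thesis
  proof cases
    case full
    \<comment> \<open>N = 1 leaves no J to consider: a Cohen-Macaulay quotient forces J into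
      \<open>M\<close>, while I + M is the whole ring.\<close>
    have "I <+> ideal_pow R M 1 \<noteq> J <+> ideal_pow R M 1" if "ideal J R" "J \<subseteq> M" for J
    proof
      assume e: "I <+> ideal_pow R M 1 = J <+> ideal_pow R M 1"
      have "J <+> M \<subseteq> M" using sum_subset_iff[OF that(1) M_ideal M_ideal] that(2) by simp
      moreover have "I \<subseteq> I <+> M" by (rule sum_upper(1)[OF I M_ideal])
      ultimately have "carrier R \<subseteq> M" using e full ideal_pow_1[OF M_ideal] by auto
      then show False using M_proper ideal_subset[OF M_ideal] by blast
    qed
    then show ?thesis using cm_quot_proper by (intro exI[of _ 1]) auto
  next
    case inf
    \<comment> \<open>No J qualifies, since a finite dimension of R/I is among the
      conditions.\<close>
    then show ?thesis by (intro exI[of _ 1]) auto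
  next
    case fin
    have IM: "I \<subseteq> M" by (rule proper_subset_M[OF I fin(1)])
    interpret I: rel_local R M I by (intro rel_local.intro rel_local_axioms.intro noeth_local_axioms I)
    have "\<exists>xs ss r. length xs = d0 \<and> length ss = d0 \<and> (\<forall>i<d0. xs ! i \<in> ideal_pow R M (ss ! i)) \<and>
        (\<forall>s\<in>set ss. 1 \<le> s) \<and>
        (\<forall>n\<ge>r. ideal_pow R M n \<subseteq> wsum R (ideal_pow R M) xs ss n <+> I \<and> shift_diff ss I.H n = 0)"
      by (rule parameters_exist[OF I IM]) (rule krull_dim_quot_bound[OF I fin(2)])
    then obtain xs ss r where len: "length xs = d0" "length ss = d0"
      and x: "\<forall>i<d0. xs ! i \<in> ideal_pow R M (ss ! i)" and pos: "\<forall>s\<in>set ss. 1 \<le> s"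
      and red: "\<forall>n\<ge>r. ideal_pow R M n \<subseteq> wsum R (ideal_pow R M) xs ss n <+> I \<and> shift_diff ss I.H n = 0"
      by (elim exE conjE)
    have xc: "set xs \<subseteq> carrier R"
    proof
      fix y assume "y \<in> set xs"
      then obtain j where j: "j < length xs" "y = xs ! j" by (auto simp: in_set_conv_nth)
      have "xs ! j \<in> ideal_pow R M (ss ! j)" using x j len by simp
      then show "y \<in> carrier R" unfolding j(2) by (rule idealD(1)[OF pow_ideal])
    qed
    have "hilbert_function (R Quot I) = hilbert_function (R Quot J)"
      if J: "ideal J R" and eq: "I <+> ideal_pow R M (Suc r) = J <+> ideal_pow R M (Suc r)"
        and dim: "krull_dim (R Quot J) = enat d" "krull_dim (R Quot I) = enat d"
        and cm: "cohen_macaulay (R Quot J)" and gr: "depth_gr (R Quot J) \<ge> enat (d - 1)" for J d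
    proof -
      have d: "d = length xs" using dim fin len by simp
      have JM: "J \<subseteq> M" by (rule cm_quot_proper[OF J cm])
      interpret J: rel_local R M J by (intro rel_local.intro rel_local_axioms.intro noeth_local_axioms J)
      have redJ: "ideal_pow R M n \<subseteq> wsum R (ideal_pow R M) xs ss n <+> J" if "r \<le> n" for n
        by (rule reduction_transfer[OF I J xc _ _ eq that]) (use len red in simp_all)
      have DJ: "shift_diff ss J.H n = 0" if "r \<le> n" for n
        by (rule cm_quotient_recursion[OF J JM cm _ _ _ _ redJ that]) (use dim gr d len x in simp_all)
      have FF: "I.F k = J.F k" if "k \<le> Suc r" for k
        unfolding I.F_def J.F_def by (rule same_F[OF I J eq that])
      have "I.H n = J.H n" for n
      proof (rule shift_diff_determines[where N = "Suc r" and ss = ss])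
        \<comment> \<open>The value at k compares \<open>F k\<close> with \<open>F (Suc k)\<close>,
          so agreement modulo M^(r+1) reaches up to k = r.\<close>
        show "I.H k = J.H k" if "k < Suc r" for k
          using FF[of k] FF[of "Suc k"] that by (simp add: I.H_def J.H_def)
      qed (use red DJ pos in auto)
      then show ?thesis
        by (intro ext) (simp add: hilbert_function_quot[OF I IM] hilbert_function_quot[OF J JM] I.ideal_len_H J.ideal_len_H)
    qed
    then show ?thesis by (intro exI[of _ "Suc r"]) blast
  qed
qed

end

theorem theorem4p5:
  fixes R :: "('a, 'b) ring_scheme" and I :: "'a set"
  assumes "noetherian_local_ring R"
    and "ideal I R"
  shows "\<exists>N::nat. N > 0 \<and>
    (\<forall>J (d::nat). ideal J R \<longrightarrow>
       I <+>\<^bsub>R\<^esub> ideal_pow R (max_ideal R) N = J <+>\<^bsub>R\<^esub> ideal_pow R (max_ideal R) N \<longrightarrow>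
       krull_dim (R Quot J) = enat d \<longrightarrow>
       krull_dim (R Quot I) = enat d \<longrightarrow>
       cohen_macaulay (R Quot J) \<longrightarrow>
       depth_gr (R Quot J) \<ge> enat (d - 1) \<longrightarrow>
       hilbert_function (R Quot I) = hilbert_function (R Quot J))"
proof -
  have nr: "noetherian_ring R" "cring R" and "\<exists>!M. maximalideal M R"
    using assms(1) by (auto simp: noetherian_local_ring_def local_ring_def)
  then obtain M where M: "maximalideal M R" "\<And>P. maximalideal P R \<Longrightarrow> P = M" by blast
  interpret noeth_local R M by (intro noeth_local.intro noeth_local_axioms.intro nr M)
  show ?thesis unfolding max_ideal_eq by (rule hilbert_function_stable[OF assms(2)])
qed

end
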